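(* Let $\alpha\ge0$, $1\le p<\infty$, and $\beta,\mu\in\mathbb{R}$ with $0<\beta-\frac1p<\mu$, and let $\mathcal{S}_{\beta,\mu}:\mathcal{T}_p^{(\alpha)}(t^\alpha)\to\mathcal{T}_p^{(\alpha)}(t^\alpha)$ be the generalized Stieltjes operator $$\mathcal{S}_{\beta,\mu}f(t)=t^{\mu-\beta}\int_0^\infty\frac{s^{\beta-1}}{(s+t)^\mu}f(s)\,ds,\qquad t>0.$$ Then its spectrum is $$\sigma(\mathcal{S}_{\beta,\mu})=\left\{B\!\left(\beta-\tfrac1p+i\xi,\ \mu-\beta+\tfrac1p-i\xi\right):\ \xi\in\mathbb{R}\right\}\cup\{0\}.$$
   Context: $B(z,w)=\Gamma(z)\Gamma(w)/\Gamma(z+w)$ is the Beta function; all spaces consist of complex-valued functions. Let $\mathcal{S}_+$ be the Schwartz class on $[0,\infty)$. For $f\in\mathcal{S}_+$ and $\alpha>0$ put $W_+^{-\alpha}f(t)=\frac1{\Gamma(\alpha)}\int_t^\infty(s-t)^{\alpha-1}f(s)\,ds$ and $W_+^{\alpha}f(t)=(-1)^n\frac{d^n}{dt^n}W_+^{-(n-\alpha)}f(t)$ with $n=[\alpha]+1$; $W_+^0=\mathrm{Id}$. For $1\le p<\infty$ and $\alpha>0$, $\mathcal{T}_p^{(\alpha)}(t^\alpha)$ is the completion of $\mathcal{S}_+$ in the norm $\|f\|_{\alpha,p}=\frac1{\Gamma(\alpha+1)}\left(\int_0^\infty|W_+^\alpha f(t)|^p t^{\alpha p}dt\right)^{1/p}$;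 $\mathcal{T}_p^{(0)}(t^0)=L^p(\mathbb{R}^+)$. These spaces are continuously embedded in $L^p(\mathbb{R}^+)$ and regarded as subspaces of it. The map $D_+^\alpha f(t)=\frac1{\Gamma(\alpha+1)}t^\alpha W_+^\alpha f(t)$ extends to an isometric isomorphism $\mathcal{T}_p^{(\alpha)}(t^\alpha)\to L^p(\mathbb{R}^+)$ with inverse (for $\alpha>0$) $(D_+^\alpha)^{-1}h(t)=\alpha\int_t^\infty(s-t)^{\alpha-1}\frac{h(s)}{s^\alpha}ds$. Under the stated condition $\mathcal{S}_{\beta,\mu}$ is a bounded operator on $\mathcal{T}_p^{(\alpha)}(t^\alpha)$. *)

theory Defs
  imports "HOL-Analysis.Analysis"
begin

text \<open>
  Elements of \<open>L\<^sup>p(0,\<infinity>)\<close> are represented by functions \<^typ>\<open>real \<Rightarrow> complex\<close>, identified when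
  they agree almost everywhere on \<open>(0,\<infinity>)\<close>; values at \<open>t \<le> 0\<close> play no role.
\<close>

abbreviation half_line :: "real measure" where
  "half_line \<equiv> lebesgue_on {0<..}"

definition ae_eq :: "(real \<Rightarrow> complex) \<Rightarrow> (real \<Rightarrow> complex) \<Rightarrow> bool" where
  "ae_eq f g \<longleftrightarrow> (AE t in half_line. f t = g t)"

definition Lp :: "real \<Rightarrow> (real \<Rightarrow> complex) set" where
  "Lp p = {f. f \<in> borel_measurable half_line \<and> integrable half_line (\<lambda>t. norm (f t) powr p)}"

definition Lp_norm :: "real \<Rightarrow> (real \<Rightarrow> complex) \<Rightarrow> real" where
  "Lp_norm p f = (LINT t|half_line. norm (f t) powr p) powr (1 / p)"

text \<open>
  The Schwartz class on \<open>[0,\<infinity>)\<close>: \<open>F n\<close> is the \<open>n\<close>-th derivative of \<open>f\<close> on \<open>[0,\<infinity>)\<close>, one-sided at 0.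
\<close>

definition schwartz_half :: "(real \<Rightarrow> complex) set" where
  "schwartz_half = {f. \<exists>F :: nat \<Rightarrow> real \<Rightarrow> complex.
     (\<forall>t\<ge>0. F 0 t = f t) \<and>
     (\<forall>n. \<forall>t\<ge>0. (F n has_vector_derivative F (Suc n) t) (at t within {0..})) \<and>
     (\<forall>m n. \<exists>C. \<forall>t\<ge>0. t ^ m * norm (F n t) \<le> C)}"

text \<open>The Weyl fractional integral \<open>W\<^sub>+\<close> of order \<open>-\<alpha>\<close>, for \<open>\<alpha> > 0\<close>.\<close>

definition weyl_integral :: "real \<Rightarrow> (real \<Rightarrow> complex) \<Rightarrow> real \<Rightarrow> complex" where
  "weyl_integral \<alpha> f t =
     of_real (1 / Gamma \<alpha>) * (LINT s|lebesgue_on {t<..}. of_real ((s - t) powr (\<alpha> - 1)) * f s)"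

definition weyl_derivative :: "real \<Rightarrow> (real \<Rightarrow> complex) \<Rightarrow> real \<Rightarrow> complex" where
  "weyl_derivative \<alpha> f =
     (if \<alpha> = 0 then f
      else let n = nat \<lfloor>\<alpha>\<rfloor> + 1 in
        (\<lambda>t. (-1) ^ n *
             ((\<lambda>g x. vector_derivative g (at x)) ^^ n) (weyl_integral (real n - \<alpha>) f) t))"

text \<open>The norm \<open>\<parallel>f\<parallel>\<close> with indices \<open>\<alpha>, p\<close>, used for \<open>f\<close> in the Schwartz class only.\<close>

definition schwartz_norm :: "real \<Rightarrow> real \<Rightarrow> (real \<Rightarrow> complex) \<Rightarrow> real" where
  "schwartz_norm \<alpha> p f =
     1 / Gamma (\<alpha> + 1) *
     (LINT t|half_line. norm (weyl_derivative \<alpha> f t) powr p * t powr (\<alpha> * p)) powr (1 / p)"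

text \<open>
  The completion is realised inside \<open>L\<^sup>p\<close>: a Cauchy sequence for \<^const>\<open>schwartz_norm\<close> is identified
  with its limit in \<open>L\<^sup>p\<close>, and the norm of that limit is the limit of the norms.
\<close>

definition represents :: "real \<Rightarrow> real \<Rightarrow> (nat \<Rightarrow> real \<Rightarrow> complex) \<Rightarrow> (real \<Rightarrow> complex) \<Rightarrow> bool" where
  "represents \<alpha> p u f \<longleftrightarrow>
     (\<forall>k. u k \<in> schwartz_half) \<and>
     (\<forall>e>0. \<exists>N. \<forall>j\<ge>N. \<forall>k\<ge>N. schwartz_norm \<alpha> p (\<lambda>t. u j t - u k t) < e) \<and>
     (\<lambda>k. Lp_norm p (\<lambda>t. u k t - f t)) \<longlonglongrightarrow> 0"

definition Tspace :: "real \<Rightarrow> real \<Rightarrow> (real \<Rightarrow> complex) set" where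
  "Tspace \<alpha> p = (if \<alpha> = 0 then Lp p else {f \<in> Lp p. \<exists>u. represents \<alpha> p u f})"

definition Tnorm :: "real \<Rightarrow> real \<Rightarrow> (real \<Rightarrow> complex) \<Rightarrow> real" where
  "Tnorm \<alpha> p f =
     (if \<alpha> = 0 then Lp_norm p f
      else THE l. \<exists>u. represents \<alpha> p u f \<and> (\<lambda>k. schwartz_norm \<alpha> p (u k)) \<longlonglongrightarrow> l)"

text \<open>
  Bounded linear operators, and the spectrum of an operator \<open>A\<close>, on a space \<open>V\<close> of functions modulo
  \<^const>\<open>ae_eq\<close> with norm \<open>N\<close>.
\<close>

definition bounded_operator ::
  "(real \<Rightarrow> complex) set \<Rightarrow> ((real \<Rightarrow> complex) \<Rightarrow> real) \<Rightarrow>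
   ((real \<Rightarrow> complex) \<Rightarrow> (real \<Rightarrow> complex)) \<Rightarrow> bool" where
  "bounded_operator V N R \<longleftrightarrow>
     (\<forall>f\<in>V. R f \<in> V) \<and>
     (\<forall>f\<in>V. \<forall>g\<in>V. ae_eq f g \<longrightarrow> ae_eq (R f) (R g)) \<and>
     (\<forall>f\<in>V. \<forall>g\<in>V. ae_eq (R (\<lambda>t. f t + g t)) (\<lambda>t. R f t + R g t)) \<and>
     (\<forall>c. \<forall>f\<in>V. ae_eq (R (\<lambda>t. c * f t)) (\<lambda>t. c * R f t)) \<and>
     (\<exists>C. \<forall>f\<in>V. N (R f) \<le> C * N f)"

definition spectrum_on ::
  "(real \<Rightarrow> complex) set \<Rightarrow> ((real \<Rightarrow> complex) \<Rightarrow> real) \<Rightarrow>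
   ((real \<Rightarrow> complex) \<Rightarrow> (real \<Rightarrow> complex)) \<Rightarrow> complex set" where
  "spectrum_on V N A =
     {z. \<not> (\<exists>R. bounded_operator V N R \<and>
               (\<forall>f\<in>V. ae_eq (R (\<lambda>t. z * f t - A f t)) f \<and>
                      ae_eq (\<lambda>t. z * R f t - A (R f) t) f))}"

definition stieltjes :: "real \<Rightarrow> real \<Rightarrow> (real \<Rightarrow> complex) \<Rightarrow> real \<Rightarrow> complex" where
  "stieltjes \<beta> \<mu> f t =
     of_real (t powr (\<mu> - \<beta>)) *
     (LINT s|half_line. of_real (s powr (\<beta> - 1) / (s + t) powr \<mu>) * f s)"

end

theory Submission
  imports Defs "HOL-Probability.Probability" "HOL-Complex_Analysis.Complex_Analysis"
begin

text \<open>
  Writing \<open>f(t) = t\<^sup>-\<^sup>1\<^sup>/\<^sup>p g(ln t)\<close> turns \<open>L\<^sup>p(0,\<infinity>)\<close> into \<open>L\<^sup>p(\<real>)\<close>, and every operator that commutes with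
  dilations, in particular the Stieltjes operator and \<open>(D\<^sub>+\<^sup>\<alpha>)\<^sup>-\<^sup>1\<close>, into a correlation \<open>g \<mapsto> \<integral> k(x) g(\<cdot> + x) dx\<close>
  with an integrable kernel \<open>k\<close>. Correlations commute, so that the isometry \<open>D\<^sub>+\<^sup>\<alpha>\<close> reduces the theorem to
  the spectrum of the correlation with \<open>\<phi>(x) = e\<^sup>a\<^sup>x (1 + e\<^sup>x)\<^sup>-\<^sup>\<mu>\<close> on \<open>L\<^sup>p(\<real>)\<close>, where \<open>a = \<beta> - 1/p\<close>.

  The Fourier transform of \<open>\<phi>\<close> is the Beta function \<open>b(\<xi>) = B(a + i\<xi>, \<mu> - a - i\<xi>)\<close>. Truncated characters
  \<open>e\<^sup>i\<^sup>\<xi>\<^sup>x\<close> on \<open>[-n, n]\<close> are approximate eigenvectors for \<open>b(\<xi>)\<close>, and \<open>b(\<xi>) \<rightarrow> 0\<close> at infinity. Conversely, if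
  \<open>z \<noteq> 0\<close> is not a value of \<open>b\<close>, then \<open>b / (z (z - b))\<close> extends holomorphically to a strip around the real
  line and is \<open>O(1 / \<xi>\<^sup>2)\<close> there together with its derivatives; hence it is the Fourier transform of
  some \<open>\<psi> \<in> L\<^sup>1(\<real>)\<close>, and the resolvent is \<open>1/z\<close> plus the correlation with \<open>\<psi>\<close>.

  That \<open>D\<^sub>+\<^sup>\<alpha>\<close> maps the completion of the Schwartz class, realised inside \<open>L\<^sup>p\<close>, onto \<open>L\<^sup>p\<close> needs three facts: \<open>L\<^sup>p\<close> is
  complete, \<open>(D\<^sub>+\<^sup>\<alpha>)\<^sup>-\<^sup>1\<close> is injective on \<open>L\<^sup>p\<close> (composed with another fractional integral it becomes an
  integral of integer order), and the functions \<open>t\<^sup>\<alpha> H(t)\<close> with \<open>H\<close> in the Schwartz class are dense in \<open>L\<^sup>p\<close>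
  (the functions \<open>exp (- (t/b)\<^sup>2\<^sup>n)\<close> approximate the indicator of \<open>(0, b)\<close>).
\<close>

text \<open>The resolvent has its form because 1/(z - b) = 1/z + b/(z (z - b)): the constant 1/z is
  not the transform of an integrable function and is split off, while the remainder decays with b.
  The strip is what yields integrability: Cauchy estimates pass the decay of b on to two
  derivatives, and this is enough for an integrable inverse transform. The kernel
  \<open>\<psi>\<close> enters the operator theory only through its integrability and one
  convolution identity with the Stieltjes kernel, so Fourier transforms are taken of integrable
  functions only.

  Truncated characters work for every p because their defect comes from the two ends of [-n, n] and
  stays bounded, while the p-th power of their norm is 2n.

  The obstacle in the space is that its norm is attached to f through some representing sequence. It
  is well defined only if the inverse of D_+^\<alpha> is injective on all of L^p, not merely on the
  Schwartz class. Operators act on functions instead of classes, so linearity and inverses hold only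
  up to \<open>ae_eq\<close>, and representatives in logarithmic coordinates have to be
  chosen.\<close>

section \<open>Convexity of the p-th power\<close>

text \<open>Dividing by \<open>m powr p\<close> leaves Bernoulli's inequality for a real exponent,
  which is the weighted Young inequality for \<open>u powr p\<close> and 1 with weights 1/p and 1 -
  1/p.\<close>

lemma powr_ge_tangent:
  fixes m x p :: real
  assumes p: "1 \<le> p" and m: "0 < m" and x: "0 \<le> x"
  shows "m powr p + p * m powr (p - 1) * (x - m) \<le> x powr p"
proof -
  define u where "u = x / m"
  have u: "0 \<le> u" using m x by (simp add: u_def)
  have bern: "1 + p * (u - 1) \<le> u powr p"
  proof (cases "u = 0")
    case True
    then show ?thesis using p by simp
  next
    case False
    then have "(u powr p) powr (1 / p) * 1 powr (1 - 1 / p) \<le> 1 / p * (u powr p) + (1 - 1 / p) * 1"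
      using u p by (intro Youngs_inequality_0) (auto simp: field_simps)
    then have "p * u \<le> p * (1 / p * (u powr p) + (1 - 1 / p))"
      using u p by (intro mult_left_mono) (auto simp: powr_powr)
    then show ?thesis using p by (simp add: algebra_simps)
  qed
  have "m powr p + p * m powr (p - 1) * (x - m) = m powr p * (1 + p * (u - 1))"
    using m by (simp add: u_def powr_diff field_simps)
  also have "\<dots> \<le> m powr p * u powr p"
    using bern by (intro mult_left_mono) auto
  also have "\<dots> = x powr p"
    using m x by (simp add: u_def powr_divide)
  finally show ?thesis .
qed

text \<open>The tangent bounds at the mean \<open>m\<close> are averaged with weights
  \<open>s\<close> and \<open>t\<close>; their linear terms cancel.\<close>

lemma powr_convex_combination:
  fixes s t x y p :: real
  assumes p: "1 \<le> p" and st: "0 \<le> s" "0 \<le> t" "s + t = 1" and x: "0 \<le> x" and y: "0 \<le> y"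
  shows "(s * x + t * y) powr p \<le> s * x powr p + t * y powr p"
proof -
  define m where "m = s * x + t * y"
  show ?thesis
  proof (cases "m = 0")
    case True
    then show ?thesis using st p by (simp add: m_def[symmetric])
  next
    case False
    then have m: "0 < m" using st x y by (simp add: m_def order.strict_iff_order)
    have "m powr p = s * (m powr p + p * m powr (p - 1) * (x - m)) + t * (m powr p + p * m powr (p - 1) * (y - m))"
    proof -
      have "s * (x - m) + t * (y - m) = 0"
        using st(3) unfolding m_def by algebra
      moreover have "s * (m powr p + p * m powr (p - 1) * (x - m)) + t * (m powr p + p * m powr (p - 1) * (y - m))
        = (s + t) * m powr p + p * m powr (p - 1) * (s * (x - m) + t * (y - m))"
        by algebra
      ultimately show ?thesis using st by simp
    qed
    also have "\<dots> \<le> s * x powr p + t * y powr p"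
      by (intro add_mono mult_left_mono powr_ge_tangent p m x y st)
    finally show ?thesis by (simp add: m_def)
  qed
qed

section \<open>The space \<open>L\<^sup>p\<close> of the real line\<close>

text \<open>Borel rather than Lebesgue measurable, so that \<open>g (y + x)\<close> is jointly
  measurable in both variables. Classes on the half line get Borel representatives in
  \<open>half_line_ex_borel\<close>.\<close>

definition LpR :: "real \<Rightarrow> (real \<Rightarrow> complex) set" where
  "LpR p = {g. g \<in> borel_measurable borel \<and> integrable lborel (\<lambda>x. norm (g x) powr p)}"

definition pnorm :: "real \<Rightarrow> (real \<Rightarrow> complex) \<Rightarrow> real" where
  "pnorm p g = (LINT x|lborel. norm (g x) powr p) powr (1 / p)"

lemma LpR_measurable: "g \<in> LpR p \<Longrightarrow> g \<in> borel_measurable borel"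
  by (simp add: LpR_def)

lemma pnorm_nonneg [simp]: "0 \<le> pnorm p g"
  by (simp add: pnorm_def)

lemma pnorm_powr:
  assumes "1 \<le> p"
  shows "pnorm p g powr p = (LINT x|lborel. norm (g x) powr p)"
  using assms by (simp add: pnorm_def powr_powr integral_nonneg_AE)

lemma pnorm_le_iff:
  assumes "1 \<le> p" "0 \<le> a"
  shows "pnorm p g \<le> a \<longleftrightarrow> (LINT x|lborel. norm (g x) powr p) \<le> a powr p"
  using assms pnorm_powr[of p g] powr_mono2[of p "pnorm p g" a] powr_less_mono2[of p a "pnorm p g"]
  by force

lemma LpR_scale: 
  assumes "1 \<le> p" "g \<in> LpR p" 
  shows "(\<lambda>x. c * g x) \<in> LpR p" and "pnorm p (\<lambda>x. c * g x) = norm c * pnorm p g"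
proof -
  have eq: "norm (c * g x) powr p = norm c powr p * norm (g x) powr p" for x
    by (simp add: norm_mult powr_mult)
  show "(\<lambda>x. c * g x) \<in> LpR p"
    using assms unfolding LpR_def mem_Collect_eq eq by auto
  show "pnorm p (\<lambda>x. c * g x) = norm c * pnorm p g"
    using assms unfolding pnorm_def eq
    by (simp add: powr_mult powr_powr integral_nonneg_AE)
qed

text \<open>Minkowski from convexity alone: the sum of the moduli divided by A + B is a convex
  combination of the modulus of f over A and that of g over B. A and B are taken slightly above the
  norms, so that they are positive even if a norm vanishes.\<close>

lemma LpR_add:
  assumes p: "1 \<le> p" and f: "f \<in> LpR p" and g: "g \<in> LpR p"
  shows LpR_add_mem: "(\<lambda>x. f x + g x) \<in> LpR p" 
    and pnorm_triangle: "pnorm p (\<lambda>x. f x + g x) \<le> pnorm p f + pnorm p g"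
proof -
  have [measurable]: "f \<in> borel_measurable borel" "g \<in> borel_measurable borel"
    using f g by (auto simp: LpR_def)
  have fi [simp]: "integrable lborel (\<lambda>x. norm (f x) powr p)" "integrable lborel (\<lambda>x. norm (g x) powr p)"
    using f g by (auto simp: LpR_def)
  define bnd where "bnd A B x = (A + B) powr p * (A / (A + B) * (norm (f x) / A) powr p
     + B / (A + B) * (norm (g x) / B) powr p)" for A B x
  have pw: "norm (f x + g x) powr p \<le> bnd A B x" if "A > 0" "B > 0" for A B x
  proof -
    have "norm (f x + g x) powr p \<le> (norm (f x) + norm (g x)) powr p"
      using p by (intro powr_mono2 norm_triangle_ineq) auto
    also have "norm (f x) + norm (g x) = (A + B) * (A / (A + B) * (norm (f x) / A) + B / (A + B) * (norm (g x) / B))"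
    proof -
      have "(A + B) * (A / (A + B) * (norm (f x) / A)) = norm (f x)" 
        "(A + B) * (B / (A + B) * (norm (g x) / B)) = norm (g x)"
        using that by auto
      then show ?thesis by (simp only: distrib_left)
    qed
    also have "\<dots> powr p = (A + B) powr p * (A / (A + B) * (norm (f x) / A) + B / (A + B) * (norm (g x) / B)) powr p"
      using that by (subst powr_mult) auto
    also have "\<dots> \<le> bnd A B x"
      unfolding bnd_def using that p
      by (intro mult_left_mono powr_convex_combination) (auto simp flip: add_divide_distrib)
    finally show ?thesis .
  qed
  have bi: "integrable lborel (bnd A B)" if "A > 0" "B > 0" for A B
    unfolding bnd_def using that by (auto simp: powr_divide)
  show *: "(\<lambda>x. f x + g x) \<in> LpR p" unfolding LpR_def
    using Bochner_Integration.integrable_bound[OF bi[of 1 1], of "\<lambda>x. norm (f x + g x) powr p"] pw[of 1 1]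
    by (auto simp: abs_of_nonneg intro!: AE_I2 order_trans[OF _ abs_ge_self])
  have main: "pnorm p (\<lambda>x. f x + g x) \<le> A + B" if A: "A > pnorm p f" and B: "B > pnorm p g" for A B
  proof -
    have A0: "A > 0" and B0: "B > 0" using A B pnorm_nonneg[of p f] pnorm_nonneg[of p g] by linarith+
    have "(LINT x|lborel. norm (f x + g x) powr p) \<le> (LINT x|lborel. bnd A B x)"
      using * pw[OF A0 B0] bi[OF A0 B0] by (intro integral_mono) (auto simp: LpR_def)
    also have "\<dots> = (A + B) powr p * (A / (A + B) * ((LINT x|lborel. norm (f x) powr p) / A powr p)
      + B / (A + B) * ((LINT x|lborel. norm (g x) powr p) / B powr p))"
      unfolding bnd_def using A0 B0 by (simp add: powr_divide)
    also have "\<dots> \<le> (A + B) powr p * (A / (A + B) * 1 + B / (A + B) * 1)"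
      using A B A0 B0 p pnorm_le_iff[of p A f] pnorm_le_iff[of p B g]
      by (intro mult_left_mono add_mono) auto
    also have "\<dots> = (A + B) powr p" 
      using A0 B0 by (simp flip: add_divide_distrib)
    finally show ?thesis using A0 B0 p by (simp add: pnorm_le_iff)
  qed
  show "pnorm p (\<lambda>x. f x + g x) \<le> pnorm p f + pnorm p g"
  proof (rule field_le_epsilon)
    fix e :: real assume "e > 0"
    then show "pnorm p (\<lambda>x. f x + g x) \<le> pnorm p f + pnorm p g + e"
      using main[of "pnorm p f + e/2" "pnorm p g + e/2"] by auto
  qed
qed

lemma LpR_diff_mem:
  assumes p: "1 \<le> p" and f: "f \<in> LpR p" and g: "g \<in> LpR p"
  shows "(\<lambda>x. f x - g x) \<in> LpR p"
  using LpR_add_mem[OF p f LpR_scale(1)[OF p g, of "-1"]] by simp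

lemma pnorm_minus_commute: "pnorm p (\<lambda>x. f x - g x) = pnorm p (\<lambda>x. g x - f x)"
  by (simp add: pnorm_def norm_minus_commute)

lemma pnorm_diff_triangle3:
  assumes p: "1 \<le> p" and f: "f \<in> LpR p" and g: "g \<in> LpR p" and h: "h \<in> LpR p"
  shows "pnorm p (\<lambda>x. f x - h x) \<le> pnorm p (\<lambda>x. f x - g x) + pnorm p (\<lambda>x. g x - h x)"
  using pnorm_triangle[OF p LpR_diff_mem[OF p f g] LpR_diff_mem[OF p g h]] by simp

lemma pnorm_reverse_triangle:
  assumes p: "1 \<le> p" and f: "f \<in> LpR p" and g: "g \<in> LpR p"
  shows "\<bar>pnorm p f - pnorm p g\<bar> \<le> pnorm p (\<lambda>x. f x - g x)"
  using pnorm_triangle[OF p LpR_diff_mem[OF p f g] g] pnorm_triangle[OF p LpR_diff_mem[OF p g f] f]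
    pnorm_minus_commute[of p f g] by simp

lemma LpR_cong_AE:
  assumes "f \<in> LpR p" "g \<in> borel_measurable borel" "AE x in lborel. f x = g x"
  shows "g \<in> LpR p" and "pnorm p g = pnorm p f"
proof -
  have [measurable]: "f \<in> borel_measurable borel" "g \<in> borel_measurable borel" 
    using assms by (auto simp: LpR_def)
  have "integrable lborel (\<lambda>x. norm (f x) powr p) \<longleftrightarrow> integrable lborel (\<lambda>x. norm (g x) powr p)"
    using assms(3) by (intro integrable_cong_AE) auto
  then show "g \<in> LpR p" using assms by (auto simp: LpR_def)
  show "pnorm p g = pnorm p f" unfolding pnorm_def
    using assms(3) by (intro arg_cong2[where f="(powr)"] integral_cong_AE) auto
qed

lemma pnorm_eq_0_iff:
  assumes "1 \<le> p" "g \<in> LpR p"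
  shows "pnorm p g = 0 \<longleftrightarrow> (AE x in lborel. g x = 0)"
proof -
  have "pnorm p g = 0 \<longleftrightarrow> (LINT x|lborel. norm (g x) powr p) = 0"
    by (simp add: pnorm_def)
  also have "\<dots> \<longleftrightarrow> (AE x in lborel. norm (g x) powr p = 0)"
    using assms by (intro integral_nonneg_eq_0_iff_AE) (auto simp: LpR_def)
  finally show ?thesis by simp
qed

lemma zero_LpR: "(\<lambda>x. 0) \<in> LpR p" by (simp add: LpR_def)

lemma pnorm_zero [simp]: "pnorm p (\<lambda>x. 0) = 0" by (simp add: pnorm_def)

section \<open>Jensen and Minkowski inequalities for integrals\<close>

text \<open>Jensen for the weight \<open>k\<close>, which is not normalised; hence the factor with
  exponent p - 1. The tangent bound at the mean \<open>m\<close> is integrated and its linear term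
  cancels. Integrability comes from \<open>G x \<le> 1 + G x powr p\<close>.\<close>

lemma jensen_powr:
  fixes k G :: "'a \<Rightarrow> real"
  assumes p: "1 \<le> p" and k: "integrable M k" "\<And>x. 0 \<le> k x" and G [measurable]: "G \<in> borel_measurable M" "\<And>x. 0 \<le> G x"
    and kG: "integrable M (\<lambda>x. k x * G x powr p)"
  shows "integrable M (\<lambda>x. k x * G x)"
    and "(LINT x|M. k x * G x) powr p \<le> (LINT x|M. k x) powr (p - 1) * (LINT x|M. k x * G x powr p)"
proof -
  have [measurable]: "k \<in> borel_measurable M" using k by auto
  have le: "G x \<le> 1 + G x powr p" for x
  proof (cases "G x \<le> 1")
    case True
    then show ?thesis by (smt (verit) powr_ge_zero)
  next
    case False
    then have "G x powr 1 \<le> G x powr p" using p by (intro powr_mono) auto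
    then show ?thesis using False by simp
  qed
  show int: "integrable M (\<lambda>x. k x * G x)"
  proof (rule Bochner_Integration.integrable_bound[OF Bochner_Integration.integrable_add[OF k(1) kG]])
    show "AE x in M. norm (k x * G x) \<le> norm (k x + k x * G x powr p)"
      using k(2) G(2) mult_left_mono[OF le k(2)]
      by (auto simp: algebra_simps abs_of_nonneg intro!: AE_I2)
  qed auto
  define K where "K = (LINT x|M. k x)"
  have K0: "0 \<le> K" using k by (auto simp: K_def)
  have i0: "0 \<le> (LINT x|M. k x * G x)" using k G by (auto intro!: integral_nonneg_AE)
  show "(LINT x|M. k x * G x) powr p \<le> K powr (p - 1) * (LINT x|M. k x * G x powr p)"
  proof (cases "(LINT x|M. k x * G x) = 0")
    case True
    then show ?thesis using k G p by (auto intro!: mult_nonneg_nonneg integral_nonneg_AE)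
  next
    case False
    have Kpos: "K > 0"
    proof (rule ccontr)
      assume "\<not> K > 0"
      then have "K = 0" using K0 by simp
      then have "AE x in M. k x = 0" 
        using integral_nonneg_eq_0_iff_AE[OF k(1)] k(2) by (auto simp: K_def)
      then have "(LINT x|M. k x * G x) = (LINT x|M. 0)"
        by (intro integral_cong_AE) auto
      then show False using False by simp
    qed
    define m where "m = (LINT x|M. k x * G x) / K"
    have m: "m > 0" using False i0 Kpos by (auto simp: m_def)
    have "(LINT x|M. k x * (m powr p + p * m powr (p - 1) * (G x - m))) \<le> (LINT x|M. k x * G x powr p)"
    proof (rule integral_mono[OF _ kG])
      show "integrable M (\<lambda>x. k x * (m powr p + p * m powr (p - 1) * (G x - m)))"
      proof -
        have "k x * (m powr p + p * m powr (p - 1) * (G x - m)) =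
          (m powr p - p * m powr (p - 1) * m) * k x + p * m powr (p - 1) * (k x * G x)" for x
          by (simp add: algebra_simps)
        then show ?thesis using k(1) int by simp
      qed
      show "k x * (m powr p + p * m powr (p - 1) * (G x - m)) \<le> k x * G x powr p" for x
        by (intro mult_left_mono powr_ge_tangent p m G k)
    qed
    moreover have "(LINT x|M. k x * (m powr p + p * m powr (p - 1) * (G x - m)))
       = (m powr p - p * m powr (p - 1) * m) * K + p * m powr (p - 1) * (LINT x|M. k x * G x)"
    proof -
      have "(LINT x|M. k x * (m powr p + p * m powr (p - 1) * (G x - m))) =
         (LINT x|M. (m powr p - p * m powr (p - 1) * m) * k x + p * m powr (p - 1) * (k x * G x))"
        by (intro Bochner_Integration.integral_cong) (auto simp: algebra_simps)
      then show ?thesis using k(1) int by (simp add: K_def)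
    qed
    moreover have "\<dots> = m powr p * K"
      using Kpos by (simp add: m_def field_simps)
    ultimately have "m powr p * K \<le> (LINT x|M. k x * G x powr p)" by simp
    then have "K powr (p - 1) * (m powr p * K) \<le> K powr (p - 1) * (LINT x|M. k x * G x powr p)"
      by (intro mult_left_mono) auto
    moreover have "K powr (p - 1) * (m powr p * K) = (LINT x|M. k x * G x) powr p"
    proof -
      have "K powr (p - 1) * K = K powr p" using Kpos by (simp add: powr_diff)
      then have "K powr (p - 1) * (m powr p * K) = (K * m) powr p"
        using Kpos m by (simp add: powr_mult mult_ac)
      also have "K * m = (LINT x|M. k x * G x)" using Kpos by (simp add: m_def)
      finally show ?thesis .
    qed
    ultimately show ?thesis by simp
  qed
qed

text \<open>For fixed \<open>y\<close>, Jensen in \<open>x\<close> with weight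
  \<open>norm (k x)\<close>; Tonelli then reduces the \<open>y\<close>-integral to \<open>D\<close>.
  \<open>F\<close> is left general because the bound serves translates, where the inner integral is
  constant, and also the defect of a truncated character, where it grows like
  \<open>\<bar>x\<bar>\<close>.\<close>

lemma minkowski_kernel:
  fixes k :: "real \<Rightarrow> complex" and F :: "real \<Rightarrow> real \<Rightarrow> complex"
  assumes p: "1 \<le> p" and k: "integrable lborel k" 
    and F [measurable]: "case_prod F \<in> borel_measurable (borel \<Otimes>\<^sub>M borel)"
    and D: "(\<integral>\<^sup>+x. ennreal (norm (k x)) * (\<integral>\<^sup>+y. ennreal (norm (F x y) powr p) \<partial>lborel) \<partial>lborel) \<le> ennreal D" "0 \<le> D"
  shows "AE y in lborel. integrable lborel (\<lambda>x. k x * F x y)" (is ?th1)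
    and "(\<lambda>y. LINT x|lborel. k x * F x y) \<in> LpR p" (is ?th2)
    and "(LINT y|lborel. norm (LINT x|lborel. k x * F x y) powr p) \<le> (LINT x|lborel. norm (k x)) powr (p - 1) * D" (is ?th3)
proof -
  have [measurable]: "k \<in> borel_measurable borel" using k by auto
  define K where "K = (LINT x|lborel. norm (k x))"
  define q where "q y = (\<integral>\<^sup>+x. ennreal (norm (k x) * norm (F x y) powr p) \<partial>lborel)" for y
  have q_meas [measurable]: "q \<in> borel_measurable borel"
    unfolding q_def by measurable
  have "(\<integral>\<^sup>+y. q y \<partial>lborel) = (\<integral>\<^sup>+x. (\<integral>\<^sup>+y. ennreal (norm (k x) * norm (F x y) powr p) \<partial>lborel) \<partial>lborel)"
    unfolding q_def by (rule lborel_pair.Fubini') measurable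
  also have "\<dots> = (\<integral>\<^sup>+x. ennreal (norm (k x)) * (\<integral>\<^sup>+y. ennreal (norm (F x y) powr p) \<partial>lborel) \<partial>lborel)"
    by (simp add: ennreal_mult nn_integral_cmult)
  finally have qD: "(\<integral>\<^sup>+y. q y \<partial>lborel) \<le> ennreal D" using D by simp
  then have "(\<integral>\<^sup>+y. q y \<partial>lborel) \<noteq> \<infinity>" by (auto simp: top_unique)
  then have fin: "AE y in lborel. q y < \<infinity>"
    using nn_integral_PInf_AE[of q lborel] by (auto simp: less_top[symmetric] intro: q_meas)
  have int: "integrable lborel (\<lambda>x. norm (k x) * norm (F x y) powr p)" if "q y < \<infinity>" for y
    using that unfolding q_def by (intro integrableI_nonneg) auto
  have nk: "integrable lborel (\<lambda>x. norm (k x))" using k by auto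
  have int2: "integrable lborel (\<lambda>x. k x * F x y)" if "q y < \<infinity>" for y
  proof -
    have "integrable lborel (\<lambda>x. norm (k x) * norm (F x y))"
      by (rule jensen_powr(1)[OF p nk _ _ _ int[OF that]]) auto
    then have "integrable lborel (\<lambda>x. norm (k x * F x y))" by (simp add: norm_mult)
    then show ?thesis by (subst (asm) integrable_norm_iff) auto
  qed
  show ?th1 using fin by eventually_elim (rule int2)
  define R where "R y = (LINT x|lborel. k x * F x y)" for y
  have [measurable]: "R \<in> borel_measurable borel" unfolding R_def by measurable
  have bd: "ennreal (norm (R y) powr p) \<le> ennreal (K powr (p - 1)) * q y" if "q y < \<infinity>" for y
  proof -
    have "norm (R y) \<le> (LINT x|lborel. norm (k x * F x y))"
      unfolding R_def by (rule integral_norm_bound)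
    then have "norm (R y) powr p \<le> (LINT x|lborel. norm (k x) * norm (F x y)) powr p"
      using p by (intro powr_mono2) (auto simp: norm_mult)
    also have "\<dots> \<le> K powr (p - 1) * (LINT x|lborel. norm (k x) * norm (F x y) powr p)"
      unfolding K_def by (rule jensen_powr(2)[OF p nk _ _ _ int[OF that]]) auto
    finally have "ennreal (norm (R y) powr p) \<le> ennreal (K powr (p - 1) * (LINT x|lborel. norm (k x) * norm (F x y) powr p))"
      by (rule ennreal_leI)
    also have "\<dots> = ennreal (K powr (p - 1)) * q y"
      unfolding q_def using int[OF that] by (subst nn_integral_eq_integral) (auto simp: ennreal_mult integral_nonneg_AE)
    finally show ?thesis .
  qed
  have "(\<integral>\<^sup>+y. ennreal (norm (R y) powr p) \<partial>lborel) \<le> (\<integral>\<^sup>+y. ennreal (K powr (p - 1)) * q y \<partial>lborel)"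
    by (intro nn_integral_mono_AE eventually_mono[OF fin] bd) auto
  also have "\<dots> \<le> ennreal (K powr (p - 1) * D)"
    using qD D by (subst nn_integral_cmult) (auto simp: ennreal_mult intro!: mult_left_mono)
  finally have fin2: "(\<integral>\<^sup>+y. ennreal (norm (R y) powr p) \<partial>lborel) \<le> ennreal (K powr (p - 1) * D)" .
  have Rint: "integrable lborel (\<lambda>y. norm (R y) powr p)"
    using fin2 by (intro integrableI_nonneg) (auto simp: less_top[symmetric] top_unique)
  then show ?th2 by (auto simp: LpR_def R_def[symmetric])
  show ?th3 unfolding R_def[symmetric] K_def[symmetric]
    using fin2 D nn_integral_eq_integral[OF Rint] by (auto simp: ennreal_le_iff mult_nonneg_nonneg)
qed

section \<open>Correlation operators\<close>

text \<open>The sign in \<open>y + x\<close> comes from the substitution s = t exp(x) in integrals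
  over s, which adds x to y = ln t.\<close>

definition correl :: "(real \<Rightarrow> complex) \<Rightarrow> (real \<Rightarrow> complex) \<Rightarrow> real \<Rightarrow> complex" where
  "correl k g y = (LINT x|lborel. k x * g (y + x))"

lemma correl_measurable [measurable]:
  assumes [measurable]: "k \<in> borel_measurable borel" "g \<in> borel_measurable borel"
  shows "correl k g \<in> borel_measurable borel"
  unfolding correl_def by measurable

lemma nn_integral_shift:
  fixes f :: "real \<Rightarrow> ennreal"
  assumes [measurable]: "f \<in> borel_measurable borel"
  shows "(\<integral>\<^sup>+y. f (y + x) \<partial>lborel) = (\<integral>\<^sup>+y. f y \<partial>lborel)"
  using nn_integral_real_affine[of f 1 x] by (simp add: add.commute)

text \<open>Translation invariance makes the inner integral of \<open>minkowski_kernel\<close>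
  constant, so D = K times the p-th power of the norm of \<open>g\<close>, and the two powers of K
  combine to K^p.\<close>

lemma correl_LpR:
  assumes p: "1 \<le> p" and k: "integrable lborel k" and g: "g \<in> LpR p"
  shows correl_AE_integrable: "AE y in lborel. integrable lborel (\<lambda>x. k x * g (y + x))"
    and correl_LpR_mem: "correl k g \<in> LpR p" 
    and pnorm_correl_le: "pnorm p (correl k g) \<le> (LINT x|lborel. norm (k x)) * pnorm p g"
proof -
  define K where "K = (LINT x|lborel. norm (k x))"
  have K0: "0 \<le> K" by (simp add: K_def)
  have [measurable]: "g \<in> borel_measurable borel" "k \<in> borel_measurable borel" using g k by (auto simp: LpR_def)
  have "(\<integral>\<^sup>+x. ennreal (norm (k x)) * (\<integral>\<^sup>+y. ennreal (norm (g (y + x)) powr p) \<partial>lborel) \<partial>lborel)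
     = (\<integral>\<^sup>+x. ennreal (norm (k x)) * (\<integral>\<^sup>+y. ennreal (norm (g y) powr p) \<partial>lborel) \<partial>lborel)"
    by (subst nn_integral_shift[where f="\<lambda>y. ennreal (norm (g y) powr p)"]) auto
  also have "\<dots> = ennreal K * ennreal (pnorm p g powr p)"
    using g k p unfolding K_def 
    by (simp add: nn_integral_multc nn_integral_eq_integral LpR_def pnorm_powr)
  finally have D: "(\<integral>\<^sup>+x. ennreal (norm (k x)) * (\<integral>\<^sup>+y. ennreal (norm (g (y + x)) powr p) \<partial>lborel) \<partial>lborel)
     \<le> ennreal (K * pnorm p g powr p)" using K0 by (simp add: ennreal_mult)
  note mk = minkowski_kernel[where F="\<lambda>x y. g (y + x)", OF p k _ D]
  show "AE y in lborel. integrable lborel (\<lambda>x. k x * g (y + x))"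
    by (rule mk(1)) (auto simp: K0)
  show "correl k g \<in> LpR p"
    unfolding correl_def[abs_def] by (rule mk(2)) (auto simp: K0)
  have "(LINT y|lborel. norm (correl k g y) powr p) \<le> K powr (p - 1) * (K * pnorm p g powr p)"
    unfolding correl_def[abs_def] K_def[symmetric] by (rule mk(3)[unfolded K_def[symmetric]]) (auto simp: K0)
  also have "\<dots> = (K * pnorm p g) powr p"
    using K0 by (cases "K = 0") (auto simp: powr_mult powr_diff)
  finally show "pnorm p (correl k g) \<le> K * pnorm p g"
    using p K0 by (simp add: pnorm_le_iff)
qed

text \<open>Translates of null sets are null, so equality holds at every single \<open>y\<close> and
  correlation descends to almost-everywhere classes.\<close>

lemma correl_cong_AE:
  assumes [measurable]: "k \<in> borel_measurable borel" "f \<in> borel_measurable borel" "g \<in> borel_measurable borel" 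
    and ae: "AE x in lborel. f x = g x"
  shows "correl k f y = correl k g y"
proof -
  have "AE x in lborel. f (y + x) = g (y + x)"
    using AE_borel_affine[of 1 "\<lambda>x. f x = g x" y] ae by simp
  then show ?thesis unfolding correl_def by (intro integral_cong_AE) auto
qed


section \<open>Composition of correlations\<close>

definition convol :: "(real \<Rightarrow> complex) \<Rightarrow> (real \<Rightarrow> complex) \<Rightarrow> real \<Rightarrow> complex" where
  "convol k l w = (LINT x|lborel. k x * l (w - x))"

lemma integrable_pairI:
  fixes f :: "real \<times> real \<Rightarrow> complex"
  assumes [measurable]: "f \<in> borel_measurable (borel \<Otimes>\<^sub>M borel)"
    and "(\<integral>\<^sup>+x. \<integral>\<^sup>+y. ennreal (norm (f (x, y))) \<partial>lborel \<partial>lborel) < \<infinity>"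
  shows "integrable (lborel \<Otimes>\<^sub>M lborel) f"
proof (rule integrableI_bounded)
  show "f \<in> borel_measurable (lborel \<Otimes>\<^sub>M lborel)" by measurable
  have "(\<integral>\<^sup>+ x. ennreal (norm (f x)) \<partial>(lborel \<Otimes>\<^sub>M lborel)) 
    = (\<integral>\<^sup>+x. \<integral>\<^sup>+y. ennreal (norm (f (x, y))) \<partial>lborel \<partial>lborel)"
    by (subst lborel.nn_integral_fst[symmetric]) auto
  then show "(\<integral>\<^sup>+ x. ennreal (norm (f x)) \<partial>(lborel \<Otimes>\<^sub>M lborel)) < \<infinity>"
    using assms by simp
qed

text \<open>Fubini, stated at one point \<open>y\<close> under absolute convergence there. This form
  also serves the power kernels of fractional calculus, which are not integrable.\<close>

lemma correl_correl_pointwise: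
  assumes [measurable]: "k \<in> borel_measurable borel" "l \<in> borel_measurable borel" "g \<in> borel_measurable borel"
    and fin: "(\<integral>\<^sup>+x. \<integral>\<^sup>+w. ennreal (norm (k x) * norm (l w) * norm (g (y + x + w))) \<partial>lborel \<partial>lborel) < \<infinity>"
  shows "correl k (correl l g) y = correl l (correl k g) y"
    and "correl k (correl l g) y = correl (convol k l) g y"
proof -
  have i1: "integrable (lborel \<Otimes>\<^sub>M lborel) (\<lambda>(x, w). k x * l w * g (y + x + w))"
    by (rule integrable_pairI) (use fin in \<open>auto simp: norm_mult\<close>)
  have e1: "correl k (correl l g) y = (LINT x|lborel. LINT w|lborel. k x * l w * g (y + x + w))"
    unfolding correl_def by (simp add: mult.assoc)
  also have "\<dots> = (LINT w|lborel. LINT x|lborel. k x * l w * g (y + x + w))"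
    using lborel_pair.Fubini_integral[OF i1] by simp
  also have "\<dots> = (LINT w|lborel. LINT x|lborel. l w * (k x * g (y + w + x)))"
    by (simp add: mult_ac add_ac)
  also have "\<dots> = correl l (correl k g) y"
    unfolding correl_def by simp
  finally show "correl k (correl l g) y = correl l (correl k g) y" .
  have "(\<integral>\<^sup>+w. ennreal (norm (k x) * norm (l (w - x)) * norm (g (y + w))) \<partial>lborel)
    = (\<integral>\<^sup>+w. ennreal (norm (k x) * norm (l w) * norm (g (y + x + w))) \<partial>lborel)" for x
    using nn_integral_real_affine[of "\<lambda>w. ennreal (norm (k x) * norm (l (w - x)) * norm (g (y + w)))" 1 x]
    by (simp add: add_ac)
  then have i2: "integrable (lborel \<Otimes>\<^sub>M lborel) (\<lambda>(x, w). k x * l (w - x) * g (y + w))"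
    by (intro integrable_pairI) (use fin in \<open>auto simp: norm_mult\<close>)
  have "(LINT w|lborel. k x * l w * g (y + x + w)) = (LINT w|lborel. k x * l (w - x) * g (y + w))" for x
    using lborel_integral_real_affine[of 1 "\<lambda>w. k x * l (w - x) * g (y + w)" x]
    by (simp add: add_ac)
  then have "correl k (correl l g) y = (LINT x|lborel. LINT w|lborel. k x * l (w - x) * g (y + w))"
    unfolding e1 by simp
  also have "\<dots> = (LINT w|lborel. LINT x|lborel. k x * l (w - x) * g (y + w))"
    using lborel_pair.Fubini_integral[OF i2] by simp
  also have "\<dots> = correl (convol k l) g y"
    unfolding correl_def convol_def by simp
  finally show "correl k (correl l g) y = correl (convol k l) g y" .
qed

text \<open>The moduli \<open>K\<close>, \<open>L\<close>, \<open>G\<close> satisfy the same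
  hypotheses, so their iterated correlation converges for almost every \<open>y\<close>. For
  nonnegative integrands this convergence is the finiteness of the double integral.\<close>

lemma correl_correl_finite_AE:
  fixes k l :: "real \<Rightarrow> complex"
  assumes p: "1 \<le> p" and k: "integrable lborel k" and l: "integrable lborel l" and g: "g \<in> LpR p"
  shows "AE y in lborel. (\<integral>\<^sup>+x. \<integral>\<^sup>+w. ennreal (norm (k x) * norm (l w) * norm (g (y + x + w))) \<partial>lborel \<partial>lborel) < \<infinity>"
proof -
  have [measurable]: "g \<in> borel_measurable borel" "k \<in> borel_measurable borel" "l \<in> borel_measurable borel"
    using g k l by (auto simp: LpR_def)
  define K L G where "K x = complex_of_real (norm (k x))" and "L x = complex_of_real (norm (l x))" 
    and "G x = complex_of_real (norm (g x))" for x
  have KL: "integrable lborel K" "integrable lborel L" unfolding K_def L_def using integrable_of_real[OF integrable_norm[OF k]] integrable_of_real[OF integrable_norm[OF l]] by simp_all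
  have G: "G \<in> LpR p" using g by (auto simp: LpR_def G_def[abs_def])
  have A: "AE u in lborel. integrable lborel (\<lambda>w. L w * G (u + w))"
    by (rule correl_AE_integrable[OF p KL(2) G])
  have "AE y in lborel. integrable lborel (\<lambda>x. K x * correl L G (y + x))"
    by (rule correl_AE_integrable[OF p KL(1) correl_LpR_mem[OF p KL(2) G]])
  then show ?thesis
  proof eventually_elim
    case (elim y)
    have "AE x in lborel. integrable lborel (\<lambda>w. L w * G (y + x + w))"
      using AE_borel_affine[of 1 "\<lambda>u. integrable lborel (\<lambda>w. L w * G (u + w))" y] A
      unfolding K_def L_def G_def by simp
    then have "AE x in lborel. (\<integral>\<^sup>+w. ennreal (norm (k x) * norm (l w) * norm (g (y + x + w))) \<partial>lborel)
       = ennreal (norm (K x * correl L G (y + x)))"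
    proof eventually_elim
      case (elim x)
      have r: "integrable lborel (\<lambda>w. norm (l w) * norm (g (y + x + w)))"
        using integrable_norm[OF elim] by (simp add: norm_mult L_def G_def)
      have "(\<integral>\<^sup>+w. ennreal (norm (k x) * norm (l w) * norm (g (y + x + w))) \<partial>lborel)
        = ennreal (norm (k x)) * (\<integral>\<^sup>+w. ennreal (norm (l w) * norm (g (y + x + w))) \<partial>lborel)"
        by (subst nn_integral_cmult[symmetric]) (auto simp: ennreal_mult mult.assoc)
      also have "\<dots> = ennreal (norm (k x)) * ennreal (LINT w|lborel. norm (l w) * norm (g (y + x + w)))"
        using r by (subst nn_integral_eq_integral) auto
      also have "\<dots> = ennreal (norm (K x * correl L G (y + x)))"
        by (simp add: K_def L_def G_def correl_def norm_mult ennreal_mult integral_nonneg_AE flip: of_real_mult)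
      finally show ?case .
    qed
    then have "(\<integral>\<^sup>+x. \<integral>\<^sup>+w. ennreal (norm (k x) * norm (l w) * norm (g (y + x + w))) \<partial>lborel \<partial>lborel)
       = (\<integral>\<^sup>+x. ennreal (norm (K x * correl L G (y + x))) \<partial>lborel)"
      by (rule nn_integral_cong_AE)
    also have "\<dots> < \<infinity>"
      using elim by (auto simp: integrable_iff_bounded)
    finally show ?case .
  qed
qed

lemma correl_commute_AE:
  assumes p: "1 \<le> p" and k: "integrable lborel k" and l: "integrable lborel l" and g: "g \<in> LpR p"
  shows "AE y in lborel. correl k (correl l g) y = correl l (correl k g) y"
  using correl_correl_finite_AE[OF assms]
  by eventually_elim (rule correl_correl_pointwise, use k l g in \<open>auto simp: LpR_def\<close>)

lemma correl_convol_AE: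
  assumes p: "1 \<le> p" and k: "integrable lborel k" and l: "integrable lborel l" and g: "g \<in> LpR p"
  shows "AE y in lborel. correl k (correl l g) y = correl (convol k l) g y"
  using correl_correl_finite_AE[OF assms]
  by eventually_elim (rule correl_correl_pointwise, use k l g in \<open>auto simp: LpR_def\<close>)

lemma correl_add_AE:
  assumes p: "1 \<le> p" and k: "integrable lborel k" and f: "f \<in> LpR p" and g: "g \<in> LpR p"
  shows "AE y in lborel. correl k (\<lambda>x. f x + g x) y = correl k f y + correl k g y"
  using correl_AE_integrable[OF p k f] correl_AE_integrable[OF p k g]
  by eventually_elim (simp add: correl_def distrib_left)

lemma correl_scale: "correl k (\<lambda>x. c * f x) y = c * correl k f y"
  unfolding correl_def by (subst integral_mult_right_zero[symmetric]) (simp add: mult_ac)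

lemma correl_diff_AE:
  assumes p: "1 \<le> p" and k: "integrable lborel k" and f: "f \<in> LpR p" and g: "g \<in> LpR p"
  shows "AE y in lborel. correl k (\<lambda>x. f x - g x) y = correl k f y - correl k g y"
  using correl_AE_integrable[OF p k f] correl_AE_integrable[OF p k g]
  by eventually_elim (simp add: correl_def right_diff_distrib)

section \<open>Completeness of \<open>L\<^sup>p\<close>\<close>

text \<open>
  Along a fast subsequence with differences \<open>d\<^sub>j\<close>, the sum of \<open>2\<^sup>j \<bar>d\<^sub>j\<bar>\<^sup>p\<close> is integrable; its finiteness at almost
  every point forces geometric decay of \<open>\<bar>d\<^sub>j\<bar>\<close> there, without Minkowski's inequality for infinite sums.
\<close>

lemma LpR_complete:
  assumes p: "1 \<le> p" and g: "\<And>k. g k \<in> LpR p"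
    and cauchy: "\<And>e. e > 0 \<Longrightarrow> \<exists>N. \<forall>j\<ge>N. \<forall>k\<ge>N. pnorm p (\<lambda>x. g j x - g k x) < e"
  obtains h where "h \<in> LpR p" "(\<lambda>k. pnorm p (\<lambda>x. g k x - h x)) \<longlonglongrightarrow> 0"
proof -
  have [measurable]: "g k \<in> borel_measurable borel" for k using g by (auto simp: LpR_def)
  have "\<forall>i. \<exists>N. \<forall>j\<ge>N. \<forall>k\<ge>N. pnorm p (\<lambda>x. g j x - g k x) < (1/4) ^ i"
    using cauchy by simp
  then obtain N where N: "\<And>i j k. N i \<le> j \<Longrightarrow> N i \<le> k \<Longrightarrow> pnorm p (\<lambda>x. g j x - g k x) < (1/4) ^ i"
    by metis
  \<comment> \<open>The sum makes both \<open>r j\<close> and \<open>r (Suc j)\<close> at least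
    \<open>N j\<close>; the summand \<open>j\<close> makes \<open>r j \<ge> j\<close>, so the
    subsequence goes to infinity.\<close>
  define r where "r j = j + (\<Sum>i\<le>j. N i)" for j
  have rN: "N j \<le> r j" for j
    unfolding r_def by (rule trans_le_add2) (rule member_le_sum, auto)
  have rSuc: "N j \<le> r (Suc j)" for j using rN[of j] by (simp add: r_def)
  define d where "d j x = g (r (Suc j)) x - g (r j) x" for j x
  have [measurable]: "d j \<in> borel_measurable borel" for j unfolding d_def by measurable
  have dLR: "d j \<in> LpR p" for j unfolding d_def by (intro LpR_diff_mem p g)
  have d_int: "(\<integral>\<^sup>+x. ennreal (2 ^ j * norm (d j x) powr p) \<partial>lborel) \<le> ennreal ((1/2) ^ j)" for j
  proof -
    have le: "pnorm p (d j) \<le> (1/4) ^ j" unfolding d_def using N[OF rSuc rN] by (simp add: less_imp_le)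
    have "(LINT x|lborel. norm (d j x) powr p) = pnorm p (d j) powr p" by (rule pnorm_powr[OF p, symmetric])
    also have "\<dots> \<le> ((1/4) ^ j) powr p" using le p by (intro powr_mono2) auto
    \<comment> \<open>As p is at least 1 and the base at most 1, the p-th power only decreases it.
      The weight 2^j then still leaves the summable (1/2)^j.\<close>
    also have "\<dots> \<le> ((1/4) ^ j) powr 1" using p by (intro powr_mono') (auto simp: power_le_one)
    finally have "(LINT x|lborel. 2 ^ j * norm (d j x) powr p) \<le> 2 ^ j * (1/4) ^ j"
      by simp
    also have "\<dots> = (1/2) ^ j" by (simp flip: power_mult_distrib)
    finally show ?thesis using dLR[of j]
      by (subst nn_integral_eq_integral) (auto simp: LpR_def intro: ennreal_leI)
  qed
  have "(\<integral>\<^sup>+x. (\<Sum>j. ennreal (2 ^ j * norm (d j x) powr p)) \<partial>lborel)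
    = (\<Sum>j. \<integral>\<^sup>+x. ennreal (2 ^ j * norm (d j x) powr p) \<partial>lborel)"
    by (rule nn_integral_suminf) auto
  also have "\<dots> \<le> (\<Sum>j. ennreal ((1/2) ^ j))"
    by (intro suminf_le d_int summableI)
  also have "\<dots> = ennreal 2"
    by (rule suminf_ennreal_eq) (use geometric_sums[of "1/2::real"] in auto)
  also have "\<dots> < \<infinity>" by simp
  finally have "AE x in lborel. (\<Sum>j. ennreal (2 ^ j * norm (d j x) powr p)) \<noteq> \<infinity>"
    by (intro nn_integral_PInf_AE) auto
  then have conv: "AE x in lborel. convergent (\<lambda>j. g (r j) x)"
  proof eventually_elim
    case (elim x)
    define E where "E j = ennreal (2 ^ j * norm (d j x) powr p)" for j
    have Efin: "suminf E \<noteq> \<infinity>" using elim by (simp add: E_def[abs_def])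
    define C where "C = enn2real (suminf E)"
    have C0: "0 \<le> C" unfolding C_def by (rule enn2real_nonneg)
    have C: "2 ^ j * norm (d j x) powr p \<le> C" for j
    proof -
      have "E j \<le> suminf E"
        using sum_le_suminf[OF summableI, of "{j}" E] by simp
      also have "\<dots> = ennreal C" unfolding C_def using Efin by (simp add: less_top)
      finally show ?thesis unfolding E_def using C0 by (simp add: ennreal_le_iff)
    qed
    have bnd: "norm (d j x) \<le> C powr (1/p) * ((1/2) powr (1/p)) ^ j" for j
    proof -
      have "norm (d j x) powr p \<le> C * (1/2) ^ j" using C[of j] by (simp add: field_simps)
      then have "(norm (d j x) powr p) powr (1/p) \<le> (C * (1/2) ^ j) powr (1/p)"
        using p by (intro powr_mono2) auto
      also have "\<dots> = C powr (1/p) * ((1/2) powr (1/p)) ^ j"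
        by (simp add: powr_mult powr_realpow[symmetric] powr_powr C0 mult.commute)
      finally show ?thesis using p by (simp add: powr_powr)
    qed
    have "(1/2::real) powr (1/p) < 1" using p powr_less_mono2[of "1/p" "1/2" 1] by simp
    then have "summable (\<lambda>j. C powr (1/p) * ((1/2) powr (1/p)) ^ j)"
      by (intro summable_mult summable_geometric) auto
    then have "summable (\<lambda>j. d j x)"
      by (rule summable_comparison_test'[where N = 0]) (rule bnd)
    then have "convergent (\<lambda>n. \<Sum>j<n. d j x)" by (simp add: summable_iff_convergent)
    moreover have "(\<Sum>j<n. d j x) = g (r n) x - g (r 0) x" for n
      unfolding d_def by (rule sum_lessThan_telescope)
    ultimately have "convergent (\<lambda>n. g (r n) x - g (r 0) x)" by simp
    then have "convergent (\<lambda>n. (g (r n) x - g (r 0) x) + g (r 0) x)"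
      by (intro convergent_add convergent_const)
    then show ?case by simp
  qed
  define h where "h x = lim (\<lambda>j. g (r j) x)" for x
  have [measurable]: "h \<in> borel_measurable borel" unfolding h_def by measurable
  have lim: "AE x in lborel. (\<lambda>j. g (r j) x) \<longlonglongrightarrow> h x"
    using conv by eventually_elim (simp add: h_def convergent_LIMSEQ_iff)
  \<comment> \<open>Fatou along the subsequence transfers the Cauchy bound for the whole sequence to
    the limit \<open>h\<close>.\<close>
  have fatou: "(\<lambda>x. g k x - h x) \<in> LpR p \<and> pnorm p (\<lambda>x. g k x - h x) \<le> e"
    if k: "\<And>j. j \<ge> n \<Longrightarrow> pnorm p (\<lambda>x. g k x - g j x) \<le> e" and e: "e > 0" for k n e
  proof -
    have "(\<integral>\<^sup>+x. ennreal (norm (g k x - h x) powr p) \<partial>lborel) 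
      = (\<integral>\<^sup>+x. liminf (\<lambda>j. ennreal (norm (g k x - g (r j) x) powr p)) \<partial>lborel)"
    proof (rule nn_integral_cong_AE, use lim in eventually_elim)
      case (elim x)
      have "(\<lambda>j. ennreal (norm (g k x - g (r j) x) powr p)) \<longlonglongrightarrow> ennreal (norm (g k x - h x) powr p)"
        using p by (intro tendsto_intros tendsto_ennrealI tendsto_powr' elim) auto
      then show ?case by (intro lim_imp_Liminf[symmetric]) auto
    qed
    also have "\<dots> \<le> liminf (\<lambda>j. \<integral>\<^sup>+x. ennreal (norm (g k x - g (r j) x) powr p) \<partial>lborel)"
      by (rule nn_integral_liminf) auto
    also have "\<dots> \<le> ennreal (e powr p)"
    proof (rule order_trans[OF Liminf_le_Limsup])
      have "(\<integral>\<^sup>+x. ennreal (norm (g k x - g (r j) x) powr p) \<partial>lborel) \<le> ennreal (e powr p)" if "j \<ge> n" for j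
      proof -
        have "n \<le> r j" using that by (simp add: r_def)
        then have "(LINT x|lborel. norm (g k x - g (r j) x) powr p) \<le> e powr p"
          using k[of "r j"] e p by (simp add: pnorm_le_iff)
        then show ?thesis using LpR_diff_mem[OF p g[of k] g[of "r j"]]
          by (subst nn_integral_eq_integral) (auto simp: LpR_def intro: ennreal_leI)
      qed
      then show "limsup (\<lambda>j. \<integral>\<^sup>+x. ennreal (norm (g k x - g (r j) x) powr p) \<partial>lborel) \<le> ennreal (e powr p)"
        by (intro Limsup_bounded) (auto simp: eventually_sequentially)
    qed auto
    finally have le: "(\<integral>\<^sup>+x. ennreal (norm (g k x - h x) powr p) \<partial>lborel) \<le> ennreal (e powr p)" .
    have int: "integrable lborel (\<lambda>x. norm (g k x - h x) powr p)"
      using le by (intro integrableI_nonneg) (auto simp: less_top[symmetric] top_unique)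
    have "(LINT x|lborel. norm (g k x - h x) powr p) \<le> e powr p"
      using le nn_integral_eq_integral[OF int] by (simp add: ennreal_le_iff)
    then show ?thesis using int e p by (auto simp: LpR_def pnorm_le_iff)
  qed
  have ev: "\<exists>n. \<forall>k\<ge>n. (\<lambda>x. g k x - h x) \<in> LpR p \<and> pnorm p (\<lambda>x. g k x - h x) \<le> e" if "e > 0" for e
  proof -
    obtain n where "\<And>j k. n \<le> j \<Longrightarrow> n \<le> k \<Longrightarrow> pnorm p (\<lambda>x. g j x - g k x) < e"
      using cauchy[OF \<open>e > 0\<close>] by auto
    then show ?thesis by (intro exI[of _ n] allI impI fatou[where n=n, OF _ that]) (auto simp: less_imp_le)
  qed
  obtain n where "(\<lambda>x. g n x - h x) \<in> LpR p" using ev[of 1] by auto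
  then have hLR: "h \<in> LpR p" using LpR_diff_mem[OF p g[of n], of "\<lambda>x. g n x - h x"] by simp
  have "(\<lambda>k. pnorm p (\<lambda>x. g k x - h x)) \<longlonglongrightarrow> 0"
  proof (rule LIMSEQ_I)
    fix e :: real assume "e > 0"
    then have "e / 2 > 0" by simp
    from ev[OF this] obtain n where n: "\<forall>k\<ge>n. pnorm p (\<lambda>x. g k x - h x) \<le> e / 2" by blast
    show "\<exists>n. \<forall>k\<ge>n. norm (pnorm p (\<lambda>x. g k x - h x) - 0) < e"
    proof (intro exI[of _ n] allI impI)
      fix k assume "k \<ge> n"
      then have "pnorm p (\<lambda>x. g k x - h x) \<le> e / 2" using n by blast
      then show "norm (pnorm p (\<lambda>x. g k x - h x) - 0) < e" using \<open>e > 0\<close> by simp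
    qed
  qed
  with hLR that show ?thesis by blast
qed

lemma pnorm_limit_unique:
  assumes p: "1 \<le> p" and g: "\<And>k. g k \<in> LpR p" and a: "a \<in> LpR p" and b: "b \<in> LpR p"
    and la: "(\<lambda>k. pnorm p (\<lambda>x. g k x - a x)) \<longlonglongrightarrow> 0" and lb: "(\<lambda>k. pnorm p (\<lambda>x. g k x - b x)) \<longlonglongrightarrow> 0"
  shows "AE x in lborel. a x = b x"
proof -
  have "pnorm p (\<lambda>x. a x - b x) \<le> 0"
  proof (rule LIMSEQ_le_const)
    show "(\<lambda>k. pnorm p (\<lambda>x. g k x - a x) + pnorm p (\<lambda>x. g k x - b x)) \<longlonglongrightarrow> 0"
      using tendsto_add[OF la lb] by simp
    show "\<exists>N. \<forall>k\<ge>N. pnorm p (\<lambda>x. a x - b x) \<le> pnorm p (\<lambda>x. g k x - a x) + pnorm p (\<lambda>x. g k x - b x)"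
      using pnorm_diff_triangle3[OF p a g b] by (simp add: pnorm_minus_commute[of p a])
  qed
  then have "pnorm p (\<lambda>x. a x - b x) = 0" using pnorm_nonneg by (intro antisym)
  then show ?thesis using pnorm_eq_0_iff[OF p LpR_diff_mem[OF p a b]] by simp
qed

lemma pnorm_tendsto:
  assumes p: "1 \<le> p" and g: "\<And>k. g k \<in> LpR p" and a: "a \<in> LpR p" 
    and la: "(\<lambda>k. pnorm p (\<lambda>x. g k x - a x)) \<longlonglongrightarrow> 0"
  shows "(\<lambda>k. pnorm p (g k)) \<longlonglongrightarrow> pnorm p a"
proof -
  have "(\<lambda>k. pnorm p (g k) - pnorm p a) \<longlonglongrightarrow> 0"
    by (rule Lim_null_comparison[OF _ la]) (auto intro!: always_eventually pnorm_reverse_triangle p g a)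
  then show ?thesis by (simp add: LIM_zero_iff)
qed

section \<open>The substitution \<open>t = e\<^sup>x\<close>\<close>

text \<open>The change of variables as an equality of measures, so that integrals, integrability and
  null sets transfer together. The substitution rule works on compact intervals; [-n, n] exhausts
  the line by monotone convergence.\<close>

lemma distr_exp: "distr (density lborel (\<lambda>x. ennreal (exp x))) borel exp = density lborel (indicator {0<..})"
proof (rule measure_eqI)
  fix A :: "real set" assume "A \<in> sets (distr (density lborel (\<lambda>x. ennreal (exp x))) borel exp)"
  then have A [measurable]: "A \<in> sets borel" by simp
  define J where "J n = {- real n..real n}" for n
  define K where "K n = {exp (- real n)..exp (real n)}" for n
  have sub: "(\<integral>\<^sup>+x. ennreal (indicator A x) * indicator (K n) x \<partial>lborel) =
    (\<integral>\<^sup>+x. ennreal (indicator A (exp x) * exp x) * indicator (J n) x \<partial>lborel)" for n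
  proof -
    have "(\<integral>\<^sup>+x. ennreal (indicat_real A x * indicat_real (K n) x) \<partial>lborel) =
      (\<integral>\<^sup>+x. ennreal (indicat_real A (exp x) * exp x * indicat_real (J n) x) \<partial>lborel)"
      unfolding J_def K_def
      by (rule nn_integral_substitution[where g=exp and g'=exp and a="- real n" and b="real n"])
        (auto simp: set_borel_measurable_def intro!: derivative_eq_intros continuous_intros)
    then show ?thesis by (simp add: ennreal_mult ennreal_indicator)
  qed
  have "(\<lambda>n. \<integral>\<^sup>+x. ennreal (indicator A x) * indicator (K n) x \<partial>lborel) \<longlonglongrightarrow> 
     (\<integral>\<^sup>+x. ennreal (indicator A x) * indicator {0<..} x \<partial>lborel)"
  proof (rule nn_integral_LIMSEQ)
    show "incseq (\<lambda>n x. ennreal (indicator A x) * indicator (K n) x)"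
    proof (intro monoI le_funI mult_left_mono)
      fix i j :: nat and x :: real assume "i \<le> j"
      then have "K i \<subseteq> K j" unfolding K_def by auto
      then show "(indicator (K i) x :: ennreal) \<le> indicator (K j) x"
        by (auto simp: indicator_def)
    qed auto
    show "(\<lambda>n. ennreal (indicator A x) * indicator (K n) x) \<longlonglongrightarrow> ennreal (indicator A x) * indicator {0<..} x" for x
    proof (cases "x > 0")
      case True
      obtain N where N: "\<bar>ln x\<bar> \<le> real N" using real_arch_simple by blast
      have "x \<in> K n" if "n \<ge> N" for n
      proof -
        have "- real n \<le> ln x" "ln x \<le> real n" using N that by linarith+
        then have "exp (- real n) \<le> exp (ln x)" "exp (ln x) \<le> exp (real n)" by (simp_all only: exp_le_cancel_iff)
        then show ?thesis using True by (simp add: K_def)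
      qed
      then have "\<forall>\<^sub>F n in sequentially. ennreal (indicator A x) * indicator (K n) x = ennreal (indicator A x) * indicator {0<..} x"
        using True by (auto simp: eventually_sequentially intro!: exI[of _ N])
      then show ?thesis by (rule tendsto_eventually)
    next
      case False
      then have "x \<notin> K n" for n unfolding K_def using exp_gt_zero[of "- real n"] by (auto simp del: exp_gt_zero)
      then show ?thesis using False by simp
    qed
  qed (auto simp: K_def)
  moreover have "(\<lambda>n. \<integral>\<^sup>+x. ennreal (indicator A (exp x) * exp x) * indicator (J n) x \<partial>lborel) \<longlonglongrightarrow> 
     (\<integral>\<^sup>+x. ennreal (indicator A (exp x) * exp x) \<partial>lborel)"
  proof (rule nn_integral_LIMSEQ)
    show "incseq (\<lambda>n x. ennreal (indicator A (exp x) * exp x) * indicator (J n) x)"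
    proof (intro monoI le_funI mult_left_mono)
      fix i j :: nat and x :: real assume "i \<le> j"
      then have "J i \<subseteq> J j" unfolding J_def by auto
      then show "(indicator (J i) x :: ennreal) \<le> indicator (J j) x"
        by (auto simp: indicator_def)
    qed auto
    show "(\<lambda>n. ennreal (indicator A (exp x) * exp x) * indicator (J n) x) \<longlonglongrightarrow> ennreal (indicator A (exp x) * exp x)" for x
    proof -
      obtain N where N: "\<bar>x\<bar> \<le> real N" using real_arch_simple by blast
      have "x \<in> J n" if "n \<ge> N" for n using N that by (auto simp: J_def)
      then have "\<forall>\<^sub>F n in sequentially. ennreal (indicator A (exp x) * exp x) * indicator (J n) x = ennreal (indicator A (exp x) * exp x)"
        by (auto simp: eventually_sequentially intro!: exI[of _ N])
      then show ?thesis by (rule tendsto_eventually)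
    qed
  qed (auto simp: J_def)
  ultimately have eq: "(\<integral>\<^sup>+x. ennreal (indicator A x) * indicator {0<..} x \<partial>lborel) =
     (\<integral>\<^sup>+x. ennreal (indicator A (exp x) * exp x) \<partial>lborel)"
    unfolding sub by (rule LIMSEQ_unique)
  have "emeasure (distr (density lborel (\<lambda>x. ennreal (exp x))) borel exp) A
    = (\<integral>\<^sup>+x. ennreal (exp x) * indicator (exp -` A) x \<partial>lborel)"
    by (simp add: emeasure_distr emeasure_density measurable_sets_borel[OF _ A])
  also have "\<dots> = (\<integral>\<^sup>+x. ennreal (indicator A (exp x) * exp x) \<partial>lborel)"
    by (intro nn_integral_cong) (auto simp: indicator_def)
  also have "\<dots> = (\<integral>\<^sup>+x. indicator {0<..} x * indicator A x \<partial>lborel)"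
    unfolding eq[symmetric] by (intro nn_integral_cong) (auto simp: indicator_def)
  also have "\<dots> = emeasure (density lborel (indicator {0<..})) A"
    by (simp add: emeasure_density)
  finally show "emeasure (distr (density lborel (\<lambda>x. ennreal (exp x))) borel exp) A
     = emeasure (density lborel (indicator {0<..})) A" .
qed simp

lemma density_indicator_real: "density lborel (indicator A) = density lborel (\<lambda>x. ennreal (indicat_real A x))"
  by (rule arg_cong[where f="density lborel"]) (auto simp: indicator_def)

lemma exp_subst:
  fixes f :: "real \<Rightarrow> complex"
  assumes [measurable]: "f \<in> borel_measurable borel"
  shows integrable_exp_subst: 
    "integrable lborel (\<lambda>t. indicat_real {0<..} t *\<^sub>R f t) \<longleftrightarrow> integrable lborel (\<lambda>x. exp x *\<^sub>R f (exp x))"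
    and integral_exp_subst:
    "(LINT t|lborel. indicat_real {0<..} t *\<^sub>R f t) = (LINT x|lborel. exp x *\<^sub>R f (exp x))"
proof -
  have "integrable lborel (\<lambda>t. indicat_real {0<..} t *\<^sub>R f t) \<longleftrightarrow> integrable (density lborel (indicator {0<..})) f"
    by (simp add: integrable_density density_indicator_real)
  also have "\<dots> \<longleftrightarrow> integrable lborel (\<lambda>x. exp x *\<^sub>R f (exp x))"
    unfolding distr_exp[symmetric] by (simp add: integrable_distr_eq integrable_density)
  finally show "integrable lborel (\<lambda>t. indicat_real {0<..} t *\<^sub>R f t) \<longleftrightarrow> integrable lborel (\<lambda>x. exp x *\<^sub>R f (exp x))" .
  have "(LINT t|lborel. indicat_real {0<..} t *\<^sub>R f t) = integral\<^sup>L (density lborel (indicator {0<..})) f"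
    by (simp add: integral_density density_indicator_real)
  also have "\<dots> = (LINT x|lborel. exp x *\<^sub>R f (exp x))"
    unfolding distr_exp[symmetric] by (simp add: integral_distr integral_density)
  finally show "(LINT t|lborel. indicat_real {0<..} t *\<^sub>R f t) = (LINT x|lborel. exp x *\<^sub>R f (exp x))" .
qed

lemma AE_exp_subst:
  fixes P :: "real \<Rightarrow> bool"
  assumes [measurable]: "Measurable.pred borel P"
  shows "(AE t in lborel. 0 < t \<longrightarrow> P t) \<longleftrightarrow> (AE x in lborel. P (exp x))"
proof -
  have "(AE t in lborel. 0 < t \<longrightarrow> P t) \<longleftrightarrow> (AE t in density lborel (indicator {0<..}). P t)"
  proof -
    have "(AE t in density lborel (indicator {0<..}). P t) \<longleftrightarrow> (AE t in lborel. 0 < (indicator {0<..} t :: ennreal) \<longrightarrow> P t)"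
      by (rule AE_density) simp
    also have "(\<lambda>t::real. 0 < (indicator {0<..} t :: ennreal)) = (\<lambda>t. 0 < t)"
      by (auto simp: indicator_def fun_eq_iff)
    ultimately show ?thesis by (simp add: fun_eq_iff)
  qed
  also have "\<dots> \<longleftrightarrow> (AE x in lborel. P (exp x))"
    unfolding distr_exp[symmetric] by (simp add: AE_distr_iff AE_density)
  finally show ?thesis .
qed

section \<open>Gamma and Beta integrals in the variable \<open>x = ln t\<close>\<close>

lemma Gamma_exp_integral:
  fixes z :: complex
  assumes z: "Re z > 0"
  shows Gamma_exp_integrable: "integrable lborel (\<lambda>x. exp (z * of_real x - of_real (exp x)))"
    and Gamma_exp_eq: "(LINT x|lborel. exp (z * of_real x - of_real (exp x))) = Gamma z"
proof -
  define f where "f t = indicat_real {0<..} t *\<^sub>R (of_real t powr (z - 1) / of_real (exp t))" for t :: real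
  have f_meas [measurable]: "f \<in> borel_measurable borel"
  proof -
    have "f = (\<lambda>t. indicat_real {0<..} t *\<^sub>R (exp ((z - 1) * of_real (ln t)) / of_real (exp t)))"
      by (auto simp: f_def fun_eq_iff powr_def Ln_of_real indicator_def)
    then show ?thesis by (simp only:) measurable
  qed
  have f_exp: "exp x *\<^sub>R f (exp x) = exp (z * of_real x - of_real (exp x))" for x
  proof -
    have "exp x *\<^sub>R f (exp x) = exp (of_real x + (z - 1) * of_real x - of_real (exp x))"
      by (simp add: f_def powr_def Ln_of_real scaleR_conv_of_real exp_diff exp_add exp_of_real)
    then show ?thesis by (simp add: algebra_simps)
  qed
  have ind: "indicat_real {0<..} t *\<^sub>R f t = f t" for t by (simp add: f_def indicator_def)
  have abs: "(\<lambda>t. of_real t powr (z - 1) / of_real (exp t)) absolutely_integrable_on {0<..}"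
    by (rule absolutely_integrable_Gamma_integral'[OF z])
  then have "integrable lebesgue f" by (simp add: set_integrable_def f_def[abs_def])
  then have int: "integrable lborel f" by (subst (asm) integrable_completion) auto
  then show "integrable lborel (\<lambda>x. exp (z * of_real x - of_real (exp x)))"
    using integrable_exp_subst[OF f_meas] by (simp add: ind f_exp)
  have "(LINT x|lborel. exp (z * of_real x - of_real (exp x))) = integral\<^sup>L lborel f"
    using integral_exp_subst[OF f_meas] by (simp add: ind f_exp)
  also have "\<dots> = integral\<^sup>L lebesgue f" by (simp add: integral_completion)
  also have "\<dots> = integral {0<..} (\<lambda>t. of_real t powr (z - 1) / of_real (exp t))"
    using set_lebesgue_integral_eq_integral(2)[OF abs] by (simp add: set_lebesgue_integral_def f_def[abs_def])
  also have "\<dots> = Gamma z" by (rule integral_unique[OF Gamma_integral_complex'[OF z]])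
  finally show "(LINT x|lborel. exp (z * of_real x - of_real (exp x))) = Gamma z" .
qed

text \<open>The modulus of the Gamma integrand at \<open>z\<close> is the integrand at
  \<open>Re z\<close>.\<close>

lemma norm_Gamma_le:
  assumes "Re z > 0"
  shows "norm (Gamma z) \<le> Gamma (Re z)"
proof -
  have "norm (Gamma z) \<le> (LINT x|lborel. norm (exp (z * of_real x - of_real (exp x))))"
    unfolding Gamma_exp_eq[OF assms, symmetric] by (rule integral_norm_bound)
  also have "\<dots> = (LINT x|lborel. Re (exp (of_real (Re z) * of_real x - of_real (exp x))))"
    by (simp add: norm_exp_eq_Re Re_exp)
  also have "\<dots> = Re (Gamma (of_real (Re z)))"
    using assms Gamma_exp_eq[of "of_real (Re z)"] Gamma_exp_integrable[of "of_real (Re z)"]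
    by (subst integral_Re) auto
  also have "\<dots> = Gamma (Re z)" by (simp add: Gamma_complex_of_real)
  finally show ?thesis .
qed

lemma lborel_integral_shift:
  fixes f :: "real \<Rightarrow> 'a :: {banach, second_countable_topology}"
  shows "(LINT x|lborel. f (x + c)) = integral\<^sup>L lborel f"
  using lborel_integral_real_affine[of 1 f c] by (simp add: add.commute)

lemma lborel_integrable_shift:
  fixes f :: "real \<Rightarrow> 'a :: {banach, second_countable_topology}"
  shows "integrable lborel (\<lambda>x. f (x + c)) \<longleftrightarrow> integrable lborel f"
  using lborel_integrable_real_affine_iff[of 1 f c] by (simp add: add.commute)

text \<open>Fubini for \<open>H\<close>, the product of two Gamma integrands. The x-integral gives
  Gamma(z) Gamma(\<mu> - z). For the y-integral, the exponentials add up to (1 + exp x) exp y, and a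
  shift by ln(1 + exp x) turns it into Gamma(\<mu>) times the integrand of the claim.\<close>

lemma Beta_exp_integral:
  fixes z :: complex and \<mu> :: real
  assumes z: "Re z > 0" "Re z < \<mu>"
  shows Beta_exp_integrable: "integrable lborel (\<lambda>x. exp (z * of_real x) / of_real ((1 + exp x) powr \<mu>))"
    and Beta_exp_eq: "(LINT x|lborel. exp (z * of_real x) / of_real ((1 + exp x) powr \<mu>)) = Beta z (of_real \<mu> - z)"
proof -
  define h where "h v y = exp (v * of_real y - of_real (exp y))" for v :: complex and y :: real
  have h_int: "integrable lborel (h v)" "integral\<^sup>L lborel (h v) = Gamma v" if "Re v > 0" for v
    using Gamma_exp_integral[OF that] by (simp_all add: h_def[abs_def])
  define H where "H y x = h z (x + y) * h (of_real \<mu> - z) y" for x y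
  have [measurable]: "h v \<in> borel_measurable borel" for v unfolding h_def by measurable
  have Hm [measurable]: "case_prod H \<in> borel_measurable (borel \<Otimes>\<^sub>M borel)" unfolding H_def by measurable
  have mu: "Re (of_real \<mu> - z) > 0" "Re (of_real \<mu>) > 0" using z by auto
  have Hint: "integrable (lborel \<Otimes>\<^sub>M lborel) (\<lambda>(y, x). H y x)"
  proof (rule lborel_pair.Fubini_integrable)
    show "AE y in lborel. integrable lborel (\<lambda>x. case (y, x) of (y, x) \<Rightarrow> H y x)"
      using h_int(1)[OF z(1)] by (simp add: H_def lborel_integrable_shift)
    have "(LINT x|lborel. norm (H y x)) = norm (h (of_real \<mu> - z) y) * (LINT x|lborel. norm (h z x))" for y
      using lborel_integral_shift[of "\<lambda>x. norm (h z x)" y] by (simp add: H_def norm_mult mult.commute)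
    then show "integrable lborel (\<lambda>y. LINT x|lborel. norm (case (y, x) of (y, x) \<Rightarrow> H y x))"
      using h_int(1)[OF mu(1)] by simp
  qed auto
  have inner: "(LINT y|lborel. H y x) = exp (z * of_real x) / of_real ((1 + exp x) powr \<mu>) * Gamma (of_real \<mu>)" for x
  proof -
    define c where "c = 1 + exp x"
    have c: "c > 0" by (simp add: c_def add_pos_pos)
    have "H y x = exp (z * of_real x - of_real (\<mu> * ln c)) * h (of_real \<mu>) (y + ln c)" for y
    proof -
      have "z * of_real x - of_real (\<mu> * ln c) + (of_real \<mu> * of_real (y + ln c) - of_real (exp (y + ln c)))
         = (z * of_real (x + y) - of_real (exp (x + y))) + ((of_real \<mu> - z) * of_real y - of_real (exp y) :: complex)"
      proof -
        have "complex_of_real (exp (y + ln c)) = of_real (exp (x + y)) + of_real (exp y)"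
          using c by (simp add: exp_add c_def algebra_simps)
        then show ?thesis by (simp add: algebra_simps)
      qed
      then show ?thesis unfolding H_def h_def exp_add[symmetric] by simp
    qed
    then have "(LINT y|lborel. H y x) = exp (z * of_real x - of_real (\<mu> * ln c)) * Gamma (of_real \<mu>)"
      using lborel_integral_shift[of "h (of_real \<mu>)" "ln c"] h_int(2)[OF mu(2)] by simp
    also have "exp (z * of_real x - of_real (\<mu> * ln c)) = exp (z * of_real x) / of_real (c powr \<mu>)"
      using c by (simp only: exp_diff exp_of_real powr_def) simp
    finally show ?thesis by (simp add: c_def)
  qed
  have G0: "Gamma (complex_of_real \<mu>) \<noteq> 0" using z by (simp add: Gamma_complex_of_real Gamma_real_pos less_imp_neq[symmetric])
  have "integrable lborel (\<lambda>x. LINT y|lborel. H y x)"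
    using lborel_pair.integrable_snd[OF Hint] by simp
  then have "integrable lborel (\<lambda>x. exp (z * of_real x) / of_real ((1 + exp x) powr \<mu>) * Gamma (of_real \<mu>) / Gamma (of_real \<mu>))"
    unfolding inner by (rule integrable_divide)
  then show "integrable lborel (\<lambda>x. exp (z * of_real x) / of_real ((1 + exp x) powr \<mu>))"
    using G0 by simp
  have "(LINT x|lborel. exp (z * of_real x) / of_real ((1 + exp x) powr \<mu>)) * Gamma (of_real \<mu>)
    = (LINT x|lborel. LINT y|lborel. H y x)"
    unfolding inner by (rule integral_mult_left_zero[symmetric])
  also have "\<dots> = (LINT y|lborel. LINT x|lborel. H y x)"
    by (rule lborel_pair.Fubini_integral[OF Hint])
  also have "\<dots> = (LINT y|lborel. Gamma z * h (of_real \<mu> - z) y)"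
    using lborel_integral_shift[of "h z"] h_int(2)[OF z(1)] by (simp add: H_def)
  also have "\<dots> = Gamma z * Gamma (of_real \<mu> - z)" using h_int(2)[OF mu(1)] by simp
  finally show "(LINT x|lborel. exp (z * of_real x) / of_real ((1 + exp x) powr \<mu>)) = Beta z (of_real \<mu> - z)"
    using G0 by (simp add: Beta_def field_simps)
qed

section \<open>Fourier inversion\<close>

text \<open>The characteristic function of the standard normal law, rescaled by
  \<open>c\<close>.\<close>

lemma gaussian_integral:
  fixes s c :: real
  assumes "c > 0"
  shows "(LINT v|lborel. complex_of_real (exp (- (c * v)\<^sup>2 / 2)) * iexp (v * s)) = complex_of_real (sqrt (2 * pi) / c * exp (- (s / c)\<^sup>2 / 2))"
    and "integrable lborel (\<lambda>v. exp (- (c * v)\<^sup>2 / 2))"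
proof -
  have "(LINT v|lborel. std_normal_density v *\<^sub>R iexp (s / c * v)) = char std_normal_distribution (s / c)"
    unfolding char_def by (subst integral_density) auto
  also have "\<dots> = complex_of_real (exp (- (s / c)\<^sup>2 / 2))"
    by (simp add: char_std_normal_distribution)
  finally have "(LINT v|lborel. sqrt (2 * pi) * (std_normal_density v *\<^sub>R iexp (s / c * v))) 
     = complex_of_real (sqrt (2 * pi) * exp (- (s / c)\<^sup>2 / 2))" 
    by (simp only: integral_mult_right_zero of_real_mult)
  moreover have "sqrt (2 * pi) * (std_normal_density v *\<^sub>R iexp (s / c * v)) = complex_of_real (exp (- v\<^sup>2 / 2)) * iexp (s / c * v)" for v
  proof -
    have "sqrt (2 * pi) * std_normal_density v = exp (- v\<^sup>2 / 2)"
      by (simp add: std_normal_density_def)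
    then have "complex_of_real (sqrt (2 * pi)) * complex_of_real (std_normal_density v) = complex_of_real (exp (- v\<^sup>2 / 2))"
      by (simp only: flip: of_real_mult)
    then show ?thesis by (simp only: scaleR_conv_of_real mult.assoc[symmetric])
  qed
  ultimately have "(LINT v|lborel. complex_of_real (exp (- v\<^sup>2 / 2)) * iexp (s / c * v)) = complex_of_real (sqrt (2 * pi) * exp (- (s / c)\<^sup>2 / 2))"
    by simp
  then show "(LINT v|lborel. complex_of_real (exp (- (c * v)\<^sup>2 / 2)) * iexp (v * s)) = complex_of_real (sqrt (2 * pi) / c * exp (- (s / c)\<^sup>2 / 2))"
    using lborel_integral_real_affine[of c "\<lambda>v. complex_of_real (exp (- v\<^sup>2 / 2)) * iexp (s / c * v)" 0] assms
    by (simp add: field_simps scaleR_conv_of_real)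
  have "integrable lborel (\<lambda>v. sqrt (2 * pi) * std_normal_density v)" by simp
  then have "integrable lborel (\<lambda>v::real. exp (- v\<^sup>2 / 2))" by (simp add: std_normal_density_def)
  then show "integrable lborel (\<lambda>v. exp (- (c * v)\<^sup>2 / 2))"
    using lborel_integrable_real_affine[of "\<lambda>v::real. exp (- v\<^sup>2 / 2)" c 0] assms by simp
qed

text \<open>Gaussian factors \<open>exp (- (c\<^sub>n \<xi>)\<^sup>2 / 2)\<close> with \<open>c\<^sub>n \<rightarrow> 0\<close> make the double integral absolutely convergent.\<close>

lemma fourier_inversion:
  fixes f Fh :: "real \<Rightarrow> complex"
  assumes f: "integrable lborel f" and cont: "continuous_on UNIV f" and bound: "\<And>x. norm (f x) \<le> B"
    and Fh: "\<And>\<xi>. Fh \<xi> = (LINT y|lborel. f y * iexp (\<xi> * y))" and Fh_int: "integrable lborel Fh"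
  shows "(LINT \<xi>|lborel. Fh \<xi> * iexp (- \<xi> * x)) = 2 * pi * f x"
proof -
  have [measurable]: "f \<in> borel_measurable borel" "Fh \<in> borel_measurable borel" using f Fh_int by auto
  define c where "c n = 1 / real (Suc n)" for n
  have c0: "c n > 0" for n by (simp add: c_def)
  have clim: "c \<longlonglongrightarrow> 0" unfolding c_def using LIMSEQ_inverse_real_of_nat by (simp add: inverse_eq_divide)
  define I where "I n = (LINT \<xi>|lborel. Fh \<xi> * iexp (- \<xi> * x) * of_real (exp (- (c n * \<xi>)\<^sup>2 / 2)))" for n
  have lim1: "I \<longlonglongrightarrow> (LINT \<xi>|lborel. Fh \<xi> * iexp (- \<xi> * x))"
    unfolding I_def
  proof (rule integral_dominated_convergence[where w="\<lambda>\<xi>. norm (Fh \<xi>)"])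
    have "(\<lambda>n. Fh \<xi> * iexp (- \<xi> * x) * of_real (exp (- (c n * \<xi>)\<^sup>2 / 2))) \<longlonglongrightarrow> Fh \<xi> * iexp (- \<xi> * x) * of_real (exp (- (0 * \<xi>)\<^sup>2 / 2))" for \<xi>
      by (intro tendsto_intros clim) auto
    then show "AE \<xi> in lborel. (\<lambda>n. Fh \<xi> * iexp (- \<xi> * x) * of_real (exp (- (c n * \<xi>)\<^sup>2 / 2))) \<longlonglongrightarrow> Fh \<xi> * iexp (- \<xi> * x)"
      by simp
    show "AE \<xi> in lborel. norm (Fh \<xi> * iexp (- \<xi> * x) * of_real (exp (- (c n * \<xi>)\<^sup>2 / 2))) \<le> norm (Fh \<xi>)" for n
      by (intro AE_I2) (simp add: norm_mult mult_left_le)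
  qed (use Fh_int in auto)
  \<comment> \<open>After Fubini the Gaussian is transformed explicitly, and \<open>I n\<close>
    becomes an average of \<open>f\<close> around \<open>x\<close> of width
    \<open>c n\<close>.\<close>
  have In: "I n = 2 * pi * (LINT w|lborel. std_normal_density w *\<^sub>R f (x + c n * w))" for n
  proof -
    define H where "H \<xi> y = f y * (of_real (exp (- (c n * \<xi>)\<^sup>2 / 2)) * iexp (\<xi> * (y - x)))" for \<xi> y
    have [measurable]: "case_prod H \<in> borel_measurable (borel \<Otimes>\<^sub>M borel)" unfolding H_def by measurable
    have Hint: "integrable (lborel \<Otimes>\<^sub>M lborel) (\<lambda>(\<xi>, y). H \<xi> y)"
    proof (rule lborel_pair.Fubini_integrable)
      show "integrable lborel (\<lambda>\<xi>. LINT y|lborel. norm (case (\<xi>, y) of (\<xi>, y) \<Rightarrow> H \<xi> y))"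
        using gaussian_integral(2)[OF c0[of n]] by (simp add: H_def norm_mult)
      show "AE \<xi> in lborel. integrable lborel (\<lambda>y. case (\<xi>, y) of (\<xi>, y) \<Rightarrow> H \<xi> y)"
      proof (intro AE_I2, simp)
        fix \<xi>
        show "integrable lborel (H \<xi>)"
          by (rule Bochner_Integration.integrable_bound[OF f]) (auto simp: H_def[abs_def] norm_mult mult_left_le)
      qed
    qed auto
    have "I n = (LINT \<xi>|lborel. LINT y|lborel. H \<xi> y)"
    proof -
      have "Fh \<xi> * iexp (- \<xi> * x) * of_real (exp (- (c n * \<xi>)\<^sup>2 / 2)) = (LINT y|lborel. H \<xi> y)" for \<xi>
        unfolding Fh H_def by (simp add: mult.assoc algebra_simps exp_diff exp_minus flip: integral_mult_left_zero) (simp add: field_simps)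
      then show ?thesis by (simp add: I_def)
    qed
    also have "\<dots> = (LINT y|lborel. LINT \<xi>|lborel. H \<xi> y)"
      by (rule lborel_pair.Fubini_integral[OF Hint, symmetric])
    also have "\<dots> = (LINT y|lborel. f y * complex_of_real (sqrt (2 * pi) / c n * exp (- ((y - x) / c n)\<^sup>2 / 2)))"
      unfolding H_def integral_mult_right_zero gaussian_integral(1)[OF c0[of n]] ..
    also have "\<dots> = c n *\<^sub>R (LINT w|lborel. f (x + c n * w) * complex_of_real (sqrt (2 * pi) / c n * exp (- w\<^sup>2 / 2)))"
      using lborel_integral_real_affine[of "c n" "\<lambda>y. f y * complex_of_real (sqrt (2 * pi) / c n * exp (- ((y - x) / c n)\<^sup>2 / 2))" x] c0[of n]
      by simp
    also have "\<dots> = (LINT w|lborel. 2 * pi * (std_normal_density w *\<^sub>R f (x + c n * w)))"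
    proof -
      have "c n *\<^sub>R (f (x + c n * w) * complex_of_real (sqrt (2 * pi) / c n * exp (- w\<^sup>2 / 2))) = 
        2 * pi * (std_normal_density w *\<^sub>R f (x + c n * w))" for w
      proof -
        have "c n * (sqrt (2 * pi) / c n * exp (- w\<^sup>2 / 2)) = 2 * pi * std_normal_density w"
        proof -
          have "2 * pi / sqrt (2 * pi) = sqrt (2 * pi)" by (simp add: real_div_sqrt)
          then have "2 * pi * std_normal_density w = sqrt (2 * pi) * exp (- w\<^sup>2 / 2)" 
            by (simp add: std_normal_density_def flip: times_divide_eq_left)
          then show ?thesis using c0[of n] by simp
        qed
        then have "complex_of_real (c n * (sqrt (2 * pi) / c n * exp (- w\<^sup>2 / 2))) = of_real (2 * pi * std_normal_density w)" by (rule arg_cong)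
        then have "complex_of_real (c n) * complex_of_real (sqrt (2 * pi) / c n * exp (- w\<^sup>2 / 2)) = 2 * of_real pi * of_real (std_normal_density w)"
          by (simp only: of_real_mult of_real_numeral)
        then have "complex_of_real (c n) * (f (x + c n * w) * complex_of_real (sqrt (2 * pi) / c n * exp (- w\<^sup>2 / 2)))
          = f (x + c n * w) * (2 * of_real pi * of_real (std_normal_density w))"
          by (subst mult.left_commute) (simp only:)
        then show ?thesis unfolding scaleR_conv_of_real of_real_mult[of 2 pi] of_real_numeral by (simp only: mult_ac)
      qed
      then show ?thesis unfolding integral_scaleR_right[symmetric] by (simp only:)
    qed
    also have "\<dots> = 2 * pi * (LINT w|lborel. std_normal_density w *\<^sub>R f (x + c n * w))" by (rule integral_mult_right_zero)
    finally show ?thesis .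
  qed
  have "(\<lambda>n. LINT w|lborel. std_normal_density w *\<^sub>R f (x + c n * w)) \<longlonglongrightarrow> (LINT w|lborel. std_normal_density w *\<^sub>R f x)"
  proof (rule integral_dominated_convergence[where w="\<lambda>w. std_normal_density w * B"])
    have "(\<lambda>n. std_normal_density w *\<^sub>R f (x + c n * w)) \<longlonglongrightarrow> std_normal_density w *\<^sub>R f (x + 0 * w)" for w
      by (intro tendsto_intros clim isCont_tendsto_compose[where g=f]) (use cont in \<open>auto simp: continuous_on_eq_continuous_at\<close>)
    then show "AE w in lborel. (\<lambda>n. std_normal_density w *\<^sub>R f (x + c n * w)) \<longlonglongrightarrow> std_normal_density w *\<^sub>R f x" by simp
    show "AE w in lborel. norm (std_normal_density w *\<^sub>R f (x + c n * w)) \<le> std_normal_density w * B" for n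
      by (intro AE_I2) (auto intro!: mult_left_mono bound simp: abs_of_nonneg)
  qed auto
  also have "(LINT w|lborel. std_normal_density w *\<^sub>R f x) = f x"
    using prob_space.prob_space[OF prob_space_normal_density[of 1 0]]
    by (simp add: integral_normal_density)
  finally have "(\<lambda>n. 2 * pi * (LINT w|lborel. std_normal_density w *\<^sub>R f (x + c n * w))) \<longlonglongrightarrow> 2 * pi * f x"
    by (intro tendsto_intros)
  then have "I \<longlonglongrightarrow> 2 * pi * f x" unfolding In[symmetric] by simp
  then show ?thesis using lim1 LIMSEQ_unique by blast
qed

section \<open>The Stieltjes kernel and its resolvent kernel\<close>

definition stieltjes_kernel :: "real \<Rightarrow> real \<Rightarrow> real \<Rightarrow> complex" where
  "stieltjes_kernel a \<mu> x = complex_of_real (exp (a * x) / (1 + exp x) powr \<mu>)"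

text \<open>The Fourier transform of the kernel with \<open>\<i> * \<xi>\<close> replaced by a
  complex \<open>w\<close>; the real frequency line is the imaginary axis and the strip of
  holomorphy is vertical.\<close>

definition stieltjes_symbol :: "real \<Rightarrow> real \<Rightarrow> complex \<Rightarrow> complex" where
  "stieltjes_symbol a \<mu> w = Beta (of_real a + w) (of_real (\<mu> - a) - w)"

lemma stieltjes_kernel_times_exp:
  "stieltjes_kernel a \<mu> x * exp (w * of_real x) = exp ((of_real a + w) * of_real x) / of_real ((1 + exp x) powr \<mu>)"
  by (simp add: stieltjes_kernel_def distrib_right exp_add exp_of_real[symmetric])

lemma stieltjes_kernel_integrable:
  assumes "0 < a" "a < \<mu>" 
  shows "integrable lborel (stieltjes_kernel a \<mu>)"
  using Beta_exp_integrable[of "of_real a" \<mu>] assms stieltjes_kernel_times_exp[of a \<mu> _ 0]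
  by (simp add: stieltjes_kernel_def[abs_def] exp_of_real flip: of_real_mult)

lemma stieltjes_kernel_fourier:
  assumes "0 < a" "a < \<mu>" 
  shows "(LINT x|lborel. stieltjes_kernel a \<mu> x * iexp (\<xi> * x)) = stieltjes_symbol a \<mu> (\<i> * of_real \<xi>)"
proof -
  have "iexp (\<xi> * x) = exp ((\<i> * of_real \<xi>) * of_real x)" for x by (simp add: mult_ac)
  then show ?thesis
    using Beta_exp_eq[of "of_real a + \<i> * of_real \<xi>" \<mu>] assms stieltjes_kernel_times_exp[of a \<mu> _ "\<i> * of_real \<xi>"]
    by (simp add: stieltjes_symbol_def algebra_simps)
qed

lemma stieltjes_kernel_continuous: "continuous_on UNIV (stieltjes_kernel a \<mu>)"
  unfolding stieltjes_kernel_def[abs_def]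
  by (intro continuous_intros) (auto simp: add_pos_pos less_imp_neq[symmetric] powr_def)

lemma stieltjes_kernel_bound:
  assumes "0 < a" "a < \<mu>" 
  shows "norm (stieltjes_kernel a \<mu> x) \<le> 1"
proof -
  have "exp (a * x) = exp x powr a" by (simp add: powr_def)
  also have "\<dots> \<le> (1 + exp x) powr a" using assms by (intro powr_mono2) auto
  also have "\<dots> \<le> (1 + exp x) powr \<mu>" using assms by (intro powr_mono) auto
  finally have "exp (a * x) \<le> (1 + exp x) powr \<mu>" .
  moreover have "1 + exp x > 0" by (simp add: add_pos_pos)
  then have "(1 + exp x) powr \<mu> > 0" by simp
  ultimately show ?thesis by (simp add: stieltjes_kernel_def norm_divide divide_le_eq_1)
qed

lemma Re_pos_not_nonpos_Int: "Re z > 0 \<Longrightarrow> z \<notin> \<int>\<^sub>\<le>\<^sub>0"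
  by (auto elim!: nonpos_Ints_cases)

lemma stieltjes_symbol_holomorphic:
  assumes "0 < a" "a < \<mu>" 
  shows "stieltjes_symbol a \<mu> holomorphic_on {w. - a < Re w \<and> Re w < \<mu> - a}"
  unfolding stieltjes_symbol_def[abs_def] Beta_def using assms
  by (intro holomorphic_intros) (auto intro!: Re_pos_not_nonpos_Int simp: Gamma_eq_zero_iff)

text \<open>Two steps of the functional equation give Gamma(s) = Gamma(s+2) / (s (s+1)), and each
  factor of the denominator grows like the imaginary part. Gamma(s+2) and Gamma(t) are bounded
  through their real parts, and Gamma(s+t) is the constant Gamma(\<mu>).\<close>

lemma stieltjes_symbol_bound:
  assumes a: "0 < a" "a < \<mu>" and d: "d = min a (\<mu> - a) / 2"
  obtains C where "C > 0" "\<And>w. \<bar>Re w\<bar> \<le> d \<Longrightarrow> norm (stieltjes_symbol a \<mu> w) \<le> C / (1 + (Im w)\<^sup>2)"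
proof -
  have d0: "d > 0" using a d by simp
  \<comment> \<open>With s = a + w and t = \<mu> - a - w, this interval contains Re t and Re (s + 2)
    for all \<open>w\<close> in the closed strip of half-width \<open>d\<close>.\<close>
  have "compact (Gamma ` {d..\<mu> + 3 :: real})"
    by (intro compact_continuous_image continuous_intros) (use d0 in \<open>auto elim!: nonpos_Ints_cases\<close>)
  then have "bounded (Gamma ` {d..\<mu> + 3 :: real})" by (rule compact_imp_bounded)
  then obtain M where M: "M > 0" "\<And>x. x \<in> {d..\<mu> + 3} \<Longrightarrow> \<bar>Gamma x\<bar> \<le> M" 
    unfolding bounded_pos by auto
  \<comment> \<open>Chosen so that m (1 + y^2) is at most d^2 + y^2, which bounds the squared
    modulus of \<open>s\<close> from below.\<close>
  define m where "m = min 1 (d\<^sup>2)"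
  have m: "m > 0" using d0 by (simp add: m_def)
  define C where "C = M / m * M / Gamma \<mu>"
  have G\<mu>: "Gamma \<mu> > 0" using a by (intro Gamma_real_pos) auto
  have "C > 0" using M(1) m G\<mu> by (simp add: C_def)
  moreover have "norm (stieltjes_symbol a \<mu> w) \<le> C / (1 + (Im w)\<^sup>2)" if w: "\<bar>Re w\<bar> \<le> d" for w
  proof -
    define s where "s = of_real a + w"
    define t where "t = of_real (\<mu> - a) - w"
    have s: "Re s \<ge> d" "Re s \<le> \<mu> + 1" and t: "Re t \<ge> d" "Re t \<le> \<mu> + 3" 
      using w a d by (auto simp: s_def t_def min_def split: if_splits)
    have Gt: "norm (Gamma t) \<le> M"
      using norm_Gamma_le[of t] M(2)[of "Re t"] t d0 by auto
    have Gs2: "norm (Gamma (s + 2)) \<le> M"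
      using norm_Gamma_le[of "s + 2"] M(2)[of "Re (s + 2)"] s d0 by auto
    have rec: "Gamma (s + 2) = (s + 1) * (s * Gamma s)"
    proof -
      have "Gamma (s + 1 + 1) = (s + 1) * Gamma (s + 1)"
        by (rule Gamma_plus1) (use s d0 in \<open>auto intro!: Re_pos_not_nonpos_Int\<close>)
      also have "Gamma (s + 1) = s * Gamma s"
        by (rule Gamma_plus1) (use s d0 in \<open>auto intro!: Re_pos_not_nonpos_Int\<close>)
      finally show ?thesis by (simp add: add.assoc)
    qed
    have ns: "m * (1 + (Im w)\<^sup>2) \<le> (norm s)\<^sup>2"
    proof -
      have "m * (1 + (Im w)\<^sup>2) \<le> d\<^sup>2 + (Im w)\<^sup>2"
        using mult_right_mono[of m 1 "(Im w)\<^sup>2"] by (simp add: m_def distrib_left)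
      also have "d\<^sup>2 \<le> (Re s)\<^sup>2" using s d0 by (intro power_mono) auto
      finally show ?thesis by (simp add: cmod_power2 s_def)
    qed
    have ns1: "norm s \<le> norm (s + 1)"
    proof -
      have "(Re s)\<^sup>2 \<le> (Re s + 1)\<^sup>2" using s d0 by (intro power_mono) auto
      then have "(norm s)\<^sup>2 \<le> (norm (s + 1))\<^sup>2" by (simp add: cmod_power2)
      then show ?thesis by (rule power2_le_imp_le) simp
    qed
    have "m * (1 + (Im w)\<^sup>2) * norm (Gamma s) \<le> (norm s * norm s) * norm (Gamma s)"
      using ns by (intro mult_right_mono) (auto simp: power2_eq_square)
    also have "\<dots> \<le> (norm (s + 1) * norm s) * norm (Gamma s)"
      using ns1 by (intro mult_right_mono) auto
    also have "\<dots> = norm (Gamma (s + 2))" unfolding rec by (simp add: norm_mult)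
    also have "\<dots> \<le> M" by (rule Gs2)
    finally have Gs: "norm (Gamma s) \<le> M / m / (1 + (Im w)\<^sup>2)"
      using m by (simp add: field_simps add_pos_nonneg)
    have st: "s + t = of_real \<mu>" by (simp add: s_def t_def)
    have "stieltjes_symbol a \<mu> w = Gamma s * Gamma t / Gamma (s + t)" by (simp only: stieltjes_symbol_def s_def t_def Beta_def)
    then have "norm (stieltjes_symbol a \<mu> w) = norm (Gamma s) * norm (Gamma t) / Gamma \<mu>"
      using G\<mu> by (simp add: st norm_mult norm_divide Gamma_complex_of_real)
    also have "\<dots> \<le> (M / m / (1 + (Im w)\<^sup>2)) * M / Gamma \<mu>"
      using Gs Gt G\<mu> M(1) m by (intro divide_right_mono mult_mono) auto
    also have "\<dots> = C / (1 + (Im w)\<^sup>2)" by (simp add: C_def)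
    finally show ?thesis .
  qed
  ultimately show ?thesis by (rule that)
qed

section \<open>Integrability of inverse Fourier transforms\<close>

lemma integrable_inverse_one_plus_square: "integrable lborel (\<lambda>x::real. K / (1 + x\<^sup>2))"
proof -
  have "set_integrable lborel (einterval (-\<infinity>) \<infinity>) (\<lambda>x. inverse (1 + x\<^sup>2))"
    by (rule integrable_inverse_1_plus_square)
  then have "integrable lborel (\<lambda>x::real. inverse (1 + x\<^sup>2))" by (simp add: set_integrable_def)
  then have "integrable lborel (\<lambda>x::real. K * inverse (1 + x\<^sup>2))" by (rule integrable_mult_right)
  then show ?thesis by (simp add: divide_inverse)
qed

lemma integrable_bound_one_plus_square:
  fixes f :: "real \<Rightarrow> complex"
  assumes "f \<in> borel_measurable borel" "\<And>x. norm (f x) \<le> K / (1 + x\<^sup>2)"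
  shows "integrable lborel f"
proof (rule Bochner_Integration.integrable_bound[OF integrable_inverse_one_plus_square[of K]])
  show "AE x in lborel. norm (f x) \<le> norm (K / (1 + x\<^sup>2))"
    using order_trans[OF assms(2) abs_ge_self] by simp
qed (use assms in simp)

lemma tendsto_inverse_one_plus_square:
  "((\<lambda>x::real. K / (1 + x\<^sup>2)) \<longlongrightarrow> 0) at_top" "((\<lambda>x::real. K / (1 + x\<^sup>2)) \<longlongrightarrow> 0) at_bot"
proof -
  have "filterlim (\<lambda>x::real. 1 + x\<^sup>2) at_top at_top" "filterlim (\<lambda>x::real. 1 + x\<^sup>2) at_top at_bot"
    by (rule filterlim_tendsto_add_at_top[OF tendsto_const], rule filterlim_pow_at_top, simp, rule filterlim_ident)
       (rule filterlim_tendsto_add_at_top[OF tendsto_const], rule filterlim_pow_at_bot_even, simp, rule filterlim_ident, simp)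
  then have "filterlim (\<lambda>x::real. 1 + x\<^sup>2) at_infinity at_top" "filterlim (\<lambda>x::real. 1 + x\<^sup>2) at_infinity at_bot"
    by (auto intro: filterlim_at_top_imp_at_infinity)
  then show "((\<lambda>x::real. K / (1 + x\<^sup>2)) \<longlongrightarrow> 0) at_top" "((\<lambda>x::real. K / (1 + x\<^sup>2)) \<longlongrightarrow> 0) at_bot"
    by (auto intro: tendsto_divide_0[OF tendsto_const])
qed

text \<open>Two integrations by parts give decay of order \<open>1 / x\<^sup>2\<close> of the inverse Fourier transform.\<close>

lemma inverse_fourier_integrable:
  fixes g g1 g2 :: "real \<Rightarrow> complex"
  assumes d1: "\<And>\<xi>. (g has_vector_derivative g1 \<xi>) (at \<xi>)" and d2: "\<And>\<xi>. (g1 has_vector_derivative g2 \<xi>) (at \<xi>)"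
    and c2: "continuous_on UNIV g2"
    and b0: "\<And>\<xi>. norm (g \<xi>) \<le> K / (1 + \<xi>\<^sup>2)" and b1: "\<And>\<xi>. norm (g1 \<xi>) \<le> K / (1 + \<xi>\<^sup>2)" and b2: "\<And>\<xi>. norm (g2 \<xi>) \<le> K / (1 + \<xi>\<^sup>2)"
  shows "integrable lborel (\<lambda>x. LINT \<xi>|lborel. g \<xi> * iexp (- \<xi> * x))"
proof -
  have c0: "continuous_on UNIV g" 
    using d1 by (auto intro!: continuous_at_imp_continuous_on has_vector_derivative_continuous)
  have [measurable]: "g \<in> borel_measurable borel" "g2 \<in> borel_measurable borel"
    using c0 c2 by (auto intro: borel_measurable_continuous_onI)
  have gi: "integrable lborel g" and g2i: "integrable lborel g2" 
    by (rule integrable_bound_one_plus_square[OF _ b0], simp) (rule integrable_bound_one_plus_square[OF _ b2], simp)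
  have inte: "integrable lborel (\<lambda>\<xi>. f \<xi> * iexp (- \<xi> * x))" if "integrable lborel f" for f :: "real \<Rightarrow> complex" and x
    by (rule Bochner_Integration.integrable_bound[OF that]) (use that in \<open>auto simp: norm_mult\<close>)
  define \<psi> where "\<psi> x = (LINT \<xi>|lborel. g \<xi> * iexp (- \<xi> * x))" for x
  have [measurable]: "\<psi> \<in> borel_measurable borel" unfolding \<psi>_def by measurable
  define A where "A = (LINT \<xi>|lborel. norm (g \<xi>))"
  define A2 where "A2 = (LINT \<xi>|lborel. norm (g2 \<xi>))"
  have parts: "x\<^sup>2 * \<psi> x = - (LINT \<xi>|lborel. g2 \<xi> * iexp (- \<xi> * x))" for x
  proof -
    \<comment> \<open>Both integrations by parts in one antiderivative: the mixed terms in
      \<open>g1\<close> cancel on differentiation, leaving \<open>g2 + x^2 * g\<close> times the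
      character. Since \<open>F\<close> vanishes at both ends, that integral is 0.\<close>
    define F where "F \<xi> = (g1 \<xi> + \<i> * of_real x * g \<xi>) * iexp (- \<xi> * x)" for \<xi>
    define f where "f \<xi> = (g2 \<xi> + (of_real x)\<^sup>2 * g \<xi>) * iexp (- \<xi> * x)" for \<xi>
    have eder: "((\<lambda>\<xi>. iexp (- \<xi> * x)) has_vector_derivative (- \<i> * of_real x) * iexp (- \<xi> * x)) (at \<xi>)" for \<xi>
    proof -
      have "((\<lambda>w. exp (- \<i> * of_real x * w)) has_field_derivative (- \<i> * of_real x) * exp (- \<i> * of_real x * of_real \<xi>)) (at (of_real \<xi>))"
        by (auto intro!: derivative_eq_intros)
      from has_vector_derivative_real_field[OF this] show ?thesis by (simp add: mult_ac)
    qed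
    have der: "(F has_vector_derivative f \<xi>) (at \<xi>)" for \<xi>
    proof -
      have "(F has_vector_derivative (g1 \<xi> + \<i> * of_real x * g \<xi>) * ((- \<i> * of_real x) * iexp (- \<xi> * x)) 
         + (g2 \<xi> + \<i> * of_real x * g1 \<xi>) * iexp (- \<xi> * x)) (at \<xi>)"
        unfolding F_def
        by (intro has_vector_derivative_mult has_vector_derivative_add eder d2 has_vector_derivative_mult_right d1)
      also have "(g1 \<xi> + \<i> * of_real x * g \<xi>) * ((- \<i> * of_real x) * iexp (- \<xi> * x)) 
         + (g2 \<xi> + \<i> * of_real x * g1 \<xi>) * iexp (- \<xi> * x) = f \<xi>"
      proof -
        have "(g1 \<xi> + \<i> * of_real x * g \<xi>) * ((- \<i> * of_real x) * E) 
         + (g2 \<xi> + \<i> * of_real x * g1 \<xi>) * E = (g2 \<xi> + (of_real x)\<^sup>2 * g \<xi>) * E" for E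
          using i_squared by algebra
        then show ?thesis unfolding f_def .
      qed
      finally show ?thesis .
    qed
    have fcont: "continuous_on UNIV f" unfolding f_def
      by (intro continuous_intros c2 c0)
    have Fb: "norm (F \<xi>) \<le> K * (1 + \<bar>x\<bar>) / (1 + \<xi>\<^sup>2)" for \<xi>
    proof -
      have "norm (F \<xi>) \<le> norm (g1 \<xi>) + \<bar>x\<bar> * norm (g \<xi>)"
        unfolding F_def norm_mult using norm_triangle_ineq[of "g1 \<xi>" "\<i> * of_real x * g \<xi>"] by (simp add: norm_mult)
      also have "\<dots> \<le> K / (1 + \<xi>\<^sup>2) + \<bar>x\<bar> * (K / (1 + \<xi>\<^sup>2))"
        by (intro add_mono mult_left_mono b0 b1) auto
      finally show ?thesis by (simp add: algebra_simps add_divide_distrib)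
    qed
    have Flim: "(F \<longlongrightarrow> 0) at_top" "(F \<longlongrightarrow> 0) at_bot"
      by (rule Lim_null_comparison[OF always_eventually tendsto_inverse_one_plus_square(1)[of "K * (1 + \<bar>x\<bar>)"]], use Fb in blast)
         (rule Lim_null_comparison[OF always_eventually tendsto_inverse_one_plus_square(2)[of "K * (1 + \<bar>x\<bar>)"]], use Fb in blast)
    have fi: "integrable lborel f"
      unfolding f_def distrib_right mult.assoc
      by (intro Bochner_Integration.integrable_add integrable_mult_right inte g2i gi)
    have "(LBINT \<xi>=-\<infinity>..\<infinity>. f \<xi>) = 0 - 0"
    proof (rule interval_integral_FTC_integrable)
      show "((F \<circ> real_of_ereal) \<longlongrightarrow> 0) (at_right (- \<infinity>))" "((F \<circ> real_of_ereal) \<longlongrightarrow> 0) (at_left \<infinity>)"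
        using Flim by (auto simp: ereal_tendsto_simps)
      show "isCont f \<xi>" for \<xi> using fcont by (simp add: continuous_on_eq_continuous_at)
      show "set_integrable lborel (einterval (- \<infinity>) \<infinity>) f" using fi by (simp add: set_integrable_def)
    qed (use der in auto)
    then have "integral\<^sup>L lborel f = 0"
      by (simp add: interval_lebesgue_integral_def set_lebesgue_integral_def)
    moreover have "integral\<^sup>L lborel f = (LINT \<xi>|lborel. g2 \<xi> * iexp (- \<xi> * x)) + (of_real x)\<^sup>2 * \<psi> x"
      unfolding f_def \<psi>_def distrib_right mult.assoc
      using inte[OF g2i, of x] inte[OF gi, of x] by simp
    ultimately show ?thesis by (simp add: eq_neg_iff_add_eq_0 add.commute)
  qed
  have nb: "norm (LINT \<xi>|lborel. f \<xi> * iexp (- \<xi> * x)) \<le> (LINT \<xi>|lborel. norm (f \<xi>))" for f and x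
    using integral_norm_bound[of lborel "\<lambda>\<xi>. f \<xi> * iexp (- \<xi> * x)"] by (simp add: norm_mult)
  have "norm (\<psi> x) \<le> (A + A2) / (1 + x\<^sup>2)" for x
  proof -
    have "norm (\<psi> x) \<le> A" unfolding \<psi>_def A_def by (rule nb)
    moreover have "x\<^sup>2 * norm (\<psi> x) \<le> A2"
      using nb[of g2 x] arg_cong[OF parts[of x], of norm] by (simp add: A2_def norm_mult norm_power)
    ultimately have "norm (\<psi> x) * (1 + x\<^sup>2) \<le> A + A2" by (simp add: algebra_simps)
    then show ?thesis by (simp add: pos_le_divide_eq add_pos_nonneg)
  qed
  then have "integrable lborel \<psi>"
    by (intro integrable_bound_one_plus_square) auto
  then show ?thesis by (simp add: \<psi>_def[abs_def])
qed

section \<open>Construction of the resolvent kernel\<close>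

text \<open>On the imaginary axis the distance to \<open>z\<close> is bounded below: far out because
  the symbol decays and \<open>z \<noteq> 0\<close>, on the compact rest by continuity. A bound on
  the derivative carries half of this lower bound to a thin strip.\<close>

lemma resolvent_strip:
  assumes a: "0 < a" "a < \<mu>" and z: "z \<noteq> 0" "\<And>\<xi>. z \<noteq> stieltjes_symbol a \<mu> (\<i> * of_real \<xi>)"
  obtains d c where "0 < d" "0 < c" "d \<le> min a (\<mu> - a) / 2" "\<And>w. \<bar>Re w\<bar> \<le> d \<Longrightarrow> c \<le> norm (z - stieltjes_symbol a \<mu> w)"
proof -
  define \<delta> where "\<delta> = min a (\<mu> - a) / 2"
  have \<delta>0: "\<delta> > 0" using a by (simp add: \<delta>_def)
  obtain C where C: "C > 0" "\<And>w. \<bar>Re w\<bar> \<le> \<delta> \<Longrightarrow> norm (stieltjes_symbol a \<mu> w) \<le> C / (1 + (Im w)\<^sup>2)"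
    using stieltjes_symbol_bound[OF a \<delta>_def] by blast
  have hol: "stieltjes_symbol a \<mu> holomorphic_on {w. - a < Re w \<and> Re w < \<mu> - a}" by (rule stieltjes_symbol_holomorphic[OF a])
  have op: "open {w. - a < Re w \<and> Re w < \<mu> - a}"
    using open_Collect_conj[OF open_halfspace_Re_gt open_halfspace_Re_lt] by blast
  have sub: "\<bar>Re w\<bar> \<le> \<delta> \<Longrightarrow> w \<in> {w. - a < Re w \<and> Re w < \<mu> - a}" for w
    using a by (auto simp: \<delta>_def min_def split: if_splits)
  obtain c0 where c0: "c0 > 0" "\<And>\<xi>. c0 \<le> norm (z - stieltjes_symbol a \<mu> (\<i> * of_real \<xi>))"
  proof -
    \<comment> \<open>Beyond \<open>T\<close> the decay bound of the symbol is at most half of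
      \<open>norm z\<close>.\<close>
    define T where "T = sqrt (2 * C / norm z)"
    have big: "norm z / 2 \<le> norm (z - stieltjes_symbol a \<mu> (\<i> * of_real \<xi>))" if "\<bar>\<xi>\<bar> \<ge> T" for \<xi>
    proof -
      have "T\<^sup>2 \<le> \<bar>\<xi>\<bar>\<^sup>2" using that C(1) by (intro power_mono) (auto simp: T_def)
      then have "2 * C / norm z \<le> 1 + \<xi>\<^sup>2" using C(1) by (simp add: T_def)
      then have le: "C / (1 + \<xi>\<^sup>2) \<le> norm z / 2" using z(1) by (simp add: field_simps add_pos_nonneg)
      have "norm (stieltjes_symbol a \<mu> (\<i> * of_real \<xi>)) \<le> C / (1 + \<xi>\<^sup>2)"
        using C(2)[of "\<i> * of_real \<xi>"] \<delta>0 by simp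
      then have "norm (stieltjes_symbol a \<mu> (\<i> * of_real \<xi>)) \<le> norm z / 2" using le by (rule order_trans)
      then show ?thesis using norm_triangle_ineq2[of z "stieltjes_symbol a \<mu> (\<i> * of_real \<xi>)"] by linarith
    qed
    have cont: "continuous_on {- T..T} (\<lambda>\<xi>. norm (z - stieltjes_symbol a \<mu> (\<i> * of_real \<xi>)))"
      by (intro continuous_intros continuous_on_compose2[OF holomorphic_on_imp_continuous_on[OF hol]])
        (use a in auto)
    have "{- T..T} \<noteq> {}" using C(1) by (simp add: T_def)
    from continuous_attains_inf[OF compact_Icc this cont] obtain \<xi>0 where 
      \<xi>0: "\<And>\<xi>. \<xi> \<in> {- T..T} \<Longrightarrow> norm (z - stieltjes_symbol a \<mu> (\<i> * of_real \<xi>0)) \<le> norm (z - stieltjes_symbol a \<mu> (\<i> * of_real \<xi>))"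
      by blast
    show ?thesis
    proof (rule that[of "min (norm z / 2) (norm (z - stieltjes_symbol a \<mu> (\<i> * of_real \<xi>0)))"])
      show "0 < min (norm z / 2) (norm (z - stieltjes_symbol a \<mu> (\<i> * of_real \<xi>0)))" using z by simp
      show "min (norm z / 2) (norm (z - stieltjes_symbol a \<mu> (\<i> * of_real \<xi>0))) \<le> norm (z - stieltjes_symbol a \<mu> (\<i> * of_real \<xi>))" for \<xi>
      proof (cases "\<bar>\<xi>\<bar> \<ge> T")
        case True
        then show ?thesis using big by (simp add: min_le_iff_disj)
      next
        case False
        then have "\<xi> \<in> {- T..T}" by auto
        then show ?thesis using \<xi>0 by (simp add: min_le_iff_disj)
      qed
    qed
  qed
  \<comment> \<open>Cauchy's estimate on discs of radius \<delta>/2, which stay in the strip of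
    half-width \<delta> when their centre is in the strip of half-width \<delta>/2.\<close>
  define B where "B = C / (\<delta> / 2)"
  have B0: "B > 0" using C(1) \<delta>0 by (simp add: B_def)
  have der: "norm (deriv (stieltjes_symbol a \<mu>) w) \<le> B" if "\<bar>Re w\<bar> \<le> \<delta> / 2" for w
  proof -
    have cb: "\<bar>Re v\<bar> \<le> \<delta>" if "v \<in> cball w (\<delta> / 2)" for v
      using that \<open>\<bar>Re w\<bar> \<le> \<delta> / 2\<close> abs_Re_le_cmod[of "w - v"] by (auto simp: dist_norm)
    have "norm ((deriv ^^ 1) (stieltjes_symbol a \<mu>) w) \<le> fact 1 * C / (\<delta> / 2) ^ 1"
    proof (rule Cauchy_inequality)
      show "stieltjes_symbol a \<mu> holomorphic_on ball w (\<delta> / 2)"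
        by (rule holomorphic_on_subset[OF hol]) (use cb sub in \<open>auto simp: subset_iff\<close>)
      show "continuous_on (cball w (\<delta> / 2)) (stieltjes_symbol a \<mu>)"
        by (rule continuous_on_subset[OF holomorphic_on_imp_continuous_on[OF hol]]) (use cb sub in \<open>auto simp: subset_iff\<close>)
      show "norm (stieltjes_symbol a \<mu> v) \<le> C" if "norm (w - v) = \<delta> / 2" for v
      proof -
        have "norm (stieltjes_symbol a \<mu> v) \<le> C / (1 + (Im v)\<^sup>2)" using that by (intro C(2) cb) (simp add: dist_norm)
        also have "\<dots> \<le> C / 1" using C(1) by (intro divide_left_mono) (auto simp: add_pos_nonneg)
        finally show ?thesis by simp
      qed
    qed (use \<delta>0 in auto)
    then show ?thesis by (simp add: B_def)
  qed
  \<comment> \<open>Moving by at most \<open>d\<close> from the axis changes the symbol by at most B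
    d, hence by at most c0/2.\<close>
  define d where "d = min (\<delta> / 2) (c0 / (2 * B))"
  show ?thesis
  proof (rule that)
    show "0 < d" using \<delta>0 c0 B0 by (simp add: d_def)
    show "0 < c0 / 2" using c0 by simp
    show "d \<le> min a (\<mu> - a) / 2" using \<delta>0 unfolding \<delta>_def[symmetric] d_def by simp
    show "c0 / 2 \<le> norm (z - stieltjes_symbol a \<mu> w)" if w: "\<bar>Re w\<bar> \<le> d" for w
    proof -
      define S where "S = {w. \<bar>Re w\<bar> \<le> \<delta> / 2}"
      have "S = {w. Re w \<le> \<delta> / 2} \<inter> {w. Re w \<ge> - (\<delta> / 2)}" unfolding S_def by auto
      then have "convex S" by (simp only:) (intro convex_Int convex_halfspace_Re_le convex_halfspace_Re_ge)
      then have "norm (stieltjes_symbol a \<mu> w - stieltjes_symbol a \<mu> (\<i> * of_real (Im w))) \<le> B * norm (w - \<i> * of_real (Im w))"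
      proof (rule field_differentiable_bound)
        show "(stieltjes_symbol a \<mu> has_field_derivative deriv (stieltjes_symbol a \<mu>) v) (at v within S)" if "v \<in> S" for v
          by (rule has_field_derivative_at_within, rule holomorphic_derivI[OF hol op])
             (rule sub, use that \<delta>0 in \<open>auto simp: S_def\<close>)
        show "norm (deriv (stieltjes_symbol a \<mu>) v) \<le> B" if "v \<in> S" for v using der that by (simp add: S_def)
      qed (use w \<delta>0 in \<open>auto simp: S_def d_def\<close>)
      also have "norm (w - \<i> * of_real (Im w)) = \<bar>Re w\<bar>"
        by (simp add: cmod_def)
      also have "B * \<bar>Re w\<bar> \<le> B * (c0 / (2 * B))" using w B0 by (intro mult_left_mono) (auto simp: d_def)
      also have "\<dots> = c0 / 2" using B0 by simp
      finally have "norm (stieltjes_symbol a \<mu> w - stieltjes_symbol a \<mu> (\<i> * of_real (Im w))) \<le> c0 / 2" .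
      moreover have "norm (z - stieltjes_symbol a \<mu> (\<i> * of_real (Im w))) \<le> norm (z - stieltjes_symbol a \<mu> w) + norm (stieltjes_symbol a \<mu> w - stieltjes_symbol a \<mu> (\<i> * of_real (Im w)))"
        using norm_triangle_ineq[of "z - stieltjes_symbol a \<mu> w" "stieltjes_symbol a \<mu> w - stieltjes_symbol a \<mu> (\<i> * of_real (Im w))"] by simp
      ultimately show ?thesis using c0(2)[of "Im w"] by linarith
    qed
  qed
qed

text \<open>On the axis, \<open>G\<close> times the symbol b equals z G - b/z. Inverting transforms
  turns this product into \<open>convol\<close>: \<open>\<psi>\<close> is the inverse transform of
  \<open>G\<close>, and the Stieltjes kernel comes back from b by
  \<open>fourier_inversion\<close>.\<close>

lemma resolvent_kernel:
  assumes a: "0 < a" "a < \<mu>" and z: "z \<noteq> 0" "\<And>\<xi>. z \<noteq> stieltjes_symbol a \<mu> (\<i> * of_real \<xi>)"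
  obtains \<psi> where "integrable lborel \<psi>" "\<And>x. convol (stieltjes_kernel a \<mu>) \<psi> x = z * \<psi> x - stieltjes_kernel a \<mu> x / z"
proof -
  obtain d c where d: "0 < d" "0 < c" "d \<le> min a (\<mu> - a) / 2" "\<And>w. \<bar>Re w\<bar> \<le> d \<Longrightarrow> c \<le> norm (z - stieltjes_symbol a \<mu> w)"
    using resolvent_strip[OF a z] by blast
  obtain C where C: "C > 0" "\<And>w. \<bar>Re w\<bar> \<le> min a (\<mu> - a) / 2 \<Longrightarrow> norm (stieltjes_symbol a \<mu> w) \<le> C / (1 + (Im w)\<^sup>2)"
    using stieltjes_symbol_bound[OF a refl] by blast
  define G where "G w = stieltjes_symbol a \<mu> w / (z * (z - stieltjes_symbol a \<mu> w))" for w
  define S where "S = {w. - d < Re w \<and> Re w < d}"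
  have opS: "open S" unfolding S_def
    using open_Collect_conj[OF open_halfspace_Re_gt open_halfspace_Re_lt] by blast
  have Ssub: "S \<subseteq> {w. - a < Re w \<and> Re w < \<mu> - a}"
    using d(1,3) a by (auto simp: S_def min_def split: if_splits)
  have nz: "z - stieltjes_symbol a \<mu> w \<noteq> 0" if "w \<in> S" for w
  proof -
    have "\<bar>Re w\<bar> \<le> d" using that by (auto simp: S_def)
    then show ?thesis using d(4)[of w] d(2) by auto
  qed
  have holG: "G holomorphic_on S"
    unfolding G_def using nz z(1)
    by (intro holomorphic_intros holomorphic_on_subset[OF stieltjes_symbol_holomorphic[OF a] Ssub]) auto
  define C2 where "C2 = C / (norm z * c)"
  have C20: "C2 > 0" using C(1) z(1) d(2) by (simp add: C2_def)
  have Gb: "norm (G w) \<le> C2 / (1 + (Im w)\<^sup>2)" if "w \<in> S" for w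
  proof -
    have "norm (G w) = norm (stieltjes_symbol a \<mu> w) / (norm z * norm (z - stieltjes_symbol a \<mu> w))" by (simp add: G_def norm_divide norm_mult)
    also have "\<dots> \<le> (C / (1 + (Im w)\<^sup>2)) / (norm z * c)"
      using that d z(1) C(1) by (intro frac_le mult_left_mono C(2) d(4)) (auto simp: S_def)
    finally show ?thesis by (simp add: C2_def mult.commute)
  qed
  \<comment> \<open>Discs of this radius around the axis stay inside \<open>S\<close>. The bound
    \<open>r \<le> 1\<close> keeps 1 + \<xi>^2 comparable across a disc, up to the factor 3, and
    makes the second derivative the worst case of the powers of 1/r.\<close>
  define r where "r = min (d / 2) 1"
  have r: "r > 0" "r \<le> 1" "r < d" using d(1) by (auto simp: r_def)
  have cb: "cball (\<i> * of_real \<xi>) r \<subseteq> S" for \<xi>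
  proof
    fix v assume "v \<in> cball (\<i> * of_real \<xi>) r"
    then show "v \<in> S" using abs_Re_le_cmod[of "\<i> * of_real \<xi> - v"] r by (auto simp: S_def dist_norm)
  qed
  have ders: "norm ((deriv ^^ n) G (\<i> * of_real \<xi>)) \<le> fact n * (3 * C2 / (1 + \<xi>\<^sup>2)) / r ^ n" for n \<xi>
  proof (rule Cauchy_inequality)
    show "G holomorphic_on ball (\<i> * of_real \<xi>) r"
      by (rule holomorphic_on_subset[OF holG]) (use cb[of \<xi>] in auto)
    show "continuous_on (cball (\<i> * of_real \<xi>) r) G"
      by (rule continuous_on_subset[OF holomorphic_on_imp_continuous_on[OF holG] cb])
    show "norm (G v) \<le> 3 * C2 / (1 + \<xi>\<^sup>2)" if v: "norm (\<i> * of_real \<xi> - v) = r" for v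
    proof -
      have "v \<in> S" using cb[of \<xi>] v by (auto simp: dist_norm)
      then have "norm (G v) \<le> C2 / (1 + (Im v)\<^sup>2)" by (rule Gb)
      also have "\<dots> \<le> 3 * C2 / (1 + \<xi>\<^sup>2)"
      proof -
        have "\<bar>\<xi> - Im v\<bar> \<le> 1" using abs_Im_le_cmod[of "\<i> * of_real \<xi> - v"] v r by simp
        then have "(\<xi> - Im v)\<^sup>2 \<le> 1" by (simp add: abs_square_le_1)
        \<comment> \<open>With v = Im v, the difference of the two sides is the square of \<xi> - 2
          v.\<close>
        moreover have "\<xi>\<^sup>2 \<le> 2 * (Im v)\<^sup>2 + 2 * (\<xi> - Im v)\<^sup>2"
          using zero_le_power2[of "\<xi> - 2 * Im v"] by (simp add: power2_eq_square algebra_simps)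
        moreover have "q \<le> 1 \<Longrightarrow> u \<le> 2 * v + 2 * q \<Longrightarrow> 0 \<le> v \<Longrightarrow> 1 + u \<le> 3 * (1 + v)" for q u v :: real by simp
        ultimately have "1 + \<xi>\<^sup>2 \<le> 3 * (1 + (Im v)\<^sup>2)" using zero_le_power2[of "Im v"] by blast
        then have "C2 * (1 + \<xi>\<^sup>2) \<le> C2 * (3 * (1 + (Im v)\<^sup>2))" using C20 by (intro mult_left_mono) auto
        then show ?thesis by (simp add: divide_simps add_pos_nonneg less_imp_neq[symmetric] not_less algebra_simps)
      qed
      finally show ?thesis .
    qed
  qed (use r in auto)
  \<comment> \<open>6 is 3 times 2!, the largest of the constants for the derivatives of order 0, 1
    and 2.\<close>
  define K where "K = 6 * C2 / r ^ 2"
  have Kge: "fact n * (3 * C2 / (1 + \<xi>\<^sup>2)) / r ^ n \<le> K / (1 + \<xi>\<^sup>2)" if "n \<le> 2" for n \<xi>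
  proof -
    have "fact n * 3 * C2 / r ^ n \<le> 6 * C2 / r ^ 2"
    proof (intro frac_le)
      show "fact n * 3 * C2 \<le> 6 * C2" using fact_mono[OF that, where 'a=real] C20 by (simp add: numeral_2_eq_2)
      show "r ^ 2 \<le> r ^ n" using that r by (intro power_decreasing) auto
    qed (use r C20 in auto)
    then have "(fact n * 3 * C2 / r ^ n) / (1 + \<xi>\<^sup>2) \<le> (6 * C2 / r ^ 2) / (1 + \<xi>\<^sup>2)"
      by (intro divide_right_mono) (auto simp: add_nonneg_nonneg)
    then show ?thesis by (simp add: K_def mult_ac)
  qed
  define g where "g \<xi> = G (\<i> * of_real \<xi>)" for \<xi> :: real
  define g1 where "g1 \<xi> = \<i> * deriv G (\<i> * of_real \<xi>)" for \<xi> :: real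
  define g2 where "g2 \<xi> = \<i> * (\<i> * deriv (deriv G) (\<i> * of_real \<xi>))" for \<xi> :: real
  have inS: "\<i> * of_real \<xi> \<in> S" for \<xi> using d(1) by (simp add: S_def)
  have hol1: "deriv G holomorphic_on S" by (rule holomorphic_deriv[OF holG opS])
  have hol2: "deriv (deriv G) holomorphic_on S" by (rule holomorphic_deriv[OF hol1 opS])
  have chain: "((\<lambda>\<xi>. f (\<i> * of_real \<xi>)) has_vector_derivative \<i> * deriv f (\<i> * of_real \<xi>)) (at \<xi>)" if "f holomorphic_on S" for f \<xi>
  proof -
    have "((\<lambda>\<xi>. \<i> * of_real \<xi>) has_vector_derivative \<i> * of_real 1) (at \<xi>)"
      by (intro has_vector_derivative_mult_right has_vector_derivative_of_real) (auto intro!: derivative_eq_intros)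
    from field_vector_diff_chain_at[OF this holomorphic_derivI[OF that opS inS]] show ?thesis
      by (simp add: o_def)
  qed
  have gcont: "continuous_on UNIV (\<lambda>\<xi>. f (\<i> * of_real \<xi>))" if "f holomorphic_on S" for f
    using chain[OF that] by (auto intro!: continuous_at_imp_continuous_on has_vector_derivative_continuous)
  have b0: "norm (g \<xi>) \<le> K / (1 + \<xi>\<^sup>2)" for \<xi>
    using order_trans[OF ders[of 0 \<xi>] Kge[of 0]] by (simp add: g_def)
  have pint: "integrable lborel (\<lambda>x. LINT \<xi>|lborel. g \<xi> * iexp (- \<xi> * x))"
  proof (rule inverse_fourier_integrable)
    show "(g has_vector_derivative g1 \<xi>) (at \<xi>)" for \<xi>
      unfolding g_def[abs_def] g1_def by (rule chain[OF holG])
    show "(g1 has_vector_derivative g2 \<xi>) (at \<xi>)" for \<xi>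
      unfolding g1_def[abs_def] g2_def by (intro has_vector_derivative_mult_right chain[OF hol1])
    show "continuous_on UNIV g2" unfolding g2_def[abs_def] by (intro continuous_intros gcont[OF hol2])
    show "norm (g \<xi>) \<le> K / (1 + \<xi>\<^sup>2)" for \<xi> by (rule b0)
    show "norm (g1 \<xi>) \<le> K / (1 + \<xi>\<^sup>2)" for \<xi>
      using order_trans[OF ders[of 1 \<xi>] Kge[of 1]] by (simp add: g1_def norm_mult)
    show "norm (g2 \<xi>) \<le> K / (1 + \<xi>\<^sup>2)" for \<xi>
      using order_trans[OF ders[of 2 \<xi>] Kge[of 2]] by (simp add: g2_def norm_mult numeral_2_eq_2)
  qed
  define b where "b \<xi> = stieltjes_symbol a \<mu> (\<i> * of_real \<xi>)" for \<xi> :: real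
  have b_cont: "continuous_on UNIV b" unfolding b_def[abs_def] 
    by (rule gcont, rule holomorphic_on_subset[OF stieltjes_symbol_holomorphic[OF a] Ssub])
  have g_cont: "continuous_on UNIV g" unfolding g_def[abs_def] by (rule gcont[OF holG])
  have [measurable]: "b \<in> borel_measurable borel" "g \<in> borel_measurable borel" 
    using b_cont g_cont by (auto intro: borel_measurable_continuous_onI)
  have bi: "integrable lborel b"
    by (rule integrable_bound_one_plus_square[of _ C]) (use C(2)[of "\<i> * of_real _"] a in \<open>auto simp: b_def\<close>)
  have gi: "integrable lborel g"
    by (rule integrable_bound_one_plus_square[of _ K]) (use b0 in auto)
  have inte: "integrable lborel (\<lambda>\<xi>. f \<xi> * iexp (- \<xi> * x))" if "integrable lborel f" for f :: "real \<Rightarrow> complex" and x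
    by (rule Bochner_Integration.integrable_bound[OF that]) (use that in \<open>auto simp: norm_mult\<close>)
  have inv: "(LINT \<xi>|lborel. b \<xi> * iexp (- \<xi> * x)) = 2 * pi * stieltjes_kernel a \<mu> x" for x
    by (rule fourier_inversion[OF stieltjes_kernel_integrable[OF a] stieltjes_kernel_continuous stieltjes_kernel_bound[OF a] _ bi])
       (simp only: b_def stieltjes_kernel_fourier[OF a])
  \<comment> \<open>The resolvent equation on the Fourier side, by clearing the denominator z (z -
    b) of \<open>G\<close>.\<close>
  have gb: "g \<xi> * b \<xi> = z * g \<xi> - b \<xi> / z" for \<xi>
    using nz[OF inS[of \<xi>]] z(1) by (simp add: g_def G_def b_def[symmetric] field_simps)
  define P where "P x = (LINT \<xi>|lborel. g \<xi> * iexp (- \<xi> * x))" for x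
  define \<psi> where "\<psi> x = P x / (2 * pi)" for x
  have phim [measurable]: "stieltjes_kernel a \<mu> \<in> borel_measurable borel" using stieltjes_kernel_integrable[OF a] by auto
  \<comment> \<open>\<open>P\<close> is expanded as an inverse transform under the convolution.
    Fubini then needs just the integrability of \<open>g\<close> and of the Stieltjes kernel, and
    the inner integral produces the symbol.\<close>
  have conv: "convol (stieltjes_kernel a \<mu>) P x = z * P x - 2 * pi * stieltjes_kernel a \<mu> x / z" for x
  proof -
    define H where "H y \<xi> = stieltjes_kernel a \<mu> y * (g \<xi> * iexp (- \<xi> * (x - y)))" for y \<xi>
    have [measurable]: "case_prod H \<in> borel_measurable (borel \<Otimes>\<^sub>M borel)" unfolding H_def by measurable
    have Hint: "integrable (lborel \<Otimes>\<^sub>M lborel) (\<lambda>(y, \<xi>). H y \<xi>)"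
    proof (rule lborel_pair.Fubini_integrable)
      show "integrable lborel (\<lambda>y. LINT \<xi>|lborel. norm (case (y, \<xi>) of (y, \<xi>) \<Rightarrow> H y \<xi>))"
        using integrable_norm[OF stieltjes_kernel_integrable[OF a]] by (simp add: H_def norm_mult)
      show "AE y in lborel. integrable lborel (\<lambda>\<xi>. case (y, \<xi>) of (y, \<xi>) \<Rightarrow> H y \<xi>)"
        unfolding H_def prod.case by (intro AE_I2 integrable_mult_right inte[OF gi])
    qed auto
    have "convol (stieltjes_kernel a \<mu>) P x = (LINT y|lborel. LINT \<xi>|lborel. H y \<xi>)"
      unfolding convol_def P_def H_def by (simp only: integral_mult_right_zero)
    also have "\<dots> = (LINT \<xi>|lborel. LINT y|lborel. H y \<xi>)"
      by (rule lborel_pair.Fubini_integral[OF Hint, symmetric])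
    also have "\<dots> = (LINT \<xi>|lborel. z * (g \<xi> * iexp (- \<xi> * x)) - (b \<xi> * iexp (- \<xi> * x)) / z)"
    proof (rule Bochner_Integration.integral_cong[OF refl])
      fix \<xi>
      have "H y \<xi> = (g \<xi> * iexp (- \<xi> * x)) * (stieltjes_kernel a \<mu> y * iexp (\<xi> * y))" for y
      proof -
        have "iexp (- \<xi> * (x - y)) = iexp (- \<xi> * x) * iexp (\<xi> * y)"
          by (simp add: algebra_simps flip: exp_add)
        then show ?thesis unfolding H_def by (simp only: mult_ac)
      qed
      then have "(LINT y|lborel. H y \<xi>) = (g \<xi> * iexp (- \<xi> * x)) * b \<xi>"
        by (simp only: integral_mult_right_zero stieltjes_kernel_fourier[OF a] b_def)
      also have "\<dots> = (g \<xi> * b \<xi>) * iexp (- \<xi> * x)" by (simp only: mult_ac)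
      also have "\<dots> = z * (g \<xi> * iexp (- \<xi> * x)) - (b \<xi> * iexp (- \<xi> * x)) / z"
        unfolding gb by (simp add: algebra_simps)
      finally show "(LINT y|lborel. H y \<xi>) = z * (g \<xi> * iexp (- \<xi> * x)) - (b \<xi> * iexp (- \<xi> * x)) / z" .
    qed
    also have "\<dots> = z * P x - (LINT \<xi>|lborel. b \<xi> * iexp (- \<xi> * x)) / z"
      unfolding P_def using inte[OF gi, of x] inte[OF bi, of x] by simp
    finally show ?thesis by (simp only: inv)
  qed
  show ?thesis
  proof (rule that)
    show "integrable lborel \<psi>" unfolding \<psi>_def[abs_def] P_def[abs_def] using pint by simp
    have "convol (stieltjes_kernel a \<mu>) \<psi> x = convol (stieltjes_kernel a \<mu>) P x / (2 * pi)" for x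
      unfolding convol_def \<psi>_def by simp
    then show "convol (stieltjes_kernel a \<mu>) \<psi> x = z * \<psi> x - stieltjes_kernel a \<mu> x / z" for x
      unfolding conv by (simp add: \<psi>_def diff_divide_distrib)
  qed
qed

section \<open>Approximate eigenvectors\<close>

lemma norm_stieltjes_kernel: "norm (stieltjes_kernel a \<mu> x) = exp (a * x) / (1 + exp x) powr \<mu>"
  unfolding stieltjes_kernel_def norm_of_real by simp

text \<open>The factor \<open>\<bar>x\<bar>\<close> is absorbed by exp(d x) + exp(- d x), which
  shifts the parameter \<open>a\<close> to a + d and a - d; \<open>d\<close> is small enough for
  both to stay between 0 and \<open>\<mu>\<close>.\<close>

lemma stieltjes_kernel_moment_integrable:
  assumes a: "0 < a" "a < \<mu>"
  shows "integrable lborel (\<lambda>x. norm (stieltjes_kernel a \<mu> x) * \<bar>x\<bar>)"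
proof -
  define d where "d = min a (\<mu> - a) / 2"
  have d: "0 < d" "0 < a - d" "a - d < \<mu>" "0 < a + d" "a + d < \<mu>"
  proof -
    have "2 * d \<le> a" "2 * d \<le> \<mu> - a" "0 < d" using a unfolding d_def by auto
    then show "0 < d" "0 < a - d" "a - d < \<mu>" "0 < a + d" "a + d < \<mu>" using a by linarith+
  qed
  have le: "norm (stieltjes_kernel a \<mu> x) * \<bar>x\<bar> \<le> (norm (stieltjes_kernel (a + d) \<mu> x) + norm (stieltjes_kernel (a - d) \<mu> x)) / d" for x
  proof -
    have "d * \<bar>x\<bar> \<le> exp (d * \<bar>x\<bar>)" using exp_ge_add_one_self[of "d * \<bar>x\<bar>"] by linarith
    also have "\<dots> \<le> exp (d * x) + exp (- (d * x))" by (cases "x \<ge> 0") auto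
    finally have "norm (stieltjes_kernel a \<mu> x) * (d * \<bar>x\<bar>) \<le> norm (stieltjes_kernel a \<mu> x) * (exp (d * x) + exp (- (d * x)))"
      by (intro mult_left_mono) auto
    also have "\<dots> = norm (stieltjes_kernel (a + d) \<mu> x) + norm (stieltjes_kernel (a - d) \<mu> x)"
    proof -
      have "exp ((a + d) * x) = exp (a * x) * exp (d * x)" "exp ((a - d) * x) = exp (a * x) * exp (- (d * x))"
        by (simp_all add: distrib_right left_diff_distrib flip: exp_add)
      then show ?thesis by (simp only: norm_stieltjes_kernel distrib_left times_divide_eq_left)
    qed
    finally show ?thesis using d(1) by (simp add: field_simps)
  qed
  have [measurable]: "stieltjes_kernel a \<mu> \<in> borel_measurable borel" using stieltjes_kernel_integrable[OF a] by auto
  show ?thesis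
  proof (rule Bochner_Integration.integrable_bound)
    show "integrable lborel (\<lambda>x. (norm (stieltjes_kernel (a + d) \<mu> x) + norm (stieltjes_kernel (a - d) \<mu> x)) / d)"
      using stieltjes_kernel_integrable[OF d(4,5)] stieltjes_kernel_integrable[OF d(2,3)] by auto
    show "AE x in lborel. norm (norm (stieltjes_kernel a \<mu> x) * \<bar>x\<bar>) \<le> norm ((norm (stieltjes_kernel (a + d) \<mu> x) + norm (stieltjes_kernel (a - d) \<mu> x)) / d)"
      using le d(1) by (intro AE_I2) (simp add: abs_mult abs_of_nonneg)
  qed auto
qed

text \<open>The defect is the kernel average of \<open>F\<close>, which vanishes unless exactly one
  of y and y + x lies in [-n, n]. Such y lie within \<open>\<bar>x\<bar>\<close> of an endpoint, a
  set of measure at most 4 \<open>\<bar>x\<bar>\<close> whatever n is, so the first moment of the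
  kernel bounds the defect uniformly in n.\<close>

lemma approximate_eigenvector_bound:
  fixes n :: nat and \<xi> :: real
  assumes a: "0 < a" "a < \<mu>" and p: "1 \<le> p" and n: "0 < n"
    and g_def: "g = (\<lambda>x. iexp (\<xi> * x) * of_real (indicat_real {- real n..real n} x))"
  shows "g \<in> LpR p" and "pnorm p g powr p = 2 * real n"
    and "pnorm p (\<lambda>x. stieltjes_symbol a \<mu> (\<i> * of_real \<xi>) * g x - correl (stieltjes_kernel a \<mu>) g x) powr p \<le>
      (LINT x|lborel. norm (stieltjes_kernel a \<mu> x)) powr (p - 1) * (LINT x|lborel. norm (stieltjes_kernel a \<mu> x) * (4 * \<bar>x\<bar>))"
proof -
  define J where "J = {- real n..real n}"
  have [measurable]: "g \<in> borel_measurable borel" unfolding g_def by measurable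
  have [measurable]: "J \<in> sets borel" by (simp add: J_def)
  have phii: "integrable lborel (stieltjes_kernel a \<mu>)" by (rule stieltjes_kernel_integrable[OF a])
  have [measurable]: "stieltjes_kernel a \<mu> \<in> borel_measurable borel" using phii by auto
  have ng: "norm (g x) powr p = indicat_real J x" for x
    by (auto simp: g_def norm_mult J_def indicator_def)
  have Jint: "integrable lborel (indicat_real J)" "integral\<^sup>L lborel (indicat_real J) = 2 * real n"
    unfolding J_def by simp_all
  show gLR: "g \<in> LpR p" using Jint by (simp add: LpR_def ng)
  show "pnorm p g powr p = 2 * real n" using Jint by (simp add: pnorm_powr[OF p] ng)
  define F where "F x y = iexp (\<xi> * x) * g y - g (y + x)" for x y
  have Fm: "case_prod F \<in> borel_measurable (borel \<Otimes>\<^sub>M borel)" unfolding F_def by measurable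
  have F: "F x y = iexp (\<xi> * (y + x)) * of_real (indicat_real J y - indicat_real J (y + x))" for x y
    by (simp add: F_def g_def J_def[symmetric] algebra_simps exp_add)
  have nF: "(\<integral>\<^sup>+y. ennreal (norm (F x y) powr p) \<partial>lborel) \<le> ennreal (4 * \<bar>x\<bar>)" for x
  proof -
    \<comment> \<open>\<open>A\<close> and \<open>B\<close> are the neighbourhoods of radius
      \<open>\<bar>x\<bar>\<close> of the two endpoints; they cover the support of
      \<open>F x\<close>.\<close>
    define A where "A = {- real n - \<bar>x\<bar>..- real n + \<bar>x\<bar>}"
    define B where "B = {real n - \<bar>x\<bar>..real n + \<bar>x\<bar>}"
    have "norm (F x y) powr p \<le> indicat_real A y + indicat_real B y" for y
      unfolding F by (auto simp: norm_mult indicator_def A_def B_def J_def)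
    then have "ennreal (norm (F x y) powr p) \<le> indicator A y + indicator B y" for y
      by (metis ennreal_leI ennreal_plus ennreal_indicator indicator_pos_le)
    then have "(\<integral>\<^sup>+y. ennreal (norm (F x y) powr p) \<partial>lborel) \<le> (\<integral>\<^sup>+y. indicator A y + indicator B y \<partial>lborel)"
      by (rule nn_integral_mono)
    also have "\<dots> = emeasure lborel A + emeasure lborel B"
      by (subst nn_integral_add) (auto simp: A_def B_def)
    also have "\<dots> = ennreal (4 * \<bar>x\<bar>)" by (simp add: A_def B_def flip: ennreal_plus)
    finally show ?thesis .
  qed
  define D where "D = (LINT x|lborel. norm (stieltjes_kernel a \<mu> x) * (4 * \<bar>x\<bar>))"
  have Di: "integrable lborel (\<lambda>x. norm (stieltjes_kernel a \<mu> x) * (4 * \<bar>x\<bar>))"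
    using integrable_mult_right[OF stieltjes_kernel_moment_integrable[OF a], of 4] by (simp add: mult_ac)
  have D0: "0 \<le> D" unfolding D_def by simp
  have "(\<integral>\<^sup>+x. ennreal (norm (stieltjes_kernel a \<mu> x)) * (\<integral>\<^sup>+y. ennreal (norm (F x y) powr p) \<partial>lborel) \<partial>lborel)
    \<le> (\<integral>\<^sup>+x. ennreal (norm (stieltjes_kernel a \<mu> x) * (4 * \<bar>x\<bar>)) \<partial>lborel)"
    using nF by (intro nn_integral_mono) (auto simp: ennreal_mult intro!: mult_left_mono)
  also have "\<dots> = ennreal D" unfolding D_def by (rule nn_integral_eq_integral[OF Di]) auto
  finally have DD: "(\<integral>\<^sup>+x. ennreal (norm (stieltjes_kernel a \<mu> x)) * (\<integral>\<^sup>+y. ennreal (norm (F x y) powr p) \<partial>lborel) \<partial>lborel) \<le> ennreal D" .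
  have pi: "integrable lborel (\<lambda>x. stieltjes_kernel a \<mu> x * iexp (\<xi> * x))"
    by (rule Bochner_Integration.integrable_bound[OF phii]) (auto simp: norm_mult)
  have eq: "AE y in lborel. stieltjes_symbol a \<mu> (\<i> * of_real \<xi>) * g y - correl (stieltjes_kernel a \<mu>) g y = (LINT x|lborel. stieltjes_kernel a \<mu> x * F x y)"
    using correl_AE_integrable[OF p phii gLR]
  proof eventually_elim
    case (elim y)
    have "stieltjes_symbol a \<mu> (\<i> * of_real \<xi>) * g y = (LINT x|lborel. (stieltjes_kernel a \<mu> x * iexp (\<xi> * x)) * g y)"
      by (simp only: stieltjes_kernel_fourier[OF a, symmetric] integral_mult_left_zero)
    then have "stieltjes_symbol a \<mu> (\<i> * of_real \<xi>) * g y - correl (stieltjes_kernel a \<mu>) g y = 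
       (LINT x|lborel. (stieltjes_kernel a \<mu> x * iexp (\<xi> * x)) * g y) - (LINT x|lborel. stieltjes_kernel a \<mu> x * g (y + x))"
      by (simp only: correl_def)
    also have "\<dots> = (LINT x|lborel. (stieltjes_kernel a \<mu> x * iexp (\<xi> * x)) * g y - stieltjes_kernel a \<mu> x * g (y + x))"
      by (rule Bochner_Integration.integral_diff[OF integrable_mult_left[OF pi] elim, symmetric])
    also have "\<dots> = (LINT x|lborel. stieltjes_kernel a \<mu> x * F x y)"
      unfolding F_def right_diff_distrib mult.assoc ..
    finally show ?case .
  qed
  have "pnorm p (\<lambda>x. stieltjes_symbol a \<mu> (\<i> * of_real \<xi>) * g x - correl (stieltjes_kernel a \<mu>) g x) = pnorm p (\<lambda>y. LINT x|lborel. stieltjes_kernel a \<mu> x * F x y)"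
    by (rule LpR_cong_AE(2)[OF minkowski_kernel(2)[OF p phii Fm DD D0]]) (use eq in \<open>auto elim: eventually_mono\<close>)
  then show "pnorm p (\<lambda>x. stieltjes_symbol a \<mu> (\<i> * of_real \<xi>) * g x - correl (stieltjes_kernel a \<mu>) g x) powr p \<le>
      (LINT x|lborel. norm (stieltjes_kernel a \<mu> x)) powr (p - 1) * D"
    using minkowski_kernel(3)[OF p phii Fm DD D0] by (simp add: pnorm_powr[OF p])
qed

lemma approximate_eigenvector:
  assumes a: "0 < a" "a < \<mu>" and p: "1 \<le> p" and e: "0 < e"
  obtains g where "g \<in> LpR p" "0 < pnorm p g" "pnorm p (\<lambda>x. stieltjes_symbol a \<mu> (\<i> * of_real \<xi>) * g x - correl (stieltjes_kernel a \<mu>) g x) \<le> e * pnorm p g"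
proof -
  define C where "C = (LINT x|lborel. norm (stieltjes_kernel a \<mu> x)) powr (p - 1) * (LINT x|lborel. norm (stieltjes_kernel a \<mu> x) * (4 * \<bar>x\<bar>))"
  \<comment> \<open>\<open>C\<close> bounds the p-th power of the defect and does not depend on the
    length; 2 m is the p-th power of the norm, so a long interval makes the quotient as small as
    desired.\<close>
  obtain n where n: "C / (2 * e powr p) < real n" using reals_Archimedean2 by blast
  define m where "m = Suc n"
  have "C < real n * (2 * e powr p)" using n e by (simp add: field_simps)
  also have "\<dots> \<le> real m * (2 * e powr p)" by (intro mult_right_mono) (auto simp: m_def)
  finally have m: "0 < m" "C \<le> e powr p * (2 * real m)" by (auto simp: m_def algebra_simps)
  define g where "g = (\<lambda>x. iexp (\<xi> * x) * of_real (indicat_real {- real m..real m} x))"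
  note b = approximate_eigenvector_bound[OF a p m(1) g_def, folded C_def]
  show ?thesis
  proof (rule that)
    show "g \<in> LpR p" by (rule b(1))
    have "pnorm p g powr p > 0" using b(2) m by simp
    then show "0 < pnorm p g" using pnorm_nonneg[of p g] by (metis less_numeral_extra(3) order_le_less powr_0)
    have "pnorm p (\<lambda>x. stieltjes_symbol a \<mu> (\<i> * of_real \<xi>) * g x - correl (stieltjes_kernel a \<mu>) g x) powr p \<le> (e * pnorm p g) powr p"
      using b(2,3) m(2) e by (simp add: powr_mult)
    then show "pnorm p (\<lambda>x. stieltjes_symbol a \<mu> (\<i> * of_real \<xi>) * g x - correl (stieltjes_kernel a \<mu>) g x) \<le> e * pnorm p g"
      using p e by (subst pnorm_le_iff) (auto simp: pnorm_powr)
  qed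
qed

lemma approximate_eigenvector_closure:
  assumes a: "0 < a" "a < \<mu>" and p: "1 \<le> p" and e: "0 < e" and z: "z = 0 \<or> (\<exists>\<xi>. z = stieltjes_symbol a \<mu> (\<i> * of_real \<xi>))"
  obtains g where "g \<in> LpR p" "0 < pnorm p g" "pnorm p (\<lambda>x. z * g x - correl (stieltjes_kernel a \<mu>) g x) \<le> e * pnorm p g"
proof -
  have "\<exists>\<xi>. norm (z - stieltjes_symbol a \<mu> (\<i> * of_real \<xi>)) \<le> e / 2"
    using z
  proof
    assume "z = 0"
    obtain C where C: "C > 0" "\<And>w. \<bar>Re w\<bar> \<le> min a (\<mu> - a) / 2 \<Longrightarrow> norm (stieltjes_symbol a \<mu> w) \<le> C / (1 + (Im w)\<^sup>2)"
      using stieltjes_symbol_bound[OF a refl] by blast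
    \<comment> \<open>The frequency at which the decay bound of the symbol drops below e/2; in this
      way 0 is treated as a limit of values of the symbol.\<close>
    define T where "T = sqrt (2 * C / e)"
    have "norm (stieltjes_symbol a \<mu> (\<i> * of_real T)) \<le> C / (1 + T\<^sup>2)" using C(2)[of "\<i> * of_real T"] a by simp
    also have "\<dots> \<le> e / 2" using C(1) e by (simp add: T_def field_simps add_pos_pos)
    finally show ?thesis using \<open>z = 0\<close> by (auto intro!: exI[of _ T])
  next
    assume "\<exists>\<xi>. z = stieltjes_symbol a \<mu> (\<i> * of_real \<xi>)"
    then show ?thesis using e by (metis cancel_comm_monoid_add_class.diff_cancel half_gt_zero less_imp_le norm_zero)
  qed
  then obtain \<xi> where \<xi>: "norm (z - stieltjes_symbol a \<mu> (\<i> * of_real \<xi>)) \<le> e / 2" by blast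
  define w where "w = stieltjes_symbol a \<mu> (\<i> * of_real \<xi>)"
  obtain g where g: "g \<in> LpR p" "0 < pnorm p g" "pnorm p (\<lambda>x. w * g x - correl (stieltjes_kernel a \<mu>) g x) \<le> e / 2 * pnorm p g"
    using approximate_eigenvector[OF a p, of "e / 2" \<xi>] e unfolding w_def by auto
  have cg: "correl (stieltjes_kernel a \<mu>) g \<in> LpR p" by (rule correl_LpR_mem[OF p stieltjes_kernel_integrable[OF a] g(1)])
  have "pnorm p (\<lambda>x. z * g x - correl (stieltjes_kernel a \<mu>) g x) = pnorm p (\<lambda>x. (z - w) * g x + (w * g x - correl (stieltjes_kernel a \<mu>) g x))"
    by (simp add: algebra_simps)
  also have "\<dots> \<le> pnorm p (\<lambda>x. (z - w) * g x) + pnorm p (\<lambda>x. w * g x - correl (stieltjes_kernel a \<mu>) g x)"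
    by (intro pnorm_triangle p LpR_scale LpR_diff_mem g cg)
  also have "\<dots> \<le> e / 2 * pnorm p g + e / 2 * pnorm p g"
    using mult_right_mono[OF \<xi>, of "pnorm p g"] g(3) by (intro add_mono) (auto simp only: LpR_scale(2)[OF p g(1)] w_def pnorm_nonneg)
  finally have "pnorm p (\<lambda>x. z * g x - correl (stieltjes_kernel a \<mu>) g x) \<le> e * pnorm p g" by simp
  with g that show ?thesis by blast
qed

section \<open>The half line in logarithmic coordinates\<close>

lemma half_line_AE: "(AE t in half_line. P t) \<longleftrightarrow> (AE t in lborel. 0 < t \<longrightarrow> P t)"
  by (subst AE_restrict_space_iff) (auto simp: AE_completion_iff)

lemma half_line_AE_exp:
  fixes P :: "real \<Rightarrow> bool"
  assumes "Measurable.pred borel P"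
  shows "(AE t in half_line. P t) \<longleftrightarrow> (AE x in lborel. P (exp x))"
  unfolding half_line_AE by (rule AE_exp_subst[OF assms])

lemma half_line_integral:
  fixes f :: "real \<Rightarrow> complex"
  assumes [measurable]: "f \<in> borel_measurable borel"
  shows half_line_integrable_iff: "integrable half_line f \<longleftrightarrow> integrable lborel (\<lambda>x. exp x *\<^sub>R f (exp x))"
    and half_line_integral_eq: "integral\<^sup>L half_line f = (LINT x|lborel. exp x *\<^sub>R f (exp x))"
proof -
  have m: "(\<lambda>t. indicat_real {0<..} t *\<^sub>R f t) \<in> borel_measurable lborel" by measurable
  show "integrable half_line f \<longleftrightarrow> integrable lborel (\<lambda>x. exp x *\<^sub>R f (exp x))"
    by (subst integrable_restrict_space)
       (simp_all add: integrable_completion[OF m] integrable_exp_subst)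
  show "integral\<^sup>L half_line f = (LINT x|lborel. exp x *\<^sub>R f (exp x))"
    by (subst integral_restrict_space)
       (simp_all add: integral_completion[OF m] integral_exp_subst)
qed

text \<open>Completeness of Lebesgue measure. It gives measurability of an arbitrary representative
  from \<open>ae_eq\<close> alone.\<close>

lemma half_line_measurable_cong_AE:
  fixes f b :: "real \<Rightarrow> complex"
  assumes b: "b \<in> borel_measurable half_line" and ae: "ae_eq f b"
  shows "f \<in> borel_measurable half_line"
proof -
  define f0 b0 where "f0 = (\<lambda>t. if t \<in> {0<..} then f t else 0)" and "b0 = (\<lambda>t. if t \<in> {0<..} then b t else 0)"
  have S: "{0<..} \<in> sets (lebesgue :: real measure)" by simp
  have b0: "b0 \<in> borel_measurable lebesgue" 
    unfolding b0_def using b borel_measurable_if[OF S, of b] by blast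
  have ae0: "AE t in lebesgue. f0 t = b0 t"
    using ae unfolding ae_eq_def half_line_AE AE_completion_iff
    by (rule eventually_mono) (auto simp: f0_def b0_def)
  have "f0 \<in> borel_measurable lebesgue"
  proof (rule measurableI)
    fix A :: "complex set" assume "A \<in> sets borel"
    then have "b0 -` A \<inter> space lebesgue \<in> sets lebesgue" by (rule measurable_sets[OF b0])
    then show "f0 -` A \<inter> space lebesgue \<in> sets lebesgue"
      by (rule completion.in_sets_AE[rotated]) (use ae0 in \<open>auto elim: eventually_mono\<close>)
  qed auto
  then show ?thesis unfolding f0_def using borel_measurable_if[OF S, of f] by blast
qed

lemma half_line_ex_borel:
  fixes f :: "real \<Rightarrow> complex"
  assumes "f \<in> borel_measurable half_line"
  obtains b where "b \<in> borel_measurable borel" "ae_eq f b"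
proof -
  define f0 where "f0 = (\<lambda>t. if t \<in> {0<..} then f t else 0)"
  have "f0 \<in> borel_measurable lebesgue" 
    unfolding f0_def using assms borel_measurable_if[of "{0<..}" f] by auto
  then have "(\<lambda>t. Re (f0 t)) \<in> borel_measurable lebesgue" "(\<lambda>t. Im (f0 t)) \<in> borel_measurable lebesgue"
    by auto
  then obtain b1 b2 where b: "b1 \<in> borel_measurable lborel" "AE t in lborel. Re (f0 t) = b1 t"
    "b2 \<in> borel_measurable lborel" "AE t in lborel. Im (f0 t) = b2 t"
    using completion_ex_borel_measurable_real by metis
  show ?thesis
  proof (rule that)
    show "(\<lambda>t. Complex (b1 t) (b2 t)) \<in> borel_measurable borel"
      using b by (auto simp: borel_measurable_complex_iff)
    show "ae_eq f (\<lambda>t. Complex (b1 t) (b2 t))"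
      unfolding ae_eq_def half_line_AE using b(2,4)
      by eventually_elim (auto simp: f0_def complex_eq_iff)
  qed
qed

lemma ae_eq_refl [simp]: "ae_eq f f" by (simp add: ae_eq_def)
lemma ae_eq_sym: "ae_eq f g \<Longrightarrow> ae_eq g f" by (auto simp: ae_eq_def elim: eventually_mono)
lemma ae_eq_trans:
  assumes "ae_eq f g" "ae_eq g h" shows "ae_eq f h"
  using assms unfolding ae_eq_def by eventually_elim simp

lemma ae_eq_add:
  assumes "ae_eq f f'" "ae_eq g g'" shows "ae_eq (\<lambda>t. f t + g t) (\<lambda>t. f' t + g' t)"
  using assms unfolding ae_eq_def by eventually_elim simp

lemma ae_eq_diff:
  assumes "ae_eq f f'" "ae_eq g g'" shows "ae_eq (\<lambda>t. f t - g t) (\<lambda>t. f' t - g' t)"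
  using assms unfolding ae_eq_def by eventually_elim simp

lemma ae_eq_scale:
  assumes "ae_eq f f'" shows "ae_eq (\<lambda>t. c * f t) (\<lambda>t. c * f' t)"
  using assms unfolding ae_eq_def by eventually_elim simp

definition from_log :: "real \<Rightarrow> (real \<Rightarrow> complex) \<Rightarrow> real \<Rightarrow> complex" where
  "from_log p g t = of_real (t powr (- 1 / p)) * g (ln t)"

lemma from_log_measurable [measurable]:
  assumes [measurable]: "g \<in> borel_measurable borel"
  shows "from_log p g \<in> borel_measurable borel"
  unfolding from_log_def[abs_def] by measurable

lemma borel_half_line [intro]: "f \<in> borel_measurable borel \<Longrightarrow> f \<in> borel_measurable half_line"
  by (intro measurable_restrict_space1 measurable_completion) auto

lemma from_log_exp: "from_log p g (exp x) = of_real (exp (- x / p)) * g x"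
  by (simp add: from_log_def powr_def)

lemma ae_eq_from_log_iff:
  assumes [measurable]: "g \<in> borel_measurable borel" "h \<in> borel_measurable borel"
  shows "ae_eq (from_log p g) (from_log p h) \<longleftrightarrow> (AE x in lborel. g x = h x)"
  unfolding ae_eq_def by (subst half_line_AE_exp) (auto simp: from_log_exp)

lemma from_log_diff: "from_log p (\<lambda>x. f x - g x) = (\<lambda>t. from_log p f t - from_log p g t)"
  by (auto simp: from_log_def fun_eq_iff right_diff_distrib)
lemma from_log_add: "from_log p (\<lambda>x. f x + g x) = (\<lambda>t. from_log p f t + from_log p g t)"
  by (auto simp: from_log_def fun_eq_iff distrib_left)
lemma from_log_scale: "from_log p (\<lambda>x. c * g x) = (\<lambda>t. c * from_log p g t)"
  by (auto simp: from_log_def fun_eq_iff)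

lemma from_log_powr:
  assumes p: "1 \<le> p" and [measurable]: "g \<in> borel_measurable borel"
  shows "integrable half_line (\<lambda>t. norm (from_log p g t) powr p) \<longleftrightarrow> integrable lborel (\<lambda>x. norm (g x) powr p)"
    and "(LINT t|half_line. norm (from_log p g t) powr p) = (LINT x|lborel. norm (g x) powr p)"
proof -
  have e: "exp x *\<^sub>R complex_of_real (norm (from_log p g (exp x)) powr p) = complex_of_real (norm (g x) powr p)" for x
  proof -
    have "norm (from_log p g (exp x)) powr p = exp (- x) * norm (g x) powr p"
      using p by (simp add: from_log_exp norm_mult powr_mult) (simp add: powr_def)
    then show ?thesis by (simp add: scaleR_conv_of_real exp_minus)
  qed
  have "integrable half_line (\<lambda>t. norm (from_log p g t) powr p) \<longleftrightarrow> integrable half_line (\<lambda>t. complex_of_real (norm (from_log p g t) powr p))"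
    by (simp only: complex_of_real_integrable_eq)
  also have "\<dots> \<longleftrightarrow> integrable lborel (\<lambda>x. complex_of_real (norm (g x) powr p))"
    by (subst half_line_integrable_iff) (simp_all only: e, measurable)
  finally show "integrable half_line (\<lambda>t. norm (from_log p g t) powr p) \<longleftrightarrow> integrable lborel (\<lambda>x. norm (g x) powr p)"
    by (simp only: complex_of_real_integrable_eq)
  have "complex_of_real (LINT t|half_line. norm (from_log p g t) powr p) = (LINT t|half_line. complex_of_real (norm (from_log p g t) powr p))"
    by (rule integral_complex_of_real[symmetric])
  also have "\<dots> = (LINT x|lborel. complex_of_real (norm (g x) powr p))"
    by (subst half_line_integral_eq) (simp_all only: e, measurable)
  also have "\<dots> = complex_of_real (LINT x|lborel. norm (g x) powr p)"
    by (rule integral_complex_of_real)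
  finally show "(LINT t|half_line. norm (from_log p g t) powr p) = (LINT x|lborel. norm (g x) powr p)"
    by (simp only: of_real_eq_iff)
qed

lemma Lp_norm_cong_AE:
  assumes f: "f \<in> borel_measurable half_line" and g: "g \<in> borel_measurable half_line" and ae: "ae_eq f g"
  shows "f \<in> Lp p \<longleftrightarrow> g \<in> Lp p" "Lp_norm p f = Lp_norm p g"
proof -
  note [measurable] = f g
  have ae': "AE t in half_line. norm (f t) powr p = norm (g t) powr p"
    using ae unfolding ae_eq_def by eventually_elim simp
  have "integrable half_line (\<lambda>t. norm (f t) powr p) \<longleftrightarrow> integrable half_line (\<lambda>t. norm (g t) powr p)"
    using ae' by (intro integrable_cong_AE) measurable
  then show "f \<in> Lp p \<longleftrightarrow> g \<in> Lp p" using f g by (simp add: Lp_def)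
  have "(LINT t|half_line. norm (f t) powr p) = (LINT t|half_line. norm (g t) powr p)"
    using ae' by (intro integral_cong_AE) measurable
  then show "Lp_norm p f = Lp_norm p g" by (simp add: Lp_norm_def)
qed

lemma from_log_Lp:
  assumes p: "1 \<le> p" and g: "g \<in> LpR p" and ae: "ae_eq f (from_log p g)"
  shows from_log_Lp_mem: "f \<in> Lp p" and from_log_Lp_norm: "Lp_norm p f = pnorm p g"
proof -
  have [measurable]: "g \<in> borel_measurable borel" using g by (simp add: LpR_def)
  have Jm: "from_log p g \<in> borel_measurable half_line" by auto
  have fm: "f \<in> borel_measurable half_line" by (rule half_line_measurable_cong_AE[OF Jm ae])
  have "from_log p g \<in> Lp p" using g Jm from_log_powr(1)[OF p, of g] by (simp add: Lp_def LpR_def)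
  then show "f \<in> Lp p" using Lp_norm_cong_AE(1)[OF fm Jm ae] by simp
  show "Lp_norm p f = pnorm p g" using Lp_norm_cong_AE(2)[OF fm Jm ae, of p] from_log_powr(2)[OF p, of g]
    by (simp add: Lp_norm_def pnorm_def)
qed

lemma Lp_imp_from_log:
  assumes p: "1 \<le> p" and f: "f \<in> Lp p"
  obtains g where "g \<in> LpR p" "ae_eq f (from_log p g)"
proof -
  have fm: "f \<in> borel_measurable half_line" using f by (simp add: Lp_def)
  then obtain b where b [measurable]: "b \<in> borel_measurable borel" and ae: "ae_eq f b" by (rule half_line_ex_borel)
  define g where "g x = of_real (exp (x / p)) * b (exp x)" for x
  have [measurable]: "g \<in> borel_measurable borel" unfolding g_def by measurable
  have "from_log p g t = b t" if "t > 0" for t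
    using that by (simp add: from_log_def g_def powr_def mult.assoc[symmetric] flip: of_real_mult exp_add)
  then have ae2: "ae_eq f (from_log p g)"
    using ae unfolding ae_eq_def half_line_AE by (auto elim: eventually_mono)
  have Jm: "from_log p g \<in> borel_measurable half_line" by auto
  have "from_log p g \<in> Lp p" using Lp_norm_cong_AE(1)[OF fm Jm ae2, of p] f by simp
  then have "g \<in> LpR p" using from_log_powr(1)[OF p, of g] by (simp add: Lp_def LpR_def)
  then show ?thesis using ae2 that by blast
qed

text \<open>Under s = t exp(x) the kernel is homogeneous: the integral releases the power t^(\<beta>
  - 1/p - \<mu>), which the prefactor t^(\<mu> - \<beta>) turns into the weight t^(-1/p) of
  \<open>from_log\<close>.\<close>

lemma stieltjes_from_log:
  assumes p: "1 \<le> p" and g [measurable]: "g \<in> borel_measurable borel" and ae: "ae_eq f (from_log p g)" and t: "0 < t"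
  shows "stieltjes \<beta> \<mu> f t = from_log p (correl (stieltjes_kernel (\<beta> - 1 / p) \<mu>) g) t"
proof -
  define y where "y = ln t"
  have ty: "t = exp y" using t by (simp add: y_def)
  have [measurable]: "f \<in> borel_measurable half_line"
    by (rule half_line_measurable_cong_AE[OF _ ae]) auto
  have [measurable]: "from_log p g \<in> borel_measurable half_line" by auto
  have id [measurable]: "(\<lambda>s. s) \<in> borel_measurable half_line" by auto
  define k where "k s = complex_of_real (s powr (\<beta> - 1) / (s + t) powr \<mu>)" for s
  have k_borel [measurable]: "k \<in> borel_measurable borel" unfolding k_def[abs_def] by measurable
  then have k_half [measurable]: "k \<in> borel_measurable half_line" by auto
  have "(LINT s|half_line. k s * f s) = (LINT s|half_line. k s * from_log p g s)"
    using ae by (intro integral_cong_AE) (auto simp: ae_eq_def elim: eventually_mono)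
  also have "\<dots> = (LINT x|lborel. exp x *\<^sub>R (k (exp x) * from_log p g (exp x)))"
    by (rule half_line_integral_eq) measurable
  also have "\<dots> = (LINT x|lborel. exp (y + x) *\<^sub>R (k (exp (y + x)) * from_log p g (exp (y + x))))"
    using lborel_integral_shift[of "\<lambda>x. exp x *\<^sub>R (k (exp x) * from_log p g (exp x))" y] by (simp add: add.commute)
  also have "\<dots> = (LINT x|lborel. of_real (exp (y * (\<beta> - 1 / p - \<mu>))) * (stieltjes_kernel (\<beta> - 1 / p) \<mu> x * g (y + x)))"
  proof (rule Bochner_Integration.integral_cong[OF refl])
    fix x
    have "(exp (y + x) + exp y) powr \<mu> = exp (y * \<mu>) * (1 + exp x) powr \<mu>"
    proof -
      have "exp (y + x) + exp y = exp y * (1 + exp x)" by (simp add: exp_add algebra_simps)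
      also have "\<dots> powr \<mu> = exp y powr \<mu> * (1 + exp x) powr \<mu>" by (rule powr_mult)
      finally show ?thesis by (simp add: powr_def mult.commute)
    qed
    then have "exp (y + x) * (exp (y + x) powr (\<beta> - 1) / (exp (y + x) + t) powr \<mu>) * exp (- (y + x) / p)
      = exp (y * (\<beta> - 1 / p - \<mu>)) * (exp ((\<beta> - 1 / p) * x) / (1 + exp x) powr \<mu>)"
    proof -
      assume *: "(exp (y + x) + exp y) powr \<mu> = exp (y * \<mu>) * (1 + exp x) powr \<mu>"
      have "exp (y + x) * (exp (y + x) powr (\<beta> - 1) / (exp (y + x) + t) powr \<mu>) * exp (- (y + x) / p)
        = (exp (y + x) * exp ((\<beta> - 1) * (y + x)) * exp (- (y + x) / p) * exp (- (y * \<mu>))) / (1 + exp x) powr \<mu>"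
        unfolding ty * by (simp add: powr_def exp_minus field_simps)
      also have "exp (y + x) * exp ((\<beta> - 1) * (y + x)) * exp (- (y + x) / p) * exp (- (y * \<mu>)) 
         = exp (y * (\<beta> - 1 / p - \<mu>)) * exp ((\<beta> - 1 / p) * x)"
        unfolding exp_add[symmetric] by (simp add: algebra_simps add_divide_distrib diff_divide_distrib)
      finally show ?thesis by simp
    qed
    then have "complex_of_real (exp (y + x) * (exp (y + x) powr (\<beta> - 1) / (exp (y + x) + t) powr \<mu>) * exp (- (y + x) / p))
      = complex_of_real (exp (y * (\<beta> - 1 / p - \<mu>)) * (exp ((\<beta> - 1 / p) * x) / (1 + exp x) powr \<mu>))"
      by (rule arg_cong)
    then show "exp (y + x) *\<^sub>R (k (exp (y + x)) * from_log p g (exp (y + x))) = 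
      of_real (exp (y * (\<beta> - 1 / p - \<mu>))) * (stieltjes_kernel (\<beta> - 1 / p) \<mu> x * g (y + x))"
      unfolding k_def from_log_exp stieltjes_kernel_def scaleR_conv_of_real mult.assoc[symmetric]
      by (simp only: of_real_mult)
  qed
  also have "\<dots> = of_real (exp (y * (\<beta> - 1 / p - \<mu>))) * correl (stieltjes_kernel (\<beta> - 1 / p) \<mu>) g y"
    unfolding correl_def by (rule integral_mult_right_zero)
  finally have "stieltjes \<beta> \<mu> f t = of_real (t powr (\<mu> - \<beta>)) * (of_real (exp (y * (\<beta> - 1 / p - \<mu>))) * correl (stieltjes_kernel (\<beta> - 1 / p) \<mu>) g y)"
    by (simp only: stieltjes_def k_def)
  also have "\<dots> = from_log p (correl (stieltjes_kernel (\<beta> - 1 / p) \<mu>) g) t"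
  proof -
    have "t powr (\<mu> - \<beta>) * exp (y * (\<beta> - 1 / p - \<mu>)) = t powr (- 1 / p)"
      using t by (simp add: powr_def y_def[symmetric] algebra_simps flip: exp_add)
    then have "complex_of_real (t powr (\<mu> - \<beta>)) * complex_of_real (exp (y * (\<beta> - 1 / p - \<mu>))) = of_real (t powr (- 1 / p))"
      by (simp only: flip: of_real_mult)
    then show ?thesis unfolding from_log_def y_def[symmetric] mult.assoc[symmetric] by (simp only:)
  qed
  finally show ?thesis .
qed

section \<open>Weyl fractional calculus as correlation with power kernels\<close>

text \<open>The kernel of fractional integration, set to 0 on the nonpositive axis. Correlation with
  it is the Weyl integral of order -a.\<close>

definition power_kernel :: "real \<Rightarrow> real \<Rightarrow> complex" where
  "power_kernel a r = of_real (indicat_real {0<..} r * r powr (a - 1) / Gamma a)"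

lemma power_kernel_measurable [measurable]: "power_kernel a \<in> borel_measurable borel"
  unfolding power_kernel_def[abs_def] by measurable

lemma power_kernel_nonpos [simp]: "r \<le> 0 \<Longrightarrow> power_kernel a r = 0"
  by (simp add: power_kernel_def)

lemma norm_power_kernel: "0 < a \<Longrightarrow> norm (power_kernel a r) = indicat_real {0<..} r * r powr (a - 1) / Gamma a"
  unfolding power_kernel_def norm_of_real using Gamma_real_pos[of a] by (simp add: abs_mult)

text \<open>The semigroup law of fractional integrals: scaling x = w v leaves the Beta integral over
  [0, 1], and Beta(a, b) / (Gamma(a) Gamma(b)) = 1 / Gamma(a + b).\<close>

lemma convol_power_kernel:
  assumes a: "0 < a" and b: "0 < b"
  shows "convol (power_kernel a) (power_kernel b) w = power_kernel (a + b) w"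
proof (cases "0 < w")
  case False
  then have z: "power_kernel a x * power_kernel b (w - x) = 0" for x by (cases "0 < x") auto
  show ?thesis unfolding convol_def z using False by simp
next
  case True
  have G: "Gamma a > 0" "Gamma b > 0" "Gamma (a + b) > 0" using a b by (auto intro: Gamma_real_pos)
  have "convol (power_kernel a) (power_kernel b) w = w *\<^sub>R (LINT v|lborel. power_kernel a (w * v) * power_kernel b (w - w * v))"
    unfolding convol_def using lborel_integral_real_affine[of w "\<lambda>x. power_kernel a x * power_kernel b (w - x)" 0] True by simp
  also have "(\<lambda>v. power_kernel a (w * v) * power_kernel b (w - w * v)) = (\<lambda>v. complex_of_real (w powr (a - 1) * w powr (b - 1) / (Gamma a * Gamma b) *
     (indicator {0..1} v *\<^sub>R (v powr (a - 1) * (1 - v) powr (b - 1)))))"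
  proof
    fix v :: real
    consider "v \<le> 0" | "v \<ge> 1" | "0 < v" "v < 1" by linarith
    then show "power_kernel a (w * v) * power_kernel b (w - w * v) = complex_of_real (w powr (a - 1) * w powr (b - 1) / (Gamma a * Gamma b) *
     (indicator {0..1} v *\<^sub>R (v powr (a - 1) * (1 - v) powr (b - 1))))"
    proof cases
      case 1
      then have "w * v \<le> 0" using True by (simp add: mult_le_0_iff)
      then show ?thesis using 1 by (auto simp: indicator_def)
    next
      case 2
      then have "w - w * v \<le> 0" using True by simp
      then show ?thesis using 2 by (auto simp: indicator_def)
    next
      case 3
      then have "0 < w * v" "0 < w - w * v" using True by auto
      moreover have "w - w * v = w * (1 - v)" by (simp add: algebra_simps)
      ultimately show ?thesis using 3 True
        by (simp add: power_kernel_def powr_mult)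
    qed
  qed
  also have "(LINT v|lborel. complex_of_real (w powr (a - 1) * w powr (b - 1) / (Gamma a * Gamma b) *
     (indicator {0..1} v *\<^sub>R (v powr (a - 1) * (1 - v) powr (b - 1)))))
     = complex_of_real (w powr (a - 1) * w powr (b - 1) / (Gamma a * Gamma b) * Beta a b)"
  proof -
    have "(LINT v|lborel. indicator {0..1} v *\<^sub>R (v powr (a - 1) * (1 - v) powr (b - 1))) = Beta a b"
      using set_borel_integral_eq_integral(2)[OF integrable_Beta[OF a b]] integral_unique[OF has_integral_Beta_real[OF a b]]
      by (simp add: set_lebesgue_integral_def)
    then show ?thesis by (simp only: integral_complex_of_real integral_mult_right_zero)
  qed
  also have "w *\<^sub>R \<dots> = complex_of_real ((w * (w powr (a - 1) * w powr (b - 1))) * (Beta a b / (Gamma a * Gamma b)))"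
    by (simp add: scaleR_conv_of_real)
  also have "w * (w powr (a - 1) * w powr (b - 1)) = w powr (a + b - 1)"
    using True by (simp add: powr_diff powr_add)
  also have "Beta a b / (Gamma a * Gamma b) = 1 / Gamma (a + b)" using G by (simp add: Beta_def)
  finally show ?thesis unfolding power_kernel_def[of "a + b"] using True by simp
qed

section \<open>Fractional integrals of rapidly decaying functions\<close>

text \<open>An integrable substitute for the power kernel: \<open>k\<close> powers of decay are
  borrowed from the function it is applied to.\<close>

definition power_majorant :: "real \<Rightarrow> nat \<Rightarrow> real \<Rightarrow> real" where
  "power_majorant a k r = norm (power_kernel a r) / (1 + r) ^ k"

lemma power_majorant_nonneg: "0 \<le> power_majorant a k r"
  by (cases "0 < r") (auto simp: power_majorant_def)

text \<open>In the variable ln r, after multiplication by the Jacobian, this is the Stieltjes kernel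
  with parameters \<open>a\<close> and \<open>k\<close>, up to the factor 1/Gamma(a).\<close>

lemma power_majorant_integrable:
  assumes a: "0 < a" "a < real k"
  shows "integrable lborel (power_majorant a k)"
proof -
  define f where "f r = complex_of_real (r powr (a - 1) / (1 + r) powr real k)" for r :: real
  have [measurable]: "f \<in> borel_measurable borel" unfolding f_def[abs_def] by measurable
  have "exp x *\<^sub>R f (exp x) = stieltjes_kernel a (real k) x" for x
  proof -
    have "exp x * exp x powr (a - 1) = exp (a * x)" by (simp add: powr_def algebra_simps flip: exp_add)
    then have "complex_of_real (exp x) * complex_of_real (exp x powr (a - 1)) = of_real (exp (a * x))"
      by (simp only: flip: of_real_mult)
    then show ?thesis unfolding f_def stieltjes_kernel_def scaleR_conv_of_real of_real_divide times_divide_eq_right by simp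
  qed
  then have "integrable lborel (\<lambda>t. indicat_real {0<..} t *\<^sub>R f t)"
    using integrable_exp_subst[of f] stieltjes_kernel_integrable[OF a] by simp
  then have "integrable lborel (\<lambda>t. norm (indicat_real {0<..} t *\<^sub>R f t) / Gamma a)"
    by (intro integrable_divide integrable_norm)
  also have "(\<lambda>t. norm (indicat_real {0<..} t *\<^sub>R f t) / Gamma a) = power_majorant a k"
  proof
    fix t
    show "norm (indicat_real {0<..} t *\<^sub>R f t) / Gamma a = power_majorant a k t"
    proof (cases "0 < t")
      case True
      then have "(1 + t) powr real k = (1 + t) ^ k" by (intro powr_realpow) simp
      then show ?thesis using True a
        unfolding f_def norm_scaleR norm_of_real by (simp add: power_majorant_def norm_power_kernel abs_mult)
    qed (simp add: power_majorant_def)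
  qed
  finally show ?thesis .
qed

text \<open>The weight 1 + t is at least 1 and splits under translation: (1+t)^m (1+r)^k is at most
  (1+t+r)^(m+k). On the negative axis only measurability is asked for.\<close>

definition decays :: "(real \<Rightarrow> complex) \<Rightarrow> bool" where
  "decays F \<longleftrightarrow> F \<in> borel_measurable borel \<and> (\<forall>m::nat. \<exists>C. \<forall>t\<ge>0. (1 + t) ^ m * norm (F t) \<le> C)"

lemma decays_measurable: "decays F \<Longrightarrow> F \<in> borel_measurable borel" by (simp add: decays_def)

lemma decays_bound:
  assumes "decays F"
  obtains C where "0 \<le> C" "\<And>t. 0 \<le> t \<Longrightarrow> (1 + t) ^ m * norm (F t) \<le> C"
proof -
  obtain C where C: "\<And>t. 0 \<le> t \<Longrightarrow> (1 + t) ^ m * norm (F t) \<le> C" using assms unfolding decays_def by blast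
  moreover have "0 \<le> C" using order_trans[OF _ C[of 0]] by simp
  ultimately show ?thesis using that by blast
qed

text \<open>Decay of order m + k at t + r pays for m powers of 1 + t and for the k powers of 1 + r
  in the majorant.\<close>

lemma decays_dominated:
  assumes F: "decays F" and a: "0 < a" "a < real k"
  obtains C where "0 \<le> C" "\<And>t r. 0 \<le> t \<Longrightarrow> (1 + t) ^ m * norm (power_kernel a r * F (t + r)) \<le> C * power_majorant a k r"
proof -
  obtain C where C: "0 \<le> C" "\<And>t. 0 \<le> t \<Longrightarrow> (1 + t) ^ (m + k) * norm (F t) \<le> C"
    using decays_bound[OF F] by blast
  have "(1 + t) ^ m * norm (power_kernel a r * F (t + r)) \<le> C * power_majorant a k r" if t: "0 \<le> t" for t r
  proof (cases "0 < r")
    case True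
    have "(1 + t) ^ m * (1 + r) ^ k * norm (F (t + r)) \<le> (1 + (t + r)) ^ m * (1 + (t + r)) ^ k * norm (F (t + r))"
      using t True by (intro mult_right_mono mult_mono power_mono) auto
    also have "\<dots> \<le> C" using C(2)[of "t + r"] t True by (simp add: power_add)
    finally have "norm (power_kernel a r) * ((1 + t) ^ m * (1 + r) ^ k * norm (F (t + r))) \<le> norm (power_kernel a r) * C"
      by (intro mult_left_mono) auto
    then show ?thesis using True by (simp add: power_majorant_def norm_mult field_simps)
  qed (simp add: power_majorant_def)
  with C(1) show ?thesis by (rule that)
qed

lemma decays_correl_integrable:
  assumes F: "decays F" and a: "0 < a" and t: "0 \<le> t"
  shows "integrable lborel (\<lambda>r. power_kernel a r * F (t + r))"
proof -
  have [measurable]: "F \<in> borel_measurable borel" by (rule decays_measurable[OF F])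
  obtain k :: nat where k: "a < real k" using reals_Archimedean2 by blast
  obtain C where C: "0 \<le> C" "\<And>t r. 0 \<le> t \<Longrightarrow> (1 + t) ^ 0 * norm (power_kernel a r * F (t + r)) \<le> C * power_majorant a k r"
    using decays_dominated[OF F a k] by blast
  show ?thesis
    by (rule Bochner_Integration.integrable_bound[OF integrable_mult_right[OF power_majorant_integrable[OF a k], of C]])
       (use C t power_majorant_nonneg[of a k] in \<open>auto simp: abs_mult\<close>)
qed

lemma decays_correl:
  assumes F: "decays F" and a: "0 < a"
  shows "decays (correl (power_kernel a) F)"
proof -
  have [measurable]: "F \<in> borel_measurable borel" by (rule decays_measurable[OF F])
  obtain k :: nat where k: "a < real k" using reals_Archimedean2 by blast
  show ?thesis unfolding decays_def
  proof (intro conjI allI)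
    fix m :: nat
    obtain C where C: "0 \<le> C" "\<And>t r. 0 \<le> t \<Longrightarrow> (1 + t) ^ m * norm (power_kernel a r * F (t + r)) \<le> C * power_majorant a k r"
      using decays_dominated[OF F a k] by blast
    have "(1 + t) ^ m * norm (correl (power_kernel a) F t) \<le> (LINT r|lborel. C * power_majorant a k r)" if t: "0 \<le> t" for t
    proof -
      have "(1 + t) ^ m * norm (correl (power_kernel a) F t) \<le> (1 + t) ^ m * (LINT r|lborel. norm (power_kernel a r * F (t + r)))"
        unfolding correl_def using t by (intro mult_left_mono integral_norm_bound) auto
      also have "\<dots> = (LINT r|lborel. (1 + t) ^ m * norm (power_kernel a r * F (t + r)))" by simp
      also have "\<dots> \<le> (LINT r|lborel. C * power_majorant a k r)"
        using C(2)[OF t] power_majorant_integrable[OF a k] decays_correl_integrable[OF F a t]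
        by (intro integral_mono) auto
      finally show ?thesis .
    qed
    then show "\<exists>C. \<forall>t\<ge>0. (1 + t) ^ m * norm (correl (power_kernel a) F t) \<le> C" by blast
  qed measurable
qed

lemma continuous_on_correl_power_kernel:
  assumes F: "decays F" and cont: "continuous_on {0..} F" and a: "0 < a"
  shows "continuous_on {0..} (correl (power_kernel a) F)"
proof (rule continuous_on_sequentiallyI)
  fix u :: "nat \<Rightarrow> real" and t assume u: "\<forall>n. u n \<in> {0..}" and t: "t \<in> {0..}" and ut: "u \<longlonglongrightarrow> t"
  have [measurable]: "F \<in> borel_measurable borel" by (rule decays_measurable[OF F])
  obtain k :: nat where k: "a < real k" using reals_Archimedean2 by blast
  obtain C where C: "0 \<le> C" "\<And>t r. 0 \<le> t \<Longrightarrow> (1 + t) ^ 0 * norm (power_kernel a r * F (t + r)) \<le> C * power_majorant a k r"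
    using decays_dominated[OF F a k] by blast
  show "(\<lambda>n. correl (power_kernel a) F (u n)) \<longlonglongrightarrow> correl (power_kernel a) F t"
    unfolding correl_def
  proof (rule integral_dominated_convergence[where w="\<lambda>r. C * power_majorant a k r"])
    show "AE r in lborel. (\<lambda>n. power_kernel a r * F (u n + r)) \<longlonglongrightarrow> power_kernel a r * F (t + r)"
    proof (intro AE_I2)
      fix r
      show "(\<lambda>n. power_kernel a r * F (u n + r)) \<longlonglongrightarrow> power_kernel a r * F (t + r)"
      proof (cases "0 < r")
        case True
        have "(\<lambda>n. u n + r) \<longlonglongrightarrow> t + r" by (intro tendsto_intros ut)
        then have "(\<lambda>n. F (u n + r)) \<longlonglongrightarrow> F (t + r)"
          by (rule continuous_on_tendsto_compose[OF cont]) (use u t True in \<open>auto intro!: always_eventually\<close>)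
        then show ?thesis by (intro tendsto_intros)
      qed simp
    qed
    show "AE r in lborel. norm (power_kernel a r * F (u n + r)) \<le> C * power_majorant a k r" for n
      using C(2)[of "u n"] u by auto
  qed (use power_majorant_integrable[OF a k] in auto)
qed

lemma correl_power_kernel_cong:
  assumes "\<And>s. t < s \<Longrightarrow> F s = G s"
  shows "correl (power_kernel a) F t = correl (power_kernel a) G t"
  unfolding correl_def
proof (rule Bochner_Integration.integral_cong[OF refl])
  show "power_kernel a r * F (t + r) = power_kernel a r * G (t + r)" for r
    using assms[of "t + r"] by (cases "0 < r") auto
qed

text \<open>Decay of order 2 k is shared equally between the two integration variables, so the
  double integral is dominated by a product of two majorant integrals and Fubini applies at every
  \<open>t \<ge> 0\<close>.\<close>

lemma correl_power_kernel_correl_power_kernel: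
  assumes F: "decays F" and a: "0 < a" and b: "0 < b" and t: "0 \<le> t"
  shows "correl (power_kernel a) (correl (power_kernel b) F) t = correl (power_kernel b) (correl (power_kernel a) F) t"
    and "correl (power_kernel a) (correl (power_kernel b) F) t = correl (power_kernel (a + b)) F t"
proof -
  have [measurable]: "F \<in> borel_measurable borel" by (rule decays_measurable[OF F])
  obtain k :: nat where "a + b < real k" using reals_Archimedean2 by blast
  then have k: "a < real k" "b < real k" using a b by auto
  obtain C where C: "0 \<le> C" "\<And>t. 0 \<le> t \<Longrightarrow> (1 + t) ^ (k + k) * norm (F t) \<le> C"
    using decays_bound[OF F] by blast
  have le: "norm (power_kernel a x) * norm (power_kernel b w) * norm (F (t + x + w)) \<le> C * power_majorant a k x * power_majorant b k w" for x w
  proof (cases "0 < x \<and> 0 < w")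
    case True
    have "(1 + x) ^ k * (1 + w) ^ k * norm (F (t + x + w)) \<le> (1 + (t + x + w)) ^ k * (1 + (t + x + w)) ^ k * norm (F (t + x + w))"
      using t True by (intro mult_right_mono mult_mono power_mono) auto
    also have "\<dots> \<le> C" using C(2)[of "t + x + w"] t True by (simp add: power_add)
    finally have "(norm (power_kernel a x) * norm (power_kernel b w)) * ((1 + x) ^ k * (1 + w) ^ k * norm (F (t + x + w))) \<le> (norm (power_kernel a x) * norm (power_kernel b w)) * C"
      by (intro mult_left_mono) auto
    then show ?thesis using True by (simp add: power_majorant_def norm_mult field_simps)
  qed (auto simp: power_majorant_def not_less)
  have "(\<integral>\<^sup>+x. \<integral>\<^sup>+w. ennreal (norm (power_kernel a x) * norm (power_kernel b w) * norm (F (t + x + w))) \<partial>lborel \<partial>lborel)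
    \<le> (\<integral>\<^sup>+x. \<integral>\<^sup>+w. ennreal (C * power_majorant a k x) * ennreal (power_majorant b k w) \<partial>lborel \<partial>lborel)"
    using le C(1) power_majorant_nonneg by (intro nn_integral_mono) (auto simp flip: ennreal_mult'' intro!: ennreal_leI)
  also have "\<dots> = ennreal (LINT x|lborel. C * power_majorant a k x) * ennreal (LINT w|lborel. power_majorant b k w)"
    using power_majorant_integrable[OF a k(1)] power_majorant_integrable[OF b k(2)] C(1) power_majorant_nonneg
    by (simp add: nn_integral_cmult nn_integral_multc nn_integral_eq_integral)
  also have "\<dots> < \<infinity>" by (simp add: ennreal_mult_less_top)
  finally have fin: "(\<integral>\<^sup>+x. \<integral>\<^sup>+w. ennreal (norm (power_kernel a x) * norm (power_kernel b w) * norm (F (t + x + w))) \<partial>lborel \<partial>lborel) < \<infinity>" .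
  show "correl (power_kernel a) (correl (power_kernel b) F) t = correl (power_kernel b) (correl (power_kernel a) F) t"
    by (rule correl_correl_pointwise(1)[OF _ _ _ fin]) measurable
  show "correl (power_kernel a) (correl (power_kernel b) F) t = correl (power_kernel (a + b)) F t"
    using correl_correl_pointwise(2)[OF _ _ _ fin] convol_power_kernel[OF a b, abs_def] by simp
qed

lemma correl_power_kernel_1: "correl (power_kernel 1) F t = (LINT s|lborel. indicat_real {t<..} s *\<^sub>R F s)"
proof -
  have "correl (power_kernel 1) F t = (LINT r|lborel. indicat_real {t<..} (r + t) *\<^sub>R F (r + t))"
    unfolding correl_def by (intro Bochner_Integration.integral_cong) (auto simp: power_kernel_def indicator_def add.commute)
  also have "\<dots> = (LINT s|lborel. indicat_real {t<..} s *\<^sub>R F s)"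
    by (rule lborel_integral_shift[of "\<lambda>s. indicat_real {t<..} s *\<^sub>R F s"])
  finally show ?thesis .
qed

lemma integrable_decays:
  assumes F: "decays F" and t: "0 \<le> t"
  shows "integrable lborel (\<lambda>s. indicat_real {t<..} s *\<^sub>R F s)"
proof -
  have "integrable lborel (\<lambda>r. power_kernel 1 r * F (t + r))" by (rule decays_correl_integrable[OF F _ t]) simp
  also have "(\<lambda>r. power_kernel 1 r * F (t + r)) = (\<lambda>r. indicat_real {t<..} (r + t) *\<^sub>R F (r + t))"
    by (auto simp: power_kernel_def indicator_def add.commute)
  finally show ?thesis using lborel_integrable_shift[of "\<lambda>s. indicat_real {t<..} s *\<^sub>R F s" t] by simp
qed

lemma correl_power_kernel_1_deriv:
  assumes F: "decays F" and cont: "continuous_on {0..} F" and t: "0 \<le> t"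
  shows "(correl (power_kernel 1) F has_vector_derivative - F t) (at t within {0..})"
proof -
  have eq: "correl (power_kernel 1) F u = correl (power_kernel 1) F 0 - (LBINT y=0..u. F y)" if u: "0 \<le> u" for u
  proof -
    have i: "integrable lborel (\<lambda>s. indicat_real {0<..u} s *\<^sub>R F s)"
    proof -
      have "integrable lborel (\<lambda>s. indicat_real {0<..u} s *\<^sub>R (indicat_real {0<..} s *\<^sub>R F s))"
        using integrable_mult_indicator[OF _ integrable_decays[OF F order_refl], of "{0<..u}"] by simp
      moreover have "(\<lambda>s. indicat_real {0<..u} s *\<^sub>R (indicat_real {0<..} s *\<^sub>R F s)) = (\<lambda>s. indicat_real {0<..u} s *\<^sub>R F s)"
        by (auto simp: indicator_def)
      ultimately show ?thesis by simp
    qed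
    have "(\<lambda>s. indicat_real {0<..} s *\<^sub>R F s) = (\<lambda>s. indicat_real {0<..u} s *\<^sub>R F s + indicat_real {u<..} s *\<^sub>R F s)"
      using u by (auto simp: indicator_def fun_eq_iff)
    then have "correl (power_kernel 1) F 0 = (LINT s|lborel. indicat_real {0<..u} s *\<^sub>R F s) + correl (power_kernel 1) F u"
      unfolding correl_power_kernel_1 using i integrable_decays[OF F u] by simp
    also have "(LINT s|lborel. indicat_real {0<..u} s *\<^sub>R F s) = (LBINT y=0..u. F y)"
      using interval_integral_Ioc[of 0 u F] u by (simp add: set_lebesgue_integral_def zero_ereal_def)
    finally show ?thesis by simp
  qed
  \<comment> \<open>The fundamental theorem is applied on a compact interval. Its end t + 1 leaves
    room to the right of \<open>t\<close>, so both filters at \<open>t\<close> coincide.\<close>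
  have "((\<lambda>u. LBINT y=0..u. F y) has_vector_derivative F t) (at t within {0..t + 1})"
    using interval_integral_FTC2[of 0 0 "t + 1" F t] continuous_on_subset[OF cont, of "{0..t + 1}"] t
    by (simp add: zero_ereal_def)
  moreover have "at t within {0..t + 1} = at t within {0..}"
    by (rule at_within_nhd[where S="{..<t + 1}"]) auto
  ultimately have "((\<lambda>u. LBINT y=0..u. F y) has_vector_derivative F t) (at t within {0..})" by simp
  then have "((\<lambda>u. correl (power_kernel 1) F 0 - (LBINT y=0..u. F y)) has_vector_derivative 0 - F t) (at t within {0..})"
    by (intro has_vector_derivative_diff has_vector_derivative_const)
  then have "((\<lambda>u. correl (power_kernel 1) F 0 - (LBINT y=0..u. F y)) has_vector_derivative - F t) (at t within {0..})" by simp
  then show ?thesis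
    unfolding has_vector_derivative_def
    by (rule has_derivative_transform[rotated 2]) (simp add: t, rule eq, simp)
qed

text \<open>\<open>D\<close>, the sum of the tail integral and \<open>G\<close>, has derivative 0
  and tends to 0 at infinity because both summands decay.\<close>

lemma correl_power_kernel_1_of_deriv:
  assumes G: "decays G" and G': "decays G'" and cont: "continuous_on {0..} G'"
    and der: "\<And>t. 0 \<le> t \<Longrightarrow> (G has_vector_derivative G' t) (at t within {0..})" and t: "0 \<le> t"
  shows "correl (power_kernel 1) G' t = - G t"
proof -
  define D where "D s = correl (power_kernel 1) G' s + G s" for s
  have D0: "(D has_vector_derivative 0) (at s within {0..})" if "0 \<le> s" for s
    using has_vector_derivative_add[OF correl_power_kernel_1_deriv[OF G' cont that] der[OF that]] by (simp add: D_def[abs_def])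
  obtain c where c: "\<And>s. s \<in> {0..} \<Longrightarrow> D s = c"
    using has_derivative_zero_constant[of "{0::real..}" D] D0 by (auto simp: has_vector_derivative_def)
  have lim: "(F \<longlongrightarrow> 0) at_top" if F: "decays F" for F :: "real \<Rightarrow> complex"
  proof -
    obtain C where C: "\<And>s. 0 \<le> s \<Longrightarrow> (1 + s) ^ 1 * norm (F s) \<le> C" using decays_bound[OF F] by blast
    have "((\<lambda>s::real. C / (1 + s)) \<longlongrightarrow> 0) at_top"
      by (intro tendsto_divide_0[OF tendsto_const] filterlim_at_top_imp_at_infinity filterlim_tendsto_add_at_top[OF tendsto_const filterlim_ident])
    moreover have "\<forall>\<^sub>F s in at_top. norm (F s) \<le> C / (1 + s)"
      using eventually_ge_at_top[of 0] by eventually_elim (use C in \<open>auto simp: field_simps\<close>)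
    ultimately show ?thesis by (rule Lim_null_comparison[rotated])
  qed
  have "(D \<longlongrightarrow> 0 + 0) at_top" unfolding D_def[abs_def]
    by (intro tendsto_add lim decays_correl G' G) simp
  moreover have "(D \<longlongrightarrow> c) at_top"
    by (rule tendsto_eventually) (use eventually_ge_at_top[of 0] in \<open>eventually_elim, use c in auto\<close>)
  ultimately have "c = 0" using tendsto_unique[of at_top D] by fastforce
  then show ?thesis using c[of t] t by (simp add: D_def eq_neg_iff_add_eq_0)
qed

section \<open>The Schwartz class and its fractional derivatives\<close>

text \<open>Carries all derivatives together, so that an operator can be applied to every one of
  them and the result is again such a family.\<close>

definition schwartz_family :: "(nat \<Rightarrow> real \<Rightarrow> complex) \<Rightarrow> bool" where
  "schwartz_family F \<longleftrightarrow> (\<forall>n. decays (F n)) \<and> (\<forall>n. \<forall>t\<ge>0. (F n has_vector_derivative F (Suc n) t) (at t within {0..}))"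

lemma schwartz_family_D:
  assumes "schwartz_family F"
  shows schwartz_family_decays: "decays (F n)" and schwartz_family_deriv: "\<And>t. 0 \<le> t \<Longrightarrow> (F n has_vector_derivative F (Suc n) t) (at t within {0..})"
    and schwartz_family_cont: "continuous_on {0..} (F n)"
proof -
  show "decays (F n)" using assms by (simp add: schwartz_family_def)
  show d: "(F n has_vector_derivative F (Suc n) t) (at t within {0..})" if "0 \<le> t" for t
    using assms that by (simp add: schwartz_family_def)
  show "continuous_on {0..} (F n)" unfolding continuous_on_eq_continuous_within
    using d has_vector_derivative_continuous by (metis atLeast_iff)
qed

lemma schwartz_half_iff_schwartz_family: "f \<in> schwartz_half \<longleftrightarrow> (\<exists>F. schwartz_family F \<and> (\<forall>t\<ge>0. F 0 t = f t))"
proof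
  assume "f \<in> schwartz_half"
  then obtain F where F: "\<forall>t\<ge>0. F 0 t = f t" 
    "\<forall>n. \<forall>t\<ge>0. (F n has_vector_derivative F (Suc n) t) (at t within {0..})"
    "\<forall>m n. \<exists>C. \<forall>t\<ge>0. t ^ m * norm (F n t) \<le> C"
    unfolding schwartz_half_def by blast
  \<comment> \<open>Extension by 0 turns each derivative, controlled only on the closed half line,
    into a Borel function on the line.\<close>
  define G where "G n t = (if t \<in> {0..} then F n t else 0)" for n t
  have cont: "continuous_on {0..} (F n)" for n
    unfolding continuous_on_eq_continuous_within
    using F(2) has_vector_derivative_continuous by (metis atLeast_iff)
  have m: "G n \<in> borel_measurable borel" for n
    unfolding G_def[abs_def] by (rule borel_measurable_continuous_on_if[OF _ cont]) auto
  have "decays (G n)" for n unfolding decays_def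
  proof (intro conjI m allI)
    fix k :: nat
    obtain C0 where C0: "\<forall>t\<ge>0. t ^ 0 * norm (F n t) \<le> C0" using F(3) by blast
    obtain C1 where C1: "\<forall>t\<ge>0. t ^ k * norm (F n t) \<le> C1" using F(3) by blast
    have "(1 + t) ^ k * norm (G n t) \<le> 2 ^ k * C0 + 2 ^ k * C1" if t: "0 \<le> t" for t
    proof -
      have "(1 + t) ^ k \<le> 2 ^ k + 2 ^ k * t ^ k"
      proof (cases "t \<le> 1")
        case True
        then have "(1 + t) ^ k \<le> 2 ^ k" using t by (intro power_mono) auto
        then show ?thesis using t by (simp add: add_increasing2)
      next
        case False
        then have "(1 + t) ^ k \<le> (2 * t) ^ k" using t by (intro power_mono) auto
        then show ?thesis by (simp add: power_mult_distrib add_increasing)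
      qed
      then have "(1 + t) ^ k * norm (F n t) \<le> (2 ^ k + 2 ^ k * t ^ k) * norm (F n t)" by (intro mult_right_mono) auto
      also have "\<dots> = 2 ^ k * norm (F n t) + 2 ^ k * (t ^ k * norm (F n t))" by (simp add: algebra_simps)
      also have "\<dots> \<le> 2 ^ k * C0 + 2 ^ k * C1" using C0 C1 t by (intro add_mono mult_left_mono) auto
      finally show ?thesis using t by (simp add: G_def)
    qed
    then show "\<exists>C. \<forall>t\<ge>0. (1 + t) ^ k * norm (G n t) \<le> C" by blast
  qed
  moreover have "(G n has_vector_derivative G (Suc n) t) (at t within {0..})" if "0 \<le> t" for n t
  proof -
    have "(F n has_vector_derivative F (Suc n) t) (at t within {0..})" using F(2) that by blast
    then have "(G n has_vector_derivative F (Suc n) t) (at t within {0..})"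
      unfolding has_vector_derivative_def by (rule has_derivative_transform[rotated 2]) (use that in \<open>auto simp: G_def\<close>)
    then show ?thesis using that by (simp add: G_def)
  qed
  ultimately have "schwartz_family G" by (simp add: schwartz_family_def)
  moreover have "\<forall>t\<ge>0. G 0 t = f t" using F(1) by (simp add: G_def)
  ultimately show "\<exists>F. schwartz_family F \<and> (\<forall>t\<ge>0. F 0 t = f t)" by blast
next
  assume "\<exists>F. schwartz_family F \<and> (\<forall>t\<ge>0. F 0 t = f t)"
  then obtain F where F: "schwartz_family F" "\<forall>t\<ge>0. F 0 t = f t" by blast
  have "\<exists>C. \<forall>t\<ge>0. t ^ m * norm (F n t) \<le> C" for m n
  proof -
    obtain C where C: "\<And>t. 0 \<le> t \<Longrightarrow> (1 + t) ^ m * norm (F n t) \<le> C" using decays_bound[OF schwartz_family_decays[OF F(1)]] by blast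
    have "t ^ m * norm (F n t) \<le> C" if "0 \<le> t" for t
      by (rule order_trans[OF mult_right_mono C[OF that]]) (use that in \<open>auto intro!: power_mono\<close>)
    then show ?thesis by blast
  qed
  then show "f \<in> schwartz_half" unfolding schwartz_half_def using F by (auto simp: schwartz_family_def)
qed

lemma decays_add: 
  assumes "decays F" "decays G" shows "decays (\<lambda>t. F t + G t)"
  unfolding decays_def
proof (intro conjI allI)
  have [measurable]: "F \<in> borel_measurable borel" "G \<in> borel_measurable borel" using assms by (auto simp: decays_def)
  show "(\<lambda>t. F t + G t) \<in> borel_measurable borel" by measurable
  fix m :: nat
  obtain C where C: "\<And>t. 0 \<le> t \<Longrightarrow> (1 + t) ^ m * norm (F t) \<le> C" using decays_bound[OF assms(1)] by blast
  obtain D where D: "\<And>t. 0 \<le> t \<Longrightarrow> (1 + t) ^ m * norm (G t) \<le> D" using decays_bound[OF assms(2)] by blast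
  have "(1 + t) ^ m * norm (F t + G t) \<le> C + D" if t: "0 \<le> t" for t
  proof -
    have "(1 + t) ^ m * norm (F t + G t) \<le> (1 + t) ^ m * (norm (F t) + norm (G t))"
      using t by (intro mult_left_mono norm_triangle_ineq) auto
    then show ?thesis using C[OF t] D[OF t] by (simp add: distrib_left)
  qed
  then show "\<exists>C. \<forall>t\<ge>0. (1 + t) ^ m * norm (F t + G t) \<le> C" by blast
qed

lemma decays_scale: 
  assumes "decays F" shows "decays (\<lambda>t. c * F t)"
  unfolding decays_def
proof (intro conjI allI)
  have [measurable]: "F \<in> borel_measurable borel" using assms by (auto simp: decays_def)
  show "(\<lambda>t. c * F t) \<in> borel_measurable borel" by measurable
  fix m :: nat
  obtain C where C: "\<And>t. 0 \<le> t \<Longrightarrow> (1 + t) ^ m * norm (F t) \<le> C" using decays_bound[OF assms] by blast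
  have "(1 + t) ^ m * norm (c * F t) \<le> norm c * C" if t: "0 \<le> t" for t
    using mult_left_mono[OF C[OF t], of "norm c"] by (simp add: norm_mult mult_ac)
  then show "\<exists>C. \<forall>t\<ge>0. (1 + t) ^ m * norm (c * F t) \<le> C" by blast
qed

lemma schwartz_family_add:
  assumes "schwartz_family F" "schwartz_family G"
  shows "schwartz_family (\<lambda>n t. F n t + G n t)"
  unfolding schwartz_family_def using assms
  by (intro conjI allI impI decays_add has_vector_derivative_add schwartz_family_decays schwartz_family_deriv)

lemma schwartz_family_scale:
  assumes "schwartz_family F"
  shows "schwartz_family (\<lambda>n t. c * F n t)"
  unfolding schwartz_family_def using assms
  by (intro conjI allI impI decays_scale has_vector_derivative_mult_right schwartz_family_decays schwartz_family_deriv)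

lemma schwartz_half_add:
  assumes "f \<in> schwartz_half" "g \<in> schwartz_half"
  shows "(\<lambda>t. f t + g t) \<in> schwartz_half"
proof -
  obtain F G where "schwartz_family F" "\<forall>t\<ge>0. F 0 t = f t" "schwartz_family G" "\<forall>t\<ge>0. G 0 t = g t"
    using assms unfolding schwartz_half_iff_schwartz_family by blast
  then show ?thesis unfolding schwartz_half_iff_schwartz_family
    by (intro exI[of _ "\<lambda>n t. F n t + G n t"]) (simp add: schwartz_family_add)
qed

lemma schwartz_half_scale:
  assumes "f \<in> schwartz_half"
  shows "(\<lambda>t. c * f t) \<in> schwartz_half"
proof -
  obtain F where "schwartz_family F" "\<forall>t\<ge>0. F 0 t = f t"
    using assms unfolding schwartz_half_iff_schwartz_family by blast
  then show ?thesis unfolding schwartz_half_iff_schwartz_family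
    by (intro exI[of _ "\<lambda>n t. c * F n t"]) (simp add: schwartz_family_scale)
qed

text \<open>On the half line \<open>F n\<close> is minus the tail integral of
  \<open>F (Suc n)\<close>. This integral of order 1 commutes with the one of order
  \<open>a\<close>, so the derivative falls on an outer tail integral and never on the
  kernel.\<close>

lemma correl_power_kernel_schwartz_family:
  assumes F: "schwartz_family F" and a: "0 < a"
  shows "schwartz_family (\<lambda>n. correl (power_kernel a) (F n))"
  unfolding schwartz_family_def
proof (intro conjI allI impI)
  fix n and t :: real assume t: "0 \<le> t"
  have eq: "correl (power_kernel a) (F n) s = - correl (power_kernel 1) (correl (power_kernel a) (F (Suc n))) s" if s: "0 \<le> s" for s
  proof -
    have "correl (power_kernel a) (F n) s = correl (power_kernel a) (\<lambda>r. - 1 * correl (power_kernel 1) (F (Suc n)) r) s"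
      by (rule correl_power_kernel_cong) (use s correl_power_kernel_1_of_deriv[OF schwartz_family_decays[OF F] schwartz_family_decays[OF F] schwartz_family_cont[OF F] schwartz_family_deriv[OF F]] in auto)
    also have "\<dots> = - correl (power_kernel a) (correl (power_kernel 1) (F (Suc n))) s" unfolding correl_scale by simp
    also have "\<dots> = - correl (power_kernel 1) (correl (power_kernel a) (F (Suc n))) s"
      using correl_power_kernel_correl_power_kernel(1)[OF schwartz_family_decays[OF F] a, of 1] s by simp
    finally show ?thesis .
  qed
  have "(correl (power_kernel 1) (correl (power_kernel a) (F (Suc n))) has_vector_derivative - correl (power_kernel a) (F (Suc n)) t) (at t within {0..})"
    by (rule correl_power_kernel_1_deriv[OF decays_correl[OF schwartz_family_decays[OF F] a] continuous_on_correl_power_kernel[OF schwartz_family_decays[OF F] schwartz_family_cont[OF F] a] t])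
  from has_vector_derivative_minus[OF this] 
  have "((\<lambda>s. - correl (power_kernel 1) (correl (power_kernel a) (F (Suc n))) s) has_vector_derivative correl (power_kernel a) (F (Suc n)) t) (at t within {0..})"
    by simp
  then show "(correl (power_kernel a) (F n) has_vector_derivative correl (power_kernel a) (F (Suc n)) t) (at t within {0..})"
    unfolding has_vector_derivative_def by (rule has_derivative_transform[rotated 2]) (use t eq in auto)
qed (intro decays_correl schwartz_family_decays F a)

text \<open>The semigroup law peels off one tail integral at a time, each undoing one derivative and
  contributing one sign.\<close>

lemma correl_power_kernel_nat_schwartz_family:
  assumes F: "schwartz_family F" and t: "0 \<le> t"
  shows "correl (power_kernel (real (Suc n))) (F (m + Suc n)) t = (- 1) ^ Suc n * F m t"
  using t
proof (induction n arbitrary: m t)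
  case 0
  then show ?case
    using correl_power_kernel_1_of_deriv[OF schwartz_family_decays[OF F] schwartz_family_decays[OF F] schwartz_family_cont[OF F] schwartz_family_deriv[OF F]] by simp
next
  case (Suc n)
  have "correl (power_kernel (real (Suc (Suc n)))) (F (m + Suc (Suc n))) t = correl (power_kernel 1) (correl (power_kernel (real (Suc n))) (F (Suc m + Suc n))) t"
    using correl_power_kernel_correl_power_kernel(2)[OF schwartz_family_decays[OF F], of 1 "real (Suc n)" t "m + Suc (Suc n)"] Suc.prems by (simp add: add_ac)
  also have "\<dots> = correl (power_kernel 1) (\<lambda>s. (- 1) ^ Suc n * F (Suc m) s) t"
  proof (rule correl_power_kernel_cong)
    fix s assume "t < s"
    then show "correl (power_kernel (real (Suc n))) (F (Suc m + Suc n)) s = (- 1) ^ Suc n * F (Suc m) s"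
      using Suc.IH[of s "Suc m"] Suc.prems by simp
  qed
  also have "\<dots> = (- 1) ^ Suc n * correl (power_kernel 1) (F (Suc m)) t" by (rule correl_scale)
  also have "correl (power_kernel 1) (F (Suc m)) t = - F m t"
    by (rule correl_power_kernel_1_of_deriv[OF schwartz_family_decays[OF F] schwartz_family_decays[OF F] schwartz_family_cont[OF F] schwartz_family_deriv[OF F] Suc.prems])
  finally show ?case by simp
qed

lemma weyl_integral_eq_correl:
  assumes [measurable]: "F \<in> borel_measurable borel" and F: "\<And>s. t < s \<Longrightarrow> F s = f s"
  shows "weyl_integral a f t = correl (power_kernel a) F t"
proof -
  have "(LINT s|lebesgue_on {t<..}. of_real ((s - t) powr (a - 1)) * f s) = 
    (LINT s|lebesgue. indicat_real {t<..} s *\<^sub>R (of_real ((s - t) powr (a - 1)) * f s))"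
    by (rule integral_restrict_space) simp
  also have "\<dots> = (LINT s|lebesgue. indicat_real {t<..} s *\<^sub>R (of_real ((s - t) powr (a - 1)) * F s))"
    by (rule Bochner_Integration.integral_cong) (auto simp: F indicator_def)
  also have "\<dots> = (LINT s|lborel. indicat_real {t<..} s *\<^sub>R (of_real ((s - t) powr (a - 1)) * F s))"
    by (rule integral_completion) measurable
  also have "\<dots> = (LINT r|lborel. indicat_real {t<..} (r + t) *\<^sub>R (of_real ((r + t - t) powr (a - 1)) * F (r + t)))"
    by (rule lborel_integral_shift[symmetric])
  finally have "weyl_integral a f t = of_real (1 / Gamma a) * (LINT r|lborel. indicat_real {t<..} (r + t) *\<^sub>R (of_real ((r + t - t) powr (a - 1)) * F (r + t)))"
    by (simp add: weyl_integral_def)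
  also have "\<dots> = (LINT r|lborel. of_real (1 / Gamma a) * (indicat_real {t<..} (r + t) *\<^sub>R (of_real ((r + t - t) powr (a - 1)) * F (r + t))))"
    by (rule integral_mult_right_zero[symmetric])
  also have "\<dots> = correl (power_kernel a) F t"
    unfolding correl_def
    by (rule Bochner_Integration.integral_cong[OF refl]) (auto simp: power_kernel_def indicator_def add.commute)
  finally show ?thesis .
qed

text \<open>The fractional integral of order \<open>n - \<alpha>\<close> maps the family to a
  family, so all \<open>n\<close> derivatives pass to \<open>F n\<close>. For \<open>t > 0\<close>
  the derivative within the closed half line is the two-sided one of
  \<open>weyl_derivative\<close>.\<close>

lemma weyl_derivative_eq:
  assumes F: "schwartz_family F" and f: "\<And>t. 0 \<le> t \<Longrightarrow> F 0 t = f t" and \<alpha>: "0 < \<alpha>" and n: "n = nat \<lfloor>\<alpha>\<rfloor> + 1" and t: "0 < t"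
  shows "weyl_derivative \<alpha> f t = (- 1) ^ n * correl (power_kernel (real n - \<alpha>)) (F n) t"
proof -
  have nu: "0 < real n - \<alpha>" using n \<alpha> by linarith
  note sf = correl_power_kernel_schwartz_family[OF F nu]
  have it: "((\<lambda>g x. vector_derivative g (at x)) ^^ k) (weyl_integral (real n - \<alpha>) f) s = correl (power_kernel (real n - \<alpha>)) (F k) s" if "0 < s" for k s
    using that
  proof (induction k arbitrary: s)
    case 0
    then show ?case 
      using weyl_integral_eq_correl[OF decays_measurable[OF schwartz_family_decays[OF F, of 0]], of s f "real n - \<alpha>"] f by simp
  next
    case (Suc k)
    have "(correl (power_kernel (real n - \<alpha>)) (F k) has_vector_derivative correl (power_kernel (real n - \<alpha>)) (F (Suc k)) s) (at s within {0..})"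
      using schwartz_family_deriv[OF sf, of s k] Suc.prems by simp
    moreover have "at s within {0..} = at s" using Suc.prems by (intro at_within_interior) simp
    ultimately have "(correl (power_kernel (real n - \<alpha>)) (F k) has_vector_derivative correl (power_kernel (real n - \<alpha>)) (F (Suc k)) s) (at s)" by simp
    then have "(((\<lambda>g x. vector_derivative g (at x)) ^^ k) (weyl_integral (real n - \<alpha>) f) has_vector_derivative correl (power_kernel (real n - \<alpha>)) (F (Suc k)) s) (at s)"
      by (rule has_vector_derivative_transform_within_open[where S="{0<..}"]) (use Suc in auto)
    then show ?case by (simp add: vector_derivative_at)
  qed
  show ?thesis using \<alpha> it[OF t, of n] unfolding weyl_derivative_def Let_def n[symmetric] by simp
qed

text \<open>The orders \<open>\<alpha>\<close> and \<open>n - \<alpha>\<close> add up to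
  \<open>n\<close>, and \<open>n\<close> tail integrals undo the \<open>n\<close> derivatives; the
  sign they produce cancels the one in the Weyl derivative.\<close>

lemma correl_power_kernel_weyl_derivative:
  assumes F: "schwartz_family F" and f: "\<And>t. 0 \<le> t \<Longrightarrow> F 0 t = f t" and \<alpha>: "0 < \<alpha>" and t: "0 \<le> t"
  shows "correl (power_kernel \<alpha>) (weyl_derivative \<alpha> f) t = f t"
proof -
  define m where "m = nat \<lfloor>\<alpha>\<rfloor>"
  define n where "n = nat \<lfloor>\<alpha>\<rfloor> + 1"
  have nm: "n = Suc m" by (simp add: n_def m_def)
  have nu: "0 < real n - \<alpha>" using n_def \<alpha> by linarith
  have "correl (power_kernel \<alpha>) (weyl_derivative \<alpha> f) t = correl (power_kernel \<alpha>) (\<lambda>s. (- 1) ^ n * correl (power_kernel (real n - \<alpha>)) (F n) s) t"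
    by (rule correl_power_kernel_cong) (use t weyl_derivative_eq[OF F f \<alpha> n_def] in auto)
  also have "\<dots> = (- 1) ^ n * correl (power_kernel \<alpha>) (correl (power_kernel (real n - \<alpha>)) (F n)) t" by (rule correl_scale)
  also have "correl (power_kernel \<alpha>) (correl (power_kernel (real n - \<alpha>)) (F n)) t = correl (power_kernel (real n)) (F n) t"
    using correl_power_kernel_correl_power_kernel(2)[OF schwartz_family_decays[OF F] \<alpha> nu t, of n] by simp
  also have "\<dots> = (- 1) ^ n * F 0 t" using correl_power_kernel_nat_schwartz_family[OF F t, of m 0] by (simp add: nm)
  finally show ?thesis using f[OF t] by (simp flip: power_mult_distrib mult.assoc)
qed

lemma weyl_derivative_correl_power_kernel:
  assumes F: "schwartz_family F" and \<alpha>: "0 < \<alpha>" and t: "0 < t"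
  shows "weyl_derivative \<alpha> (correl (power_kernel \<alpha>) (F 0)) t = F 0 t"
proof -
  define m where "m = nat \<lfloor>\<alpha>\<rfloor>"
  define n where "n = nat \<lfloor>\<alpha>\<rfloor> + 1"
  have nm: "n = Suc m" by (simp add: n_def m_def)
  have nu: "0 < real n - \<alpha>" using n_def \<alpha> by linarith
  have "weyl_derivative \<alpha> (correl (power_kernel \<alpha>) (F 0)) t = (- 1) ^ n * correl (power_kernel (real n - \<alpha>)) (correl (power_kernel \<alpha>) (F n)) t"
    by (rule weyl_derivative_eq[OF correl_power_kernel_schwartz_family[OF F \<alpha>] _ \<alpha> n_def t]) simp
  also have "correl (power_kernel (real n - \<alpha>)) (correl (power_kernel \<alpha>) (F n)) t = correl (power_kernel (real n)) (F n) t"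
    using correl_power_kernel_correl_power_kernel(2)[OF schwartz_family_decays[OF F] nu \<alpha>, of t n] t by simp
  also have "\<dots> = (- 1) ^ n * F 0 t" using correl_power_kernel_nat_schwartz_family[OF F, of t m 0] t by (simp add: nm)
  finally show ?thesis by (simp flip: power_mult_distrib mult.assoc)
qed

section \<open>The operator \<open>(D\<^sub>+\<^sup>\<alpha>)\<^sup>-\<^sup>1\<close> in logarithmic coordinates\<close>

text \<open>
  \<open>kober_kernel \<eta> a p\<close> is the logarithmic form of \<open>h \<mapsto> t\<^sup>\<eta> W\<^sub>+\<^sup>-\<^sup>a (s\<^sup>-\<^sup>\<eta>\<^sup>-\<^sup>a h)\<close>, an operator of Erdelyi-Kober type.
\<close>

definition kober_kernel :: "real \<Rightarrow> real \<Rightarrow> real \<Rightarrow> real \<Rightarrow> complex" where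
  "kober_kernel \<eta> a p x = of_real (indicat_real {0<..} x * (exp x - 1) powr (a - 1) * exp ((1 - \<eta> - a - 1 / p) * x) / Gamma a)"

lemma kober_kernel_measurable [measurable]: "kober_kernel \<eta> a p \<in> borel_measurable borel"
  unfolding kober_kernel_def[abs_def] by measurable

lemma kober_kernel_power_kernel: "kober_kernel \<eta> a p x = power_kernel a (exp x - 1) * of_real (exp ((1 - \<eta> - a - 1 / p) * x))"
  by (simp add: kober_kernel_def power_kernel_def indicator_def)

text \<open>Under v = exp(-x) the kernel becomes the Beta integrand on [0, 1] with parameters
  \<open>\<eta> + 1 / p\<close> and \<open>a\<close>.\<close>

lemma kober_kernel_integrable:
  assumes a: "0 < a" and b: "0 < \<eta> + 1 / p"
  shows "integrable lborel (kober_kernel \<eta> a p)"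
proof -
  define b where "b = \<eta> + 1 / p"
  have b0: "0 < b" using b by (simp add: b_def)
  define f where "f v = complex_of_real (indicat_real {0..1} v *\<^sub>R (v powr (b - 1) * (1 - v) powr (a - 1)))" for v
  have [measurable]: "f \<in> borel_measurable borel" unfolding f_def[abs_def] by measurable
  have "integrable lborel f" unfolding f_def[abs_def]
    using integrable_Beta[OF b0 a] by (intro integrable_of_real) (simp add: set_integrable_def)
  also have "f = (\<lambda>v. indicat_real {0<..} v *\<^sub>R f v)"
    by (auto simp: f_def indicator_def fun_eq_iff)
  finally have "integrable lborel (\<lambda>x. exp x *\<^sub>R f (exp x))" using integrable_exp_subst[of f] by simp
  then have "integrable lborel (\<lambda>x. exp (0 + - 1 * x) *\<^sub>R f (exp (0 + - 1 * x)))"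
    by (rule lborel_integrable_real_affine) simp
  then have "integrable lborel (\<lambda>x. exp (- x) *\<^sub>R f (exp (- x)) / of_real (Gamma a))" by simp
  also have "(\<lambda>x. exp (- x) *\<^sub>R f (exp (- x)) / of_real (Gamma a)) = kober_kernel \<eta> a p"
  proof
    fix x
    show "exp (- x) *\<^sub>R f (exp (- x)) / of_real (Gamma a) = kober_kernel \<eta> a p x"
    proof (cases "0 < x")
      case True
      have "exp (- x) * (exp (- x) powr (b - 1) * (1 - exp (- x)) powr (a - 1)) 
        = (exp x - 1) powr (a - 1) * exp ((1 - \<eta> - a - 1 / p) * x)"
      proof -
        have "1 - exp (- x) = (exp x - 1) * exp (- x)" by (simp add: algebra_simps flip: exp_add)
        then have "(1 - exp (- x)) powr (a - 1) = (exp x - 1) powr (a - 1) * exp (- x) powr (a - 1)" 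
          by (simp add: powr_mult)
        then have "exp (- x) * (exp (- x) powr (b - 1) * (1 - exp (- x)) powr (a - 1)) 
          = (exp x - 1) powr (a - 1) * (exp (- x) * exp (- x) powr (b - 1) * exp (- x) powr (a - 1))"
          by simp
        also have "exp (- x) * exp (- x) powr (b - 1) * exp (- x) powr (a - 1) = exp ((1 - \<eta> - a - 1 / p) * x)"
          by (simp add: powr_def b_def algebra_simps flip: exp_add)
        finally show ?thesis .
      qed
      then have "complex_of_real (exp (- x) * (exp (- x) powr (b - 1) * (1 - exp (- x)) powr (a - 1)))
        = of_real ((exp x - 1) powr (a - 1) * exp ((1 - \<eta> - a - 1 / p) * x))" by (rule arg_cong)
      then show ?thesis using True by (simp add: f_def kober_kernel_def scaleR_conv_of_real)
    next
      case False
      then have "f (exp (- x)) = 0" by (cases "x = 0") (auto simp: f_def indicator_def)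
      then show ?thesis using False by (simp add: kober_kernel_def)
    qed
  qed
  finally show ?thesis .
qed

lemma from_log_correl_kober_kernel:
  assumes a: "0 < a" and [measurable]: "g \<in> borel_measurable borel" and t: "0 < t"
  shows "from_log p (correl (kober_kernel \<eta> a p) g) t = of_real (t powr \<eta>) * correl (power_kernel a) (\<lambda>s. of_real (s powr (- \<eta> - a)) * from_log p g s) t"
proof -
  define y where "y = ln t"
  have ty: "t = exp y" using t by (simp add: y_def)
  define h where "h s = of_real (s powr (- \<eta> - a)) * from_log p g s" for s
  have [measurable]: "h \<in> borel_measurable borel" unfolding h_def[abs_def] by measurable
  have "correl (power_kernel a) h t = (LINT r|lborel. power_kernel a (r + t - t) * h (r + t))"
    by (simp add: correl_def add.commute)
  also have "\<dots> = (LINT s|lborel. power_kernel a (s - t) * h s)"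
    by (rule lborel_integral_shift[of "\<lambda>s. power_kernel a (s - t) * h s"])
  also have "\<dots> = (LINT s|lborel. indicat_real {0<..} s *\<^sub>R (power_kernel a (s - t) * h s))"
    by (rule Bochner_Integration.integral_cong[OF refl]) (use t in \<open>auto simp: indicator_def\<close>)
  also have "\<dots> = (LINT v|lborel. exp v *\<^sub>R (power_kernel a (exp v - t) * h (exp v)))"
    by (rule integral_exp_subst) measurable
  also have "\<dots> = (LINT x|lborel. exp (x + y) *\<^sub>R (power_kernel a (exp (x + y) - t) * h (exp (x + y))))"
    by (rule lborel_integral_shift[symmetric])
  also have "\<dots> = (LINT x|lborel. of_real (exp (y * (- \<eta> - 1 / p))) * (kober_kernel \<eta> a p x * g (y + x)))"
  proof (rule Bochner_Integration.integral_cong[OF refl])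
    fix x
    have power_kernel: "power_kernel a (exp (x + y) - t) = of_real (exp (y * (a - 1))) * power_kernel a (exp x - 1)"
    proof (cases "0 < x")
      case True
      have "exp (x + y) - t = exp y * (exp x - 1)" by (simp add: ty exp_add algebra_simps)
      then have "(exp (x + y) - t) powr (a - 1) = exp (y * (a - 1)) * (exp x - 1) powr (a - 1)"
        by (simp add: powr_mult) (simp add: powr_def)
      then show ?thesis using True by (simp add: power_kernel_def ty)
    qed (simp add: ty)
    have "exp (x + y) * exp (y * (a - 1)) * (exp (x + y) powr (- \<eta> - a)) * exp (- (x + y) / p) 
      = exp (y * (- \<eta> - 1 / p)) * exp ((1 - \<eta> - a - 1 / p) * x)"
      by (simp add: powr_def algebra_simps add_divide_distrib diff_divide_distrib flip: exp_add)
    then have e: "complex_of_real (exp (x + y)) * of_real (exp (y * (a - 1))) * of_real (exp (x + y) powr (- \<eta> - a)) * of_real (exp (- (x + y) / p))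
      = of_real (exp (y * (- \<eta> - 1 / p))) * of_real (exp ((1 - \<eta> - a - 1 / p) * x))"
      by (simp only: flip: of_real_mult)
    have "exp (x + y) *\<^sub>R (power_kernel a (exp (x + y) - t) * h (exp (x + y))) 
      = (complex_of_real (exp (x + y)) * of_real (exp (y * (a - 1))) * of_real (exp (x + y) powr (- \<eta> - a)) * of_real (exp (- (x + y) / p)))
        * (power_kernel a (exp x - 1) * g (x + y))"
      unfolding power_kernel h_def from_log_exp scaleR_conv_of_real by (simp only: mult_ac)
    also have "\<dots> = of_real (exp (y * (- \<eta> - 1 / p))) * (kober_kernel \<eta> a p x * g (y + x))"
      unfolding e kober_kernel_power_kernel by (simp only: mult_ac add.commute)
    finally show "exp (x + y) *\<^sub>R (power_kernel a (exp (x + y) - t) * h (exp (x + y))) = of_real (exp (y * (- \<eta> - 1 / p))) * (kober_kernel \<eta> a p x * g (y + x))" .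
  qed
  also have "\<dots> = of_real (exp (y * (- \<eta> - 1 / p))) * correl (kober_kernel \<eta> a p) g y"
    unfolding correl_def by (rule integral_mult_right_zero)
  finally have *: "correl (power_kernel a) h t = of_real (exp (y * (- \<eta> - 1 / p))) * correl (kober_kernel \<eta> a p) g y" .
  have "t powr \<eta> * exp (y * (- \<eta> - 1 / p)) = t powr (- 1 / p)"
    by (simp add: powr_def ty algebra_simps flip: exp_add)
  then have "complex_of_real (t powr \<eta>) * complex_of_real (exp (y * (- \<eta> - 1 / p))) = of_real (t powr (- 1 / p))"
    by (simp only: flip: of_real_mult)
  then have "from_log p (correl (kober_kernel \<eta> a p) g) t = of_real (t powr \<eta>) * (of_real (exp (y * (- \<eta> - 1 / p))) * correl (kober_kernel \<eta> a p) g y)"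
    unfolding mult.assoc[symmetric] by (simp add: from_log_def y_def)
  then show ?thesis unfolding h_def[symmetric] * .
qed

text \<open>In operator form, W^(-a) s^(-a) followed by s^a W^(-b) s^(-a-b) is W^(-a-b) s^(-a-b):
  the inner powers cancel. With s = exp(x) and T = exp(w) this is the semigroup law for power
  kernels at T - 1.\<close>

lemma convol_kober_kernel:
  assumes a: "0 < a" and b: "0 < b"
  shows "convol (kober_kernel 0 a p) (kober_kernel a b p) w = kober_kernel 0 (a + b) p w"
proof -
  define T where "T = exp w"
  have "convol (kober_kernel 0 a p) (kober_kernel a b p) w = 
    (LINT x|lborel. of_real (exp ((1 - a - b - 1 / p) * w)) * (exp x *\<^sub>R (power_kernel a (exp x - 1) * power_kernel b (T - exp x))))"
    unfolding convol_def
  proof (rule Bochner_Integration.integral_cong[OF refl])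
    fix x
    have power_kernel: "power_kernel b (exp (w - x) - 1) = of_real (exp (- x * (b - 1))) * power_kernel b (T - exp x)"
    proof (cases "x < w")
      case True
      have "T - exp x = exp x * (exp (w - x) - 1)" by (simp add: T_def algebra_simps flip: exp_add)
      then have "(T - exp x) powr (b - 1) = exp x powr (b - 1) * (exp (w - x) - 1) powr (b - 1)"
        by (simp add: powr_mult)
      then have "(exp (w - x) - 1) powr (b - 1) = exp (- x * (b - 1)) * (T - exp x) powr (b - 1)"
        by (simp add: powr_def flip: exp_add mult.assoc)
      then show ?thesis using True by (simp add: power_kernel_def T_def)
    qed (simp add: T_def)
    have "exp ((1 - a - 1 / p) * x) * exp (- x * (b - 1)) * exp ((1 - a - b - 1 / p) * (w - x)) = exp ((1 - a - b - 1 / p) * w) * exp x"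
      by (simp add: algebra_simps diff_divide_distrib flip: exp_add)
    then have e: "complex_of_real (exp ((1 - a - 1 / p) * x)) * of_real (exp (- x * (b - 1))) * of_real (exp ((1 - a - b - 1 / p) * (w - x)))
       = of_real (exp ((1 - a - b - 1 / p) * w)) * of_real (exp x)"
      by (simp only: flip: of_real_mult)
    have "kober_kernel 0 a p x * kober_kernel a b p (w - x) = 
      (complex_of_real (exp ((1 - a - 1 / p) * x)) * of_real (exp (- x * (b - 1))) * of_real (exp ((1 - a - b - 1 / p) * (w - x))))
       * (power_kernel a (exp x - 1) * power_kernel b (T - exp x))"
      unfolding kober_kernel_power_kernel power_kernel diff_zero by (simp only: mult_ac)
    also have "\<dots> = of_real (exp ((1 - a - b - 1 / p) * w)) * (exp x *\<^sub>R (power_kernel a (exp x - 1) * power_kernel b (T - exp x)))"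
      unfolding e scaleR_conv_of_real by (simp only: mult_ac)
    finally show "kober_kernel 0 a p x * kober_kernel a b p (w - x) = of_real (exp ((1 - a - b - 1 / p) * w)) * (exp x *\<^sub>R (power_kernel a (exp x - 1) * power_kernel b (T - exp x)))" .
  qed
  also have "\<dots> = of_real (exp ((1 - a - b - 1 / p) * w)) * (LINT x|lborel. exp x *\<^sub>R (power_kernel a (exp x - 1) * power_kernel b (T - exp x)))"
    by (rule integral_mult_right_zero)
  also have "(LINT x|lborel. exp x *\<^sub>R (power_kernel a (exp x - 1) * power_kernel b (T - exp x))) = (LINT s|lborel. indicat_real {0<..} s *\<^sub>R (power_kernel a (s - 1) * power_kernel b (T - s)))"
    by (rule integral_exp_subst[symmetric]) measurable
  also have "\<dots> = (LINT s|lborel. power_kernel a (s - 1) * power_kernel b (T - s))"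
    by (rule Bochner_Integration.integral_cong[OF refl]) (auto simp: indicator_def)
  also have "\<dots> = (LINT s|lborel. power_kernel a (s + 1 - 1) * power_kernel b (T - (s + 1)))"
    by (rule lborel_integral_shift[symmetric])
  also have "\<dots> = convol (power_kernel a) (power_kernel b) (T - 1)"
    unfolding convol_def by (simp add: algebra_simps)
  also have "\<dots> = power_kernel (a + b) (T - 1)" by (rule convol_power_kernel[OF a b])
  finally show ?thesis unfolding kober_kernel_power_kernel[of 0 "a + b"] by (simp add: T_def diff_diff_eq mult.commute)
qed

section \<open>Injectivity\<close>

text \<open>The tail integral is continuous in y, so vanishing almost everywhere means vanishing
  everywhere. The open right half lines are closed under intersection and generate the Borel sets,
  hence \<open>f\<close> integrates to 0 over every Borel set.\<close>

lemma tail_integrals_zero: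
  fixes f :: "real \<Rightarrow> complex"
  assumes f: "integrable lborel f" and z: "integral\<^sup>L lborel f = 0"
    and t: "AE y in lborel. (LINT s|lborel. indicat_real {y<..} s *\<^sub>R f s) = 0"
  shows "AE s in lborel. f s = 0"
proof -
  define \<Phi> where "\<Phi> y = (LINT s|lborel. indicat_real {y<..} s *\<^sub>R f s)" for y
  have [measurable]: "f \<in> borel_measurable borel" using f by auto
  have cont: "continuous_on UNIV \<Phi>"
  proof (rule continuous_on_sequentiallyI)
    fix u :: "nat \<Rightarrow> real" and y assume u: "u \<longlonglongrightarrow> y"
    show "(\<lambda>n. \<Phi> (u n)) \<longlonglongrightarrow> \<Phi> y" unfolding \<Phi>_def
    proof (rule integral_dominated_convergence[where w="\<lambda>s. norm (f s)"])
      show "AE s in lborel. (\<lambda>n. indicat_real {u n<..} s *\<^sub>R f s) \<longlonglongrightarrow> indicat_real {y<..} s *\<^sub>R f s"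
        using AE_lborel_singleton[of y]
      proof eventually_elim
        case (elim s)
        consider "s < y" | "y < s" using elim by linarith
        then have "\<forall>\<^sub>F n in sequentially. indicat_real {u n<..} s *\<^sub>R f s = indicat_real {y<..} s *\<^sub>R f s"
        proof cases
          case 1
          show ?thesis using order_tendstoD(1)[OF u 1] by eventually_elim (use 1 in \<open>auto simp: indicator_def\<close>)
        next
          case 2
          show ?thesis using order_tendstoD(2)[OF u 2] by eventually_elim (use 2 in \<open>auto simp: indicator_def\<close>)
        qed
        then show ?case by (rule tendsto_eventually)
      qed
      show "AE s in lborel. norm (indicat_real {u n<..} s *\<^sub>R f s) \<le> norm (f s)" for n
        by (auto simp: indicator_def)
    qed (use f in auto)
  qed
  have "closed {y. \<Phi> y = 0}"
    using continuous_closed_vimage[of "{0}" \<Phi>] cont by (auto simp: vimage_def continuous_on_eq_continuous_at)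
  then have \<Phi>0: "\<Phi> y = 0" for y
    using mem_closed_if_AE_lebesgue[of "{y. \<Phi> y = 0}" y] t by (auto simp: \<Phi>_def AE_completion_iff)
  show ?thesis
  proof (rule sigma_finite_measure.density_zero[OF sigma_finite_lborel f])
    have s: "sets borel = sigma_sets UNIV (range (greaterThan :: real \<Rightarrow> real set))"
      by (subst borel_Ioi) (simp add: sets_measure_of)
    fix A :: "real set" assume "A \<in> sets lborel"
    then have A: "A \<in> sigma_sets UNIV (range greaterThan)" by (simp add: s)
    have meas: "A \<in> sets borel" if "A \<in> sigma_sets UNIV (range greaterThan)" for A :: "real set"
      using that by (simp add: s)
    have "{a<..} \<inter> {b<..} = {max a b<..}" for a b :: real by auto
    then have I: "Int_stable (range (greaterThan :: real \<Rightarrow> real set))" by (auto simp: Int_stable_def)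
    have P: "range (greaterThan :: real \<Rightarrow> real set) \<subseteq> Pow UNIV" by simp
    from I P A show "set_lebesgue_integral lborel A f = 0"
    proof (induction A rule: sigma_sets_induct_disjoint)
      case (basic A)
      then show ?case using \<Phi>0 by (auto simp: \<Phi>_def set_lebesgue_integral_def)
    next
      case empty
      then show ?case by (simp add: set_lebesgue_integral_def)
    next
      case (compl A)
      have [measurable]: "A \<in> sets borel" using meas compl by blast
      have "(\<lambda>s. indicat_real (UNIV - A) s *\<^sub>R f s) = (\<lambda>s. f s - indicat_real A s *\<^sub>R f s)"
        by (auto simp: indicator_def)
      then show ?case using compl(2) z f integrable_mult_indicator[of A lborel f] by (simp add: set_lebesgue_integral_def)
    next
      case (union A)
      have m: "A i \<in> sets lborel" for i using meas union(2) by auto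
      have "set_lebesgue_integral lborel (\<Union>i. A i) f = (\<Sum>i. set_lebesgue_integral lborel (A i) f)"
      proof (rule lebesgue_integral_countable_add[OF m])
        show "A i \<inter> A j = {}" if "i \<noteq> j" for i j using union(1) that by (auto simp: disjoint_family_on_def)
        show "set_integrable lborel (\<Union>i. A i) f" unfolding set_integrable_def
          using m f by (intro integrable_mult_indicator) auto
      qed
      then show ?case using union(3) by simp
    qed
  qed
qed

text \<open>Multiplying by exp(-c y) turns the correlation into a tail integral of \<open>h\<close>.
  On the left the exponential grows, so integrability of \<open>h\<close> is available only on right
  half lines, and the argument runs to the right of points \<open>y0\<close> that go to minus
  infinity.\<close>

lemma exponential_kernel_injective:
  assumes p: "1 \<le> p" and c: "0 < c" and g: "g \<in> LpR p"
    and k: "\<And>x. k x = of_real (indicat_real {0<..} x * exp (- c * x))" "integrable lborel k"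
    and z: "AE y in lborel. correl k g y = 0"
  shows "AE x in lborel. g x = 0"
proof -
  have [measurable]: "g \<in> borel_measurable borel" using g by (simp add: LpR_def)
  define h where "h s = of_real (exp (- c * s)) * g s" for s
  have [measurable]: "h \<in> borel_measurable borel" unfolding h_def[abs_def] by measurable
  have eq: "k x * g (y + x) = of_real (exp (c * y)) * (indicat_real {y<..} (x + y) *\<^sub>R h (x + y))" for x y
  proof -
    have "complex_of_real (exp (c * y)) * of_real (exp (- c * (x + y))) = of_real (exp (- c * x))"
      by (simp add: algebra_simps flip: of_real_mult exp_add)
    then show ?thesis unfolding k h_def scaleR_conv_of_real by (auto simp: indicator_def add.commute simp flip: mult.assoc)
  qed
  have "AE y in lborel. integrable lborel (\<lambda>s. indicat_real {y<..} s *\<^sub>R h s) \<and> (LINT s|lborel. indicat_real {y<..} s *\<^sub>R h s) = 0"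
    using z correl_AE_integrable[OF p k(2) g]
  proof eventually_elim
    case (elim y)
    have "complex_of_real (exp (- (c * y))) * of_real (exp (c * y)) = 1"
      by (simp flip: of_real_mult exp_add)
    then have "of_real (exp (- (c * y))) * (k x * g (y + x)) = indicat_real {y<..} (x + y) *\<^sub>R h (x + y)" for x
      unfolding eq mult.assoc[symmetric] by (simp only: mult_1_left)
    then have "integrable lborel (\<lambda>x. indicat_real {y<..} (x + y) *\<^sub>R h (x + y))"
      using integrable_mult_right[OF elim(2), of "of_real (exp (- (c * y)))"] by simp
    then have "integrable lborel (\<lambda>s. indicat_real {y<..} s *\<^sub>R h s)"
      using lborel_integrable_shift[of "\<lambda>s. indicat_real {y<..} s *\<^sub>R h s" y] by simp
    moreover have "(LINT x|lborel. indicat_real {y<..} (x + y) *\<^sub>R h (x + y)) = 0"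
      using elim(1) unfolding correl_def eq integral_mult_right_zero by simp
    then have "(LINT s|lborel. indicat_real {y<..} s *\<^sub>R h s) = 0"
      using lborel_integral_shift[of "\<lambda>s. indicat_real {y<..} s *\<^sub>R h s" y] by simp
    ultimately show ?case by blast
  qed
  note good = this
  have local: "AE s in lborel. y0 < s \<longrightarrow> h s = 0" 
    if y0: "integrable lborel (\<lambda>s. indicat_real {y0<..} s *\<^sub>R h s)" "(LINT s|lborel. indicat_real {y0<..} s *\<^sub>R h s) = 0" for y0
  proof -
    have "AE s in lborel. indicat_real {y0<..} s *\<^sub>R h s = 0"
    proof (rule tail_integrals_zero[OF y0])
      show "AE y in lborel. (LINT s|lborel. indicat_real {y<..} s *\<^sub>R (indicat_real {y0<..} s *\<^sub>R h s)) = 0"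
        using good
      proof eventually_elim
        case (elim y)
        have "(\<lambda>s. indicat_real {y<..} s *\<^sub>R (indicat_real {y0<..} s *\<^sub>R h s)) = (if y \<le> y0 then (\<lambda>s. indicat_real {y0<..} s *\<^sub>R h s) else (\<lambda>s. indicat_real {y<..} s *\<^sub>R h s))"
          by (auto simp: indicator_def fun_eq_iff)
        then show ?case using elim y0 by simp
      qed
    qed
    then show ?thesis by eventually_elim (auto simp: indicator_def split: if_splits)
  qed
  \<comment> \<open>The good points have full measure, so they meet every left half line.\<close>
  have ex: "\<exists>y0 < - real n. integrable lborel (\<lambda>s. indicat_real {y0<..} s *\<^sub>R h s) \<and> (LINT s|lborel. indicat_real {y0<..} s *\<^sub>R h s) = 0" for n
  proof (rule ccontr)
    assume "\<not> ?thesis"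
    then have "AE y in lborel. \<not> y < - real n" using good by (auto elim: eventually_mono)
    then have "- real n - 1 \<in> {- real n..}" 
      using mem_closed_if_AE_lebesgue[of "{- real n..}" "- real n - 1"] by (auto simp: AE_completion_iff not_less)
    then show False by simp
  qed
  have "AE s in lborel. \<forall>n. - real n < s \<longrightarrow> h s = 0"
  proof (subst AE_all_countable, rule allI)
    fix n
    obtain y0 where y0: "y0 < - real n" "integrable lborel (\<lambda>s. indicat_real {y0<..} s *\<^sub>R h s)" "(LINT s|lborel. indicat_real {y0<..} s *\<^sub>R h s) = 0"
      using ex by blast
    show "AE s in lborel. - real n < s \<longrightarrow> h s = 0"
      using local[OF y0(2,3)] by eventually_elim (use y0(1) in auto)
  qed
  then show ?thesis
  proof eventually_elim
    case (elim s)
    obtain n where "- s < real n" using reals_Archimedean2 by blast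
    then have "h s = 0" using elim[rule_format, of n] by simp
    then show ?case by (simp add: h_def)
  qed
qed

lemma kober_kernel_1_injective:
  assumes p: "1 \<le> p" and m: "0 \<le> m" and g: "g \<in> LpR p" and z: "AE y in lborel. correl (kober_kernel m 1 p) g y = 0"
  shows "AE x in lborel. g x = 0"
proof (rule exponential_kernel_injective[OF p _ g _ _ z])
  show c: "0 < m + 1 / p" using p m by (simp add: add_nonneg_pos)
  show "integrable lborel (kober_kernel m 1 p)" by (rule kober_kernel_integrable) (use c in auto)
  show "kober_kernel m 1 p x = of_real (indicat_real {0<..} x * exp (- (m + 1 / p) * x))" for x
    by (auto simp: kober_kernel_def indicator_def algebra_simps)
qed

text \<open>The kernel of order n + 2 is the convolution of the one of order n + 1 with one of order
  1. Commutation brings the factor of order 1 to the outside, where its injectivity strips it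
  off.\<close>

lemma kober_kernel_nat_injective:
  assumes p: "1 \<le> p" and g: "g \<in> LpR p" and z: "AE y in lborel. correl (kober_kernel 0 (real (Suc n)) p) g y = 0"
  shows "AE x in lborel. g x = 0"
  using g z
proof (induction n)
  case 0
  then show ?case using kober_kernel_1_injective[OF p, of 0 g] by simp
next
  case (Suc n)
  have ki: "integrable lborel (kober_kernel 0 (real (Suc n)) p)" "integrable lborel (kober_kernel (real (Suc n)) 1 p)"
    using p kober_kernel_integrable[of "real (Suc n)" 0 p] kober_kernel_integrable[of 1 "real (Suc n)" p] by (simp_all add: add_pos_pos)
  have "AE y in lborel. correl (kober_kernel (real (Suc n)) 1 p) (correl (kober_kernel 0 (real (Suc n)) p) g) y = 0"
    using Suc.prems(2) correl_convol_AE[OF p ki Suc.prems(1)] correl_commute_AE[OF p ki Suc.prems(1)]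
  proof eventually_elim
    case (elim y)
    have "convol (kober_kernel 0 (real (Suc n)) p) (kober_kernel (real (Suc n)) 1 p) = kober_kernel 0 (real (Suc (Suc n))) p"
      using convol_kober_kernel[of "real (Suc n)" 1 p] by (auto simp: fun_eq_iff add.commute)
    then show ?case using elim by simp
  qed
  then have "AE y in lborel. correl (kober_kernel 0 (real (Suc n)) p) g y = 0"
    by (intro kober_kernel_1_injective[OF p _ correl_LpR_mem[OF p ki(1) Suc.prems(1)]]) auto
  then show ?case using Suc by blast
qed

lemma kober_kernel_injective:
  assumes p: "1 \<le> p" and \<alpha>: "0 < \<alpha>" and g: "g \<in> LpR p" and z: "AE y in lborel. correl (kober_kernel 0 \<alpha> p) g y = 0"
  shows "AE x in lborel. g x = 0"
proof -
  define n where "n = nat \<lfloor>\<alpha>\<rfloor>"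
  define \<nu> where "\<nu> = real (Suc n) - \<alpha>"
  have nu: "0 < \<nu>" unfolding \<nu>_def n_def using \<alpha> by linarith
  have ki: "integrable lborel (kober_kernel 0 \<alpha> p)" "integrable lborel (kober_kernel \<alpha> \<nu> p)"
    using p \<alpha> nu by (auto intro!: kober_kernel_integrable add_nonneg_pos)
  have [measurable]: "g \<in> borel_measurable borel" using g by (simp add: LpR_def)
  have "correl (kober_kernel \<alpha> \<nu> p) (correl (kober_kernel 0 \<alpha> p) g) y = correl (kober_kernel \<alpha> \<nu> p) (\<lambda>x. 0) y" for y
    by (rule correl_cong_AE[OF _ _ _ z]) measurable
  then have "correl (kober_kernel \<alpha> \<nu> p) (correl (kober_kernel 0 \<alpha> p) g) y = 0" for y by (simp add: correl_def)
  then have "AE y in lborel. correl (kober_kernel 0 (real (Suc n)) p) g y = 0"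
    using correl_convol_AE[OF p ki g] correl_commute_AE[OF p ki g] convol_kober_kernel[OF \<alpha> nu, of p, abs_def]
    by (auto elim!: eventually_elim2 simp: \<nu>_def)
  then show ?thesis by (rule kober_kernel_nat_injective[OF p g])
qed

section \<open>The isometry \<open>D\<^sub>+\<^sup>\<alpha>\<close> on the Schwartz class\<close>

text \<open>The exponent \<open>\<alpha>\<close> is the weight t^\<alpha> of D_+^\<alpha>; the
  additional 1/p cancels the factor t^(-1/p) of \<open>from_log\<close>.\<close>

definition log_weight :: "real \<Rightarrow> real \<Rightarrow> real \<Rightarrow> complex" where
  "log_weight \<alpha> p x = of_real (exp ((\<alpha> + 1 / p) * x) / Gamma (\<alpha> + 1))"

definition log_D :: "real \<Rightarrow> real \<Rightarrow> (real \<Rightarrow> complex) \<Rightarrow> real \<Rightarrow> complex" where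
  "log_D \<alpha> p u x = log_weight \<alpha> p x * weyl_derivative \<alpha> u (exp x)"

text \<open>The logarithmic kernel of the inverse of D_+^\<alpha>. \<open>kober_kernel\<close>
  carries 1/Gamma(\<alpha>), and Gamma(\<alpha>+1)/Gamma(\<alpha>) = \<alpha> is the constant in
  front of that inverse.\<close>

definition weyl_kernel :: "real \<Rightarrow> real \<Rightarrow> real \<Rightarrow> complex" where
  "weyl_kernel \<alpha> p x = of_real (Gamma (\<alpha> + 1)) * kober_kernel 0 \<alpha> p x"

lemma log_weight_measurable [measurable]: "log_weight \<alpha> p \<in> borel_measurable borel"
  unfolding log_weight_def[abs_def] by measurable

text \<open>The Stieltjes kernel is at most 1, so for \<open>p \<ge> 1\<close> its p-th power is
  dominated by the kernel itself, which is integrable.\<close>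

lemma LpR_stieltjes_kernel_bound:
  assumes p: "1 \<le> p" and a: "0 < a" "a < \<mu>" and [measurable]: "h \<in> borel_measurable borel"
    and le: "\<And>x. norm (h x) \<le> C * norm (stieltjes_kernel a \<mu> x)"
  shows "h \<in> LpR p"
proof -
  have "integrable lborel (\<lambda>x. norm (h x) powr p)"
  proof (rule Bochner_Integration.integrable_bound)
    show "integrable lborel (\<lambda>x. C powr p * norm (stieltjes_kernel a \<mu> x))" using stieltjes_kernel_integrable[OF a] by simp
    have "norm (h x) powr p \<le> C powr p * norm (stieltjes_kernel a \<mu> x)" for x
    proof -
      have "norm (stieltjes_kernel a \<mu> x) > 0" by (simp add: norm_stieltjes_kernel add_pos_pos less_imp_neq[symmetric])
      then have "0 \<le> C" using order_trans[OF norm_ge_zero le[of x]] by (simp add: zero_le_mult_iff)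
      have "norm (h x) powr p \<le> (C * norm (stieltjes_kernel a \<mu> x)) powr p" using p by (intro powr_mono2 le) auto
      also have "\<dots> = C powr p * norm (stieltjes_kernel a \<mu> x) powr p" by (rule powr_mult)
      also have "norm (stieltjes_kernel a \<mu> x) powr p \<le> norm (stieltjes_kernel a \<mu> x) powr 1"
        using p stieltjes_kernel_bound[OF a, of x] by (intro powr_mono') auto
      finally show ?thesis by (simp add: mult_left_mono)
    qed
    then show "AE x in lborel. norm (norm (h x) powr p) \<le> norm (C powr p * norm (stieltjes_kernel a \<mu> x))"
      by (intro AE_I2) simp
  qed measurable
  then show ?thesis by (simp add: LpR_def)
qed

lemma log_weight_decays_LpR:
  assumes p: "1 \<le> p" and \<alpha>: "0 < \<alpha>" and w: "decays w"
  shows "(\<lambda>x. log_weight \<alpha> p x * w (exp x)) \<in> LpR p"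
proof -
  have [measurable]: "w \<in> borel_measurable borel" by (rule decays_measurable[OF w])
  obtain k :: nat where k: "\<alpha> + 1 / p < real k" using reals_Archimedean2 by blast
  have G: "Gamma (\<alpha> + 1) > 0" using \<alpha> by (intro Gamma_real_pos) auto
  obtain C where C: "0 \<le> C" "\<And>t. 0 \<le> t \<Longrightarrow> (1 + t) ^ k * norm (w t) \<le> C" using decays_bound[OF w] by blast
  show ?thesis
  proof (rule LpR_stieltjes_kernel_bound[OF p _ k])
    show "0 < \<alpha> + 1 / p" using \<alpha> p by (simp add: add_pos_pos)
    show "norm (log_weight \<alpha> p x * w (exp x)) \<le> C / Gamma (\<alpha> + 1) * norm (stieltjes_kernel (\<alpha> + 1 / p) (real k) x)" for x
    proof -
      have "1 + exp x > 0" by (simp add: add_pos_pos)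
      then have pw: "(1 + exp x) powr real k = (1 + exp x) ^ k" by (rule powr_realpow)
      have "norm (w (exp x)) \<le> C / (1 + exp x) ^ k" 
        using C(2)[of "exp x"] \<open>1 + exp x > 0\<close> by (simp add: field_simps)
      then have "exp ((\<alpha> + 1 / p) * x) / Gamma (\<alpha> + 1) * norm (w (exp x)) \<le> exp ((\<alpha> + 1 / p) * x) / Gamma (\<alpha> + 1) * (C / (1 + exp x) ^ k)"
        using G by (intro mult_left_mono) auto
      moreover have "norm (log_weight \<alpha> p x) = exp ((\<alpha> + 1 / p) * x) / Gamma (\<alpha> + 1)"
        unfolding log_weight_def norm_of_real using G by simp
      ultimately show ?thesis unfolding norm_mult norm_stieltjes_kernel pw by (simp add: mult_ac)
    qed
  qed measurable
qed

text \<open>\<open>weyl_derivative\<close> is controlled only for \<open>t > 0\<close>. The function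
  \<open>w\<close> agrees with it there and is Borel and rapidly decaying, as the correlation lemmas
  require.\<close>

lemma schwartz_weyl:
  assumes u: "u \<in> schwartz_half" and \<alpha>: "0 < \<alpha>"
  obtains w where "decays w" "\<And>t. 0 < t \<Longrightarrow> weyl_derivative \<alpha> u t = w t"
    "\<And>t. 0 \<le> t \<Longrightarrow> correl (power_kernel \<alpha>) w t = u t"
proof -
  obtain F where F: "schwartz_family F" "\<And>t. 0 \<le> t \<Longrightarrow> F 0 t = u t" using u unfolding schwartz_half_iff_schwartz_family by blast
  define n where "n = nat \<lfloor>\<alpha>\<rfloor> + 1"
  have nu: "0 < real n - \<alpha>" using n_def \<alpha> by linarith
  define w where "w t = (- 1) ^ n * correl (power_kernel (real n - \<alpha>)) (F n) t" for t
  have eq: "weyl_derivative \<alpha> u t = w t" if "0 < t" for t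
    using weyl_derivative_eq[OF F \<alpha> n_def that] by (simp add: w_def)
  show ?thesis
  proof (rule that)
    show "decays w" unfolding w_def[abs_def] by (intro decays_scale decays_correl schwartz_family_decays F nu)
    show "weyl_derivative \<alpha> u t = w t" if "0 < t" for t by (rule eq[OF that])
    show "correl (power_kernel \<alpha>) w t = u t" if "0 \<le> t" for t
      using correl_power_kernel_weyl_derivative[OF F \<alpha> that] correl_power_kernel_cong[of t "weyl_derivative \<alpha> u" w \<alpha>] eq that by simp
  qed
qed

lemma schwartz_log_D:
  assumes p: "1 \<le> p" and \<alpha>: "0 < \<alpha>" and u: "u \<in> schwartz_half"
  shows log_D_LpR: "log_D \<alpha> p u \<in> LpR p"
    and schwartz_norm_eq: "schwartz_norm \<alpha> p u = pnorm p (log_D \<alpha> p u)"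
    and from_log_correl_weyl_kernel_log_D: "\<And>t. 0 < t \<Longrightarrow> from_log p (correl (weyl_kernel \<alpha> p) (log_D \<alpha> p u)) t = u t"
proof -
  obtain w where w: "decays w" "\<And>t. 0 < t \<Longrightarrow> weyl_derivative \<alpha> u t = w t"
    "\<And>t. 0 \<le> t \<Longrightarrow> correl (power_kernel \<alpha>) w t = u t" using schwartz_weyl[OF u \<alpha>] by blast
  have G: "Gamma (\<alpha> + 1) > 0" using \<alpha> by (intro Gamma_real_pos) auto
  have dl: "log_D \<alpha> p u = (\<lambda>x. log_weight \<alpha> p x * w (exp x))" by (simp add: log_D_def[abs_def] w(2))
  show LpR: "log_D \<alpha> p u \<in> LpR p" unfolding dl by (rule log_weight_decays_LpR[OF p \<alpha> w(1)])
  have [measurable]: "log_D \<alpha> p u \<in> borel_measurable borel" using LpR by (simp add: LpR_def)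
  have Jd: "from_log p (log_D \<alpha> p u) t = of_real (t powr \<alpha> / Gamma (\<alpha> + 1)) * weyl_derivative \<alpha> u t" if "0 < t" for t
  proof -
    have "t powr (- 1 / p) * exp ((\<alpha> + 1 / p) * ln t) = t powr \<alpha>"
      using that by (simp add: powr_def algebra_simps flip: exp_add)
    then have "complex_of_real (t powr (- 1 / p)) * of_real (exp ((\<alpha> + 1 / p) * ln t)) = of_real (t powr \<alpha>)"
      by (simp only: flip: of_real_mult)
    then show ?thesis using that
      unfolding from_log_def log_D_def log_weight_def of_real_divide by (simp flip: mult.assoc)
  qed
  show "schwartz_norm \<alpha> p u = pnorm p (log_D \<alpha> p u)"
  proof -
    have "(LINT t|half_line. norm (weyl_derivative \<alpha> u t) powr p * t powr (\<alpha> * p)) 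
      = (LINT t|half_line. Gamma (\<alpha> + 1) powr p * norm (from_log p (log_D \<alpha> p u) t) powr p)"
    proof (rule Bochner_Integration.integral_cong[OF refl])
      fix t assume "t \<in> space half_line"
      then have t: "0 < t" by simp
      have "norm (from_log p (log_D \<alpha> p u) t) = t powr \<alpha> / Gamma (\<alpha> + 1) * norm (weyl_derivative \<alpha> u t)"
        unfolding Jd[OF t] norm_mult norm_of_real using G by simp
      then show "norm (weyl_derivative \<alpha> u t) powr p * t powr (\<alpha> * p) = Gamma (\<alpha> + 1) powr p * norm (from_log p (log_D \<alpha> p u) t) powr p"
        using G by (simp add: powr_mult powr_divide powr_powr)
    qed
    also have "\<dots> = Gamma (\<alpha> + 1) powr p * (LINT x|lborel. norm (log_D \<alpha> p u x) powr p)"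
      by (simp add: from_log_powr(2)[OF p])
    finally show ?thesis using G p
      by (simp add: schwartz_norm_def pnorm_def powr_mult powr_powr)
  qed
  show "from_log p (correl (weyl_kernel \<alpha> p) (log_D \<alpha> p u)) t = u t" if t: "0 < t" for t
  proof -
    \<comment> \<open>The factor Gamma(\<alpha>+1) pulled out here cancels the 1/Gamma(\<alpha>+1)
      contained in \<open>log_D\<close>.\<close>
    have "correl (weyl_kernel \<alpha> p) (log_D \<alpha> p u) = (\<lambda>y. of_real (Gamma (\<alpha> + 1)) * correl (kober_kernel 0 \<alpha> p) (log_D \<alpha> p u) y)"
      unfolding correl_def weyl_kernel_def mult.assoc by (simp only: integral_mult_right_zero)
    then have "from_log p (correl (weyl_kernel \<alpha> p) (log_D \<alpha> p u)) t = of_real (Gamma (\<alpha> + 1)) * from_log p (correl (kober_kernel 0 \<alpha> p) (log_D \<alpha> p u)) t"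
      by (simp only: from_log_scale)
    also have "from_log p (correl (kober_kernel 0 \<alpha> p) (log_D \<alpha> p u)) t = correl (power_kernel \<alpha>) (\<lambda>s. of_real (s powr (- \<alpha>)) * from_log p (log_D \<alpha> p u) s) t"
      using from_log_correl_kober_kernel[OF \<alpha>, of "log_D \<alpha> p u" t p 0] t by simp
    also have "\<dots> = correl (power_kernel \<alpha>) (\<lambda>s. of_real (1 / Gamma (\<alpha> + 1)) * w s) t"
    proof (rule correl_power_kernel_cong)
      fix s assume "t < s"
      then have s: "0 < s" using t by simp
      have "complex_of_real (s powr (- \<alpha>)) * of_real (s powr \<alpha>) = 1"
        using s by (simp flip: of_real_mult powr_add)
      then show "of_real (s powr (- \<alpha>)) * from_log p (log_D \<alpha> p u) s = of_real (1 / Gamma (\<alpha> + 1)) * w s"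
        unfolding Jd[OF s] w(2)[OF s] of_real_divide by (simp flip: mult.assoc)
    qed
    also have "\<dots> = of_real (1 / Gamma (\<alpha> + 1)) * u t" using w(3)[of t] t by (simp only: correl_scale less_imp_le)
    finally show ?thesis using G by simp
  qed
qed

lemma log_D_diff:
  assumes \<alpha>: "0 < \<alpha>" and u: "u \<in> schwartz_half" and v: "v \<in> schwartz_half"
  shows "log_D \<alpha> p (\<lambda>t. u t - v t) = (\<lambda>x. log_D \<alpha> p u x - log_D \<alpha> p v x)"
proof
  fix x
  obtain F where F: "schwartz_family F" "\<And>t. 0 \<le> t \<Longrightarrow> F 0 t = u t" using u unfolding schwartz_half_iff_schwartz_family by blast
  obtain G where G: "schwartz_family G" "\<And>t. 0 \<le> t \<Longrightarrow> G 0 t = v t" using v unfolding schwartz_half_iff_schwartz_family by blast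
  define n where "n = nat \<lfloor>\<alpha>\<rfloor> + 1"
  have nu: "0 < real n - \<alpha>" using n_def \<alpha> by linarith
  have H: "schwartz_family (\<lambda>n t. F n t + (- 1) * G n t)" by (intro schwartz_family_add schwartz_family_scale F G)
  have "weyl_derivative \<alpha> (\<lambda>t. u t - v t) (exp x) = (- 1) ^ n * correl (power_kernel (real n - \<alpha>)) (\<lambda>t. F n t + (- 1) * G n t) (exp x)"
    by (rule weyl_derivative_eq[OF H _ \<alpha> n_def]) (auto simp: F(2) G(2))
  also have "correl (power_kernel (real n - \<alpha>)) (\<lambda>t. F n t + (- 1) * G n t) (exp x) 
     = correl (power_kernel (real n - \<alpha>)) (F n) (exp x) - correl (power_kernel (real n - \<alpha>)) (G n) (exp x)"
    using decays_correl_integrable[OF schwartz_family_decays[OF F(1)] nu, of "exp x" n] decays_correl_integrable[OF schwartz_family_decays[OF G(1)] nu, of "exp x" n]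
    by (simp add: correl_def right_diff_distrib)
  finally show "log_D \<alpha> p (\<lambda>t. u t - v t) x = log_D \<alpha> p u x - log_D \<alpha> p v x"
    using weyl_derivative_eq[OF F \<alpha> n_def, of "exp x"] weyl_derivative_eq[OF G \<alpha> n_def, of "exp x"]
    by (simp add: log_D_def right_diff_distrib)
qed

text \<open>The equation W^\<alpha> u = H on t > 0 is solved by the fractional integral of
  \<open>H\<close>, which stays in the Schwartz class. Density of the image of D_+^\<alpha> thereby
  becomes density of weighted Schwartz functions.\<close>

lemma log_D_surj:
  assumes \<alpha>: "0 < \<alpha>" and H: "H \<in> schwartz_half"
  obtains u where "u \<in> schwartz_half" "log_D \<alpha> p u = (\<lambda>x. log_weight \<alpha> p x * H (exp x))"
proof -
  obtain F where F: "schwartz_family F" "\<And>t. 0 \<le> t \<Longrightarrow> F 0 t = H t" using H unfolding schwartz_half_iff_schwartz_family by blast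
  show ?thesis
  proof (rule that)
    show "correl (power_kernel \<alpha>) (F 0) \<in> schwartz_half"
      unfolding schwartz_half_iff_schwartz_family using correl_power_kernel_schwartz_family[OF F(1) \<alpha>] by (intro exI[of _ "\<lambda>n. correl (power_kernel \<alpha>) (F n)"]) simp
    show "log_D \<alpha> p (correl (power_kernel \<alpha>) (F 0)) = (\<lambda>x. log_weight \<alpha> p x * H (exp x))"
      using weyl_derivative_correl_power_kernel[OF F(1) \<alpha>] F(2) by (simp add: log_D_def[abs_def])
  qed
qed

section \<open>Density of the Schwartz class\<close>

lemma powr_exp_bounded:
  fixes c :: real
  assumes c: "0 < c" and m: "0 < m"
  shows "\<exists>C. \<forall>t\<ge>0. t ^ k * exp (- c * t ^ m) \<le> C"
proof (cases "k = 0")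
  case True
  then show ?thesis using c by (intro exI[of _ 1]) auto
next
  case False
  have "t ^ k * exp (- c * t ^ m) \<le> max 1 ((real k / c) ^ k)" if t: "0 \<le> t" for t
  proof (cases "t \<le> 1")
    case True
    then have "t ^ k * exp (- c * t ^ m) \<le> 1 * 1" using t c by (intro mult_mono power_le_one) auto
    then show ?thesis by simp
  next
    case F: False
    \<comment> \<open>The power t^k is absorbed by exp(c t), and exp(- c t^m) is at most exp(- c t)
      because t > 1 in this case.\<close>
    have "(1 + c * t / real k) ^ k \<le> exp (c * t)"
      using False c t by (intro exp_ge_one_plus_x_over_n_power_n) (auto intro: order_trans[of _ 0])
    moreover have "(c * t / real k) ^ k \<le> (1 + c * t / real k) ^ k" using c t by (intro power_mono) auto
    ultimately have "(c * t / real k) ^ k \<le> exp (c * t)" by linarith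
    moreover have "t ^ k = (real k / c) ^ k * (c * t / real k) ^ k"
      using c False by (simp flip: power_mult_distrib)
    ultimately have "t ^ k \<le> (real k / c) ^ k * exp (c * t)" using c by (auto intro!: mult_left_mono)
    moreover have "t ^ 1 \<le> t ^ m" using F m by (intro power_increasing) auto
    then have "exp (- c * t ^ m) \<le> exp (- (c * t))" using c by (simp add: mult_left_mono)
    ultimately have "t ^ k * exp (- c * t ^ m) \<le> ((real k / c) ^ k * exp (c * t)) * exp (- (c * t))"
      using c t by (intro mult_mono) auto
    also have "\<dots> = (real k / c) ^ k" by (simp flip: exp_add mult.assoc add: exp_minus)
    finally show ?thesis by simp
  qed
  then show ?thesis by blast
qed

lemma poly_exp_bounded:
  fixes c :: real
  assumes c: "0 < c" and m: "0 < m"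
  shows "\<exists>C. \<forall>t\<ge>0. t ^ k * \<bar>poly R t\<bar> * exp (- c * t ^ m) \<le> C"
proof (induction R arbitrary: k)
  case 0
  then show ?case by auto
next
  case (pCons a R)
  obtain C1 where C1: "\<forall>t\<ge>0. t ^ k * exp (- c * t ^ m) \<le> C1" using powr_exp_bounded[OF c m] by blast
  obtain C2 where C2: "\<forall>t\<ge>0. t ^ Suc k * \<bar>poly R t\<bar> * exp (- c * t ^ m) \<le> C2" using pCons.IH by blast
  have "t ^ k * \<bar>poly (pCons a R) t\<bar> * exp (- c * t ^ m) \<le> \<bar>a\<bar> * C1 + C2" if t: "0 \<le> t" for t
  proof -
    have "\<bar>poly (pCons a R) t\<bar> \<le> \<bar>a\<bar> + t * \<bar>poly R t\<bar>" 
      using abs_triangle_ineq[of a "t * poly R t"] t by (simp add: abs_mult)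
    then have "t ^ k * \<bar>poly (pCons a R) t\<bar> * exp (- c * t ^ m) \<le> t ^ k * (\<bar>a\<bar> + t * \<bar>poly R t\<bar>) * exp (- c * t ^ m)"
      using t by (intro mult_right_mono mult_left_mono) auto
    also have "\<dots> = \<bar>a\<bar> * (t ^ k * exp (- c * t ^ m)) + t ^ Suc k * \<bar>poly R t\<bar> * exp (- c * t ^ m)"
      by (simp add: algebra_simps)
    also have "\<dots> \<le> \<bar>a\<bar> * C1 + C2" using C1 C2 t by (intro add_mono mult_left_mono) auto
    finally show ?thesis .
  qed
  then show ?case by blast
qed

lemma exp_power_schwartz:
  fixes c :: real
  assumes c: "0 < c" and m: "0 < m"
  shows "(\<lambda>t. complex_of_real (exp (- c * t ^ m))) \<in> schwartz_half"
proof -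
  define Q where "Q = monom c m"
  \<comment> \<open>Every derivative of exp(-Q) is a polynomial times exp(-Q); this is the recursion
    for the polynomials.\<close>
  define P where "P = rec_nat (1 :: real poly) (\<lambda>_ R. pderiv R - pderiv Q * R)"
  have P: "P 0 = 1" "P (Suc n) = pderiv (P n) - pderiv Q * P n" for n by (simp_all add: P_def)
  define F where "F n t = complex_of_real (poly (P n) t * exp (- poly Q t))" for n t
  have Q: "poly Q t = c * t ^ m" for t by (simp add: Q_def poly_monom)
  have "(F n has_vector_derivative F (Suc n) t) (at t within {0..})" for n t
  proof -
    have e: "((\<lambda>t. exp (- poly Q t)) has_real_derivative exp (- poly Q t) * (- poly (pderiv Q) t)) (at t)"
      by (rule DERIV_chain2[OF DERIV_exp DERIV_minus[OF poly_DERIV]])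
    have "((\<lambda>t. poly (P n) t * exp (- poly Q t)) has_real_derivative poly (P (Suc n)) t * exp (- poly Q t)) (at t)"
      using DERIV_mult[OF poly_DERIV[of "P n" t] e] by (simp add: P algebra_simps)
    then show ?thesis unfolding F_def by (rule has_vector_derivative_of_real[OF has_field_derivative_at_within])
  qed
  moreover have "\<exists>C. \<forall>t\<ge>0. t ^ k * norm (F n t) \<le> C" for n k
  proof -
    obtain C where "\<forall>t\<ge>0. t ^ k * \<bar>poly (P n) t\<bar> * exp (- c * t ^ m) \<le> C" using poly_exp_bounded[OF c m] by blast
    then have "\<forall>t\<ge>0. t ^ k * norm (F n t) \<le> C" unfolding F_def norm_of_real by (simp add: abs_mult Q mult.assoc)
    then show ?thesis by blast
  qed
  moreover have "F 0 t = complex_of_real (exp (- c * t ^ m))" for t by (simp add: F_def P Q)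
  ultimately show ?thesis unfolding schwartz_half_def by (intro CollectI exI[of _ F]) simp
qed

lemma pnorm_dominated_convergence:
  assumes p: "1 \<le> p" and g: "\<And>n. g n \<in> LpR p" and h: "h \<in> LpR p" and f: "f \<in> LpR p"
    and le: "\<And>n. AE x in lborel. norm (g n x - f x) \<le> norm (h x)"
    and lim: "AE x in lborel. (\<lambda>n. g n x) \<longlonglongrightarrow> f x"
  shows "(\<lambda>n. pnorm p (\<lambda>x. g n x - f x)) \<longlonglongrightarrow> 0"
proof -
  have [measurable]: "g n \<in> borel_measurable borel" "f \<in> borel_measurable borel" for n using g f by (auto simp: LpR_def)
  have "(\<lambda>n. LINT x|lborel. norm (g n x - f x) powr p) \<longlonglongrightarrow> (LINT x::real|lborel. 0)"
  proof (rule integral_dominated_convergence[where w="\<lambda>x. norm (h x) powr p"])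
    show "AE x in lborel. (\<lambda>n. norm (g n x - f x) powr p) \<longlonglongrightarrow> 0"
      using lim
    proof eventually_elim
      case (elim x)
      have "(\<lambda>n. norm (g n x - f x) powr p) \<longlonglongrightarrow> norm (f x - f x) powr p"
        using p by (intro tendsto_powr' tendsto_intros elim) auto
      then show ?case using p by simp
    qed
    show "AE x in lborel. norm (norm (g n x - f x) powr p) \<le> norm (h x) powr p" for n
      using le[of n] by eventually_elim (use p in \<open>auto intro!: powr_mono2\<close>)
  qed (use h in \<open>auto simp: LpR_def\<close>)
  then have "(\<lambda>n. LINT x|lborel. norm (g n x - f x) powr p) \<longlonglongrightarrow> 0" by simp
  then have "(\<lambda>n. pnorm p (\<lambda>x. g n x - f x)) \<longlonglongrightarrow> 0 powr (1 / p)"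
    unfolding pnorm_def using p by (intro tendsto_powr' tendsto_intros) (auto intro!: always_eventually)
  then show ?thesis by simp
qed

section \<open>The closure of the weighted Schwartz functions\<close>

text \<open>A closed subspace of \<open>LpR p\<close>. Density is proved by climbing inside it from
  half lines to Borel sets, to simple functions, and to all of \<open>LpR p\<close>.\<close>

definition approximable :: "real \<Rightarrow> real \<Rightarrow> (real \<Rightarrow> complex) \<Rightarrow> bool" where
  "approximable \<alpha> p g \<longleftrightarrow> g \<in> LpR p \<and> 
     (\<forall>e>0. \<exists>H\<in>schwartz_half. (\<lambda>x. log_weight \<alpha> p x * H (exp x)) \<in> LpR p \<and> pnorm p (\<lambda>x. log_weight \<alpha> p x * H (exp x) - g x) < e)"

lemma log_weight_schwartz_LpR:
  assumes p: "1 \<le> p" and \<alpha>: "0 < \<alpha>" and H: "H \<in> schwartz_half"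
  shows "(\<lambda>x. log_weight \<alpha> p x * H (exp x)) \<in> LpR p"
proof -
  obtain u where "u \<in> schwartz_half" "log_D \<alpha> p u = (\<lambda>x. log_weight \<alpha> p x * H (exp x))" using log_D_surj[OF \<alpha> H] by blast
  then show ?thesis using log_D_LpR[OF p \<alpha>, of u] by simp
qed

context
  fixes \<alpha> p :: real
  assumes p: "1 \<le> p" and \<alpha>: "0 < \<alpha>"
begin

lemma approximable_add:
  assumes "approximable \<alpha> p f" "approximable \<alpha> p g"
  shows "approximable \<alpha> p (\<lambda>x. f x + g x)"
  unfolding approximable_def
proof (intro conjI allI impI)
  have fg: "f \<in> LpR p" "g \<in> LpR p" using assms by (auto simp: approximable_def)
  then show "(\<lambda>x. f x + g x) \<in> LpR p" by (intro LpR_add_mem p)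
  fix e :: real assume "0 < e"
  then have e: "0 < e / 2" by simp
  obtain F where F: "F \<in> schwartz_half" "pnorm p (\<lambda>x. log_weight \<alpha> p x * F (exp x) - f x) < e / 2"
    using assms(1) e unfolding approximable_def by blast
  obtain G where G: "G \<in> schwartz_half" "pnorm p (\<lambda>x. log_weight \<alpha> p x * G (exp x) - g x) < e / 2"
    using assms(2) e unfolding approximable_def by blast
  note L = log_weight_schwartz_LpR[OF p \<alpha> F(1)] log_weight_schwartz_LpR[OF p \<alpha> G(1)]
  have "pnorm p (\<lambda>x. log_weight \<alpha> p x * (F (exp x) + G (exp x)) - (f x + g x)) 
    = pnorm p (\<lambda>x. (log_weight \<alpha> p x * F (exp x) - f x) + (log_weight \<alpha> p x * G (exp x) - g x))"
    by (simp add: algebra_simps)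
  also have "\<dots> \<le> pnorm p (\<lambda>x. log_weight \<alpha> p x * F (exp x) - f x) + pnorm p (\<lambda>x. log_weight \<alpha> p x * G (exp x) - g x)"
    by (intro pnorm_triangle LpR_diff_mem p L fg)
  finally have "pnorm p (\<lambda>x. log_weight \<alpha> p x * (F (exp x) + G (exp x)) - (f x + g x)) < e" using F G by linarith
  moreover have "(\<lambda>t. F t + G t) \<in> schwartz_half" by (rule schwartz_half_add[OF F(1) G(1)])
  ultimately show "\<exists>H\<in>schwartz_half. (\<lambda>x. log_weight \<alpha> p x * H (exp x)) \<in> LpR p \<and> pnorm p (\<lambda>x. log_weight \<alpha> p x * H (exp x) - (f x + g x)) < e"
    using log_weight_schwartz_LpR[OF p \<alpha>, of "\<lambda>t. F t + G t"] by (intro bexI[of _ "\<lambda>t. F t + G t"]) auto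
qed

lemma approximable_scale:
  assumes "approximable \<alpha> p f"
  shows "approximable \<alpha> p (\<lambda>x. c * f x)"
  unfolding approximable_def
proof (intro conjI allI impI)
  have f: "f \<in> LpR p" using assms by (auto simp: approximable_def)
  then show "(\<lambda>x. c * f x) \<in> LpR p" by (intro LpR_scale p)
  fix e :: real assume "0 < e"
  then have e: "0 < e / (norm c + 1)" by (simp add: add_nonneg_pos)
  obtain F where F: "F \<in> schwartz_half" "pnorm p (\<lambda>x. log_weight \<alpha> p x * F (exp x) - f x) < e / (norm c + 1)"
    using assms(1) e unfolding approximable_def by blast
  note L = log_weight_schwartz_LpR[OF p \<alpha> F(1)]
  have "pnorm p (\<lambda>x. log_weight \<alpha> p x * (c * F (exp x)) - c * f x) = pnorm p (\<lambda>x. c * (log_weight \<alpha> p x * F (exp x) - f x))"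
    by (simp add: algebra_simps)
  also have "\<dots> = norm c * pnorm p (\<lambda>x. log_weight \<alpha> p x * F (exp x) - f x)"
    by (intro LpR_scale(2) LpR_diff_mem p L f)
  also have "\<dots> \<le> (norm c + 1) * pnorm p (\<lambda>x. log_weight \<alpha> p x * F (exp x) - f x)" by (intro mult_right_mono) auto
  also have "\<dots> < e"
  proof -
    have "0 < norm c + 1" by (simp add: add_nonneg_pos)
    then show ?thesis using F(2) by (simp only: pos_less_divide_eq mult.commute)
  qed
  finally have "pnorm p (\<lambda>x. log_weight \<alpha> p x * (c * F (exp x)) - c * f x) < e" .
  moreover have "(\<lambda>t. c * F t) \<in> schwartz_half" by (rule schwartz_half_scale[OF F(1)])
  ultimately show "\<exists>H\<in>schwartz_half. (\<lambda>x. log_weight \<alpha> p x * H (exp x)) \<in> LpR p \<and> pnorm p (\<lambda>x. log_weight \<alpha> p x * H (exp x) - c * f x) < e"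
    using log_weight_schwartz_LpR[OF p \<alpha>, of "\<lambda>t. c * F t"] by (intro bexI[of _ "\<lambda>t. c * F t"]) auto
qed

lemma approximable_limit:
  assumes g: "\<And>n. approximable \<alpha> p (g n)" and f: "f \<in> LpR p" and lim: "(\<lambda>n. pnorm p (\<lambda>x. g n x - f x)) \<longlonglongrightarrow> 0"
  shows "approximable \<alpha> p f"
  unfolding approximable_def
proof (intro conjI f allI impI)
  fix e :: real assume "0 < e"
  then have e: "0 < e / 2" by simp
  then obtain n where n: "pnorm p (\<lambda>x. g n x - f x) < e / 2"
    using order_tendstoD(2)[OF lim e] by (auto simp: eventually_sequentially)
  obtain F where F: "F \<in> schwartz_half" "pnorm p (\<lambda>x. log_weight \<alpha> p x * F (exp x) - g n x) < e / 2"
    using g[of n] e unfolding approximable_def by blast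
  have gn: "g n \<in> LpR p" using g by (simp add: approximable_def)
  note L = log_weight_schwartz_LpR[OF p \<alpha> F(1)]
  have "pnorm p (\<lambda>x. log_weight \<alpha> p x * F (exp x) - f x) < e"
    using pnorm_diff_triangle3[OF p L gn f] n F(2) by linarith
  then show "\<exists>H\<in>schwartz_half. (\<lambda>x. log_weight \<alpha> p x * H (exp x)) \<in> LpR p \<and> pnorm p (\<lambda>x. log_weight \<alpha> p x * H (exp x) - f x) < e"
    using F(1) L by blast
qed

lemma approximable_0: "approximable \<alpha> p (\<lambda>x. 0)"
proof -
  have "(\<lambda>t. 0) \<in> schwartz_half" unfolding schwartz_half_def by (auto intro!: exI[of _ "\<lambda>n t. 0"])
  then show ?thesis unfolding approximable_def by (auto intro!: bexI[of _ "\<lambda>t. 0"] simp: zero_LpR)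
qed

lemma approximable_sum:
  assumes "finite A" "\<And>a. a \<in> A \<Longrightarrow> approximable \<alpha> p (f a)"
  shows "approximable \<alpha> p (\<lambda>x. \<Sum>a\<in>A. f a x)"
  using assms
proof (induction A)
  case empty
  then show ?case by (simp add: approximable_0)
next
  case (insert a A)
  then have "approximable \<alpha> p (\<lambda>x. f a x + (\<Sum>a\<in>A. f a x))" by (intro approximable_add) auto
  then show ?case using insert(1,2) by simp
qed

text \<open>The weight grows exponentially to the right, hence the cut at \<open>c\<close>; to the
  left of \<open>c\<close> it is dominated by a multiple of a Stieltjes kernel.\<close>

lemma log_weight_half_LpR:
  assumes [measurable]: "B \<in> sets borel" and "B \<subseteq> {..<c}"
  shows "(\<lambda>x. log_weight \<alpha> p x * indicator B x) \<in> LpR p"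
proof -
  obtain k :: nat where k: "\<alpha> + 1 / p < real k" using reals_Archimedean2 by blast
  have G: "Gamma (\<alpha> + 1) > 0" using \<alpha> by (intro Gamma_real_pos) auto
  show ?thesis
  proof (rule LpR_stieltjes_kernel_bound[OF p _ k])
    show "0 < \<alpha> + 1 / p" using \<alpha> p by (simp add: add_pos_pos)
    show "norm (log_weight \<alpha> p x * indicator B x) \<le> (1 + exp c) powr real k / Gamma (\<alpha> + 1) * norm (stieltjes_kernel (\<alpha> + 1 / p) (real k) x)" for x
    proof (cases "x \<in> B")
      case True
      then have "x < c" using assms by auto
      then have "(1 + exp x) powr real k \<le> (1 + exp c) powr real k" by (intro powr_mono2) auto
      moreover have "1 + exp x > 0" by (simp add: add_pos_pos)
      then have "(1 + exp x) powr real k > 0" by simp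
      ultimately have "1 \<le> (1 + exp c) powr real k / (1 + exp x) powr real k" by simp
      then have "exp ((\<alpha> + 1 / p) * x) / Gamma (\<alpha> + 1) * 1 \<le> exp ((\<alpha> + 1 / p) * x) / Gamma (\<alpha> + 1) * ((1 + exp c) powr real k / (1 + exp x) powr real k)"
        using G by (intro mult_left_mono) auto
      moreover have "norm (log_weight \<alpha> p x) = exp ((\<alpha> + 1 / p) * x) / Gamma (\<alpha> + 1)"
        unfolding log_weight_def norm_of_real using G by simp
      ultimately show ?thesis using True unfolding norm_mult norm_stieltjes_kernel by (simp add: mult_ac)
    qed (use G in simp)
  qed measurable
qed

lemma approximable_lessThan: "approximable \<alpha> p (\<lambda>x. log_weight \<alpha> p x * indicator {..<c} x)"
proof (rule approximable_limit)
  \<comment> \<open>At t = exp(x) the exponent is a growing power of exp(x - c). It tends to 0 for x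
    < c and to infinity for x > c, so \<open>H n\<close> approaches the indicator of x < c.\<close>
  define H where "H n t = complex_of_real (exp (- (exp (- c) ^ (2 * Suc n)) * t ^ (2 * Suc n)))" for n and t :: real
  have HS: "H n \<in> schwartz_half" for n unfolding H_def[abs_def] by (rule exp_power_schwartz) auto
  have Hx: "H n (exp x) = complex_of_real (exp (- ((exp (x - c)) ^ (2 * Suc n))))" for n x
    by (simp add: H_def exp_diff exp_minus divide_inverse mult.commute flip: power_mult_distrib)
  show "approximable \<alpha> p (\<lambda>x. log_weight \<alpha> p x * H n (exp x))" for n
    unfolding approximable_def using log_weight_schwartz_LpR[OF p \<alpha> HS[of n]] HS[of n]
    by (auto intro!: bexI[of _ "H n"])
  show LRc: "(\<lambda>x. log_weight \<alpha> p x * indicator {..<c} x) \<in> LpR p" by (rule log_weight_half_LpR[of _ c]) auto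
  show "(\<lambda>n. pnorm p (\<lambda>x. log_weight \<alpha> p x * H n (exp x) - log_weight \<alpha> p x * indicator {..<c} x)) \<longlonglongrightarrow> 0"
  proof (rule pnorm_dominated_convergence[OF p log_weight_schwartz_LpR[OF p \<alpha> HS] LpR_add_mem[OF p LRc log_weight_schwartz_LpR[OF p \<alpha> HS[of 0]]] LRc])
    show "AE x in lborel. norm (log_weight \<alpha> p x * H n (exp x) - log_weight \<alpha> p x * indicator {..<c} x) \<le> norm (log_weight \<alpha> p x * indicator {..<c} x + log_weight \<alpha> p x * H 0 (exp x))" for n
    proof (intro AE_I2)
      fix x
      \<comment> \<open>To the left of \<open>c\<close> the difference is at most 1. From
        \<open>c\<close> on, the powers increase with \<open>n\<close>, so \<open>H n\<close> lies
        below \<open>H 0\<close>. The sum of the indicator and \<open>H 0\<close> thus dominates all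
        differences.\<close>
      have "norm (H n (exp x) - indicator {..<c} x) \<le> norm (indicator {..<c} x + H 0 (exp x))"
      proof (cases "x < c")
        case True
        have "norm (H n (exp x) - indicator {..<c} x) = norm (complex_of_real (exp (- (exp (x - c) ^ (2 * Suc n))) - 1))"
          using True by (simp add: Hx)
        also have "\<dots> \<le> 1" unfolding norm_of_real by (simp add: abs_if)
        also have "\<dots> \<le> norm (complex_of_real (1 + exp (- (exp (x - c) ^ 2))))" unfolding norm_of_real by simp
        also have "\<dots> = norm (indicator {..<c} x + H 0 (exp x))" using True by (simp add: Hx)
        finally show ?thesis .
      next
        case False
        then have "exp (x - c) ^ 2 \<le> exp (x - c) ^ (2 * Suc n)" by (intro power_increasing) auto
        then show ?thesis using False unfolding Hx by simp
      qed
      then have "norm (log_weight \<alpha> p x) * norm (H n (exp x) - indicator {..<c} x) \<le> norm (log_weight \<alpha> p x) * norm (indicator {..<c} x + H 0 (exp x))"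
        by (intro mult_left_mono) auto
      then show "norm (log_weight \<alpha> p x * H n (exp x) - log_weight \<alpha> p x * indicator {..<c} x) \<le> norm (log_weight \<alpha> p x * indicator {..<c} x + log_weight \<alpha> p x * H 0 (exp x))"
        by (simp flip: norm_mult distrib_left right_diff_distrib)
    qed
    \<comment> \<open>At x = c the limit is exp(-1); this single point is discarded.\<close>
    show "AE x in lborel. (\<lambda>n. log_weight \<alpha> p x * H n (exp x)) \<longlonglongrightarrow> log_weight \<alpha> p x * indicator {..<c} x"
      using AE_lborel_singleton[of c]
    proof eventually_elim
      case (elim x)
      have sub: "filterlim (\<lambda>n. 2 * Suc n) sequentially sequentially"
        by (rule filterlim_subseq) (auto simp: strict_mono_def)
      have "(\<lambda>n. complex_of_real (exp (- ((exp (x - c)) ^ (2 * Suc n))))) \<longlonglongrightarrow> indicator {..<c} x"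
      proof (cases "x < c")
        case True
        then have "(\<lambda>k. exp (x - c) ^ k) \<longlonglongrightarrow> 0" by (intro LIMSEQ_realpow_zero) auto
        then have "(\<lambda>n. exp (x - c) ^ (2 * Suc n)) \<longlonglongrightarrow> 0" using sub by (rule filterlim_compose)
        then have "(\<lambda>n. complex_of_real (exp (- ((exp (x - c)) ^ (2 * Suc n))))) \<longlonglongrightarrow> complex_of_real (exp (- 0))"
          by (intro tendsto_intros)
        then show ?thesis using True by simp
      next
        case False
        then have "1 < exp (x - c)" using elim by simp
        then have "filterlim (\<lambda>k. exp (x - c) ^ k) at_top sequentially" 
          by (intro filterlim_at_infinity_imp_filterlim_at_top filterlim_realpow_sequentially_gt1) auto
        then have "filterlim (\<lambda>n. exp (x - c) ^ (2 * Suc n)) at_top sequentially" using sub by (rule filterlim_compose)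
        then have "(\<lambda>n. exp (- (exp (x - c) ^ (2 * Suc n)))) \<longlonglongrightarrow> 0"
          by (intro filterlim_compose[OF exp_at_bot] filterlim_uminus_at_bot_at_top[THEN filterlim_compose])
        then have "(\<lambda>n. complex_of_real (exp (- (exp (x - c) ^ (2 * Suc n))))) \<longlonglongrightarrow> complex_of_real 0" by (intro tendsto_of_real)
        then show ?thesis using False by simp
      qed
      then show ?case unfolding Hx by (intro tendsto_intros)
    qed
  qed
qed

text \<open>Left half lines are closed under intersection and generate the Borel sets, so it
  suffices to treat complements and disjoint unions. The fixed cut at \<open>c\<close> makes
  complements relative to a set on which the weight has finite norm and supplies the dominating
  function for unions.\<close>

lemma approximable_indicator:
  assumes A: "A \<in> sets borel"
  shows "approximable \<alpha> p (\<lambda>x. log_weight \<alpha> p x * indicator (A \<inter> {..<c}) x)"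
proof -
  have s: "sets borel = sigma_sets UNIV (range (lessThan :: real \<Rightarrow> real set))"
    by (subst borel_Iio) (simp add: sets_measure_of)
  have I: "Int_stable (range (lessThan :: real \<Rightarrow> real set))"
  proof -
    have "{..<a} \<inter> {..<b} = {..<min a b}" for a b :: real by auto
    then show ?thesis by (auto simp: Int_stable_def)
  qed
  have P: "range (lessThan :: real \<Rightarrow> real set) \<subseteq> Pow UNIV" by simp
  from I P A[unfolded s] show ?thesis
  proof (induction A rule: sigma_sets_induct_disjoint)
    case (basic A)
    then obtain d where "A = {..<d}" by auto
    then have "A \<inter> {..<c} = {..<min d c}" by auto
    then show ?case using approximable_lessThan by simp
  next
    case empty
    then show ?case using approximable_0 by simp
  next
    case (compl A)
    have "(\<lambda>x. log_weight \<alpha> p x * indicator ((UNIV - A) \<inter> {..<c}) x) = (\<lambda>x. log_weight \<alpha> p x * indicator {..<c} x + (- 1) * (log_weight \<alpha> p x * indicator (A \<inter> {..<c}) x))"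
      by (auto simp: indicator_def fun_eq_iff)
    then show ?case by (simp only:) (intro approximable_add approximable_scale approximable_lessThan compl(2))
  next
    case (union A)
    have [measurable]: "A i \<in> sets borel" for i unfolding s using union(2) by blast
    have d: "indicator (\<Union>i<n. A i \<inter> {..<c}) x = (\<Sum>i<n. indicator (A i \<inter> {..<c}) x :: complex)" for n x
    proof (induction n)
      case (Suc n)
      have "A n \<inter> A i = {}" if "i < n" for i using union(1) that by (auto simp: disjoint_family_on_def)
      then have "(A n \<inter> {..<c}) \<inter> (\<Union>i<n. A i \<inter> {..<c}) = {}" by auto
      then have "indicator (\<Union>i<Suc n. A i \<inter> {..<c}) x = (indicator (A n \<inter> {..<c}) x + indicator (\<Union>i<n. A i \<inter> {..<c}) x :: complex)"
        by (auto simp: indicator_def lessThan_Suc)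
      then show ?case unfolding Suc by simp
    qed simp
    show ?case
    proof (rule approximable_limit)
      show "approximable \<alpha> p (\<lambda>x. \<Sum>i<n. log_weight \<alpha> p x * indicator (A i \<inter> {..<c}) x)" for n
        by (intro approximable_sum union(3)) auto
      show LRu: "(\<lambda>x. log_weight \<alpha> p x * indicator ((\<Union>i. A i) \<inter> {..<c}) x) \<in> LpR p" by (rule log_weight_half_LpR[of _ c]) auto
      have LRc: "(\<lambda>x. log_weight \<alpha> p x * indicator {..<c} x) \<in> LpR p" by (rule log_weight_half_LpR[of _ c]) auto
      show "(\<lambda>n. pnorm p (\<lambda>x. (\<Sum>i<n. log_weight \<alpha> p x * indicator (A i \<inter> {..<c}) x) - log_weight \<alpha> p x * indicator ((\<Union>i. A i) \<inter> {..<c}) x)) \<longlonglongrightarrow> 0"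
        unfolding sum_distrib_left[symmetric] d[symmetric]
      proof (rule pnorm_dominated_convergence[OF p _ LRc LRu])
        show "(\<lambda>x. log_weight \<alpha> p x * indicator (\<Union>i<n. A i \<inter> {..<c}) x) \<in> LpR p" for n by (rule log_weight_half_LpR[of _ c]) auto
        show "AE x in lborel. norm (log_weight \<alpha> p x * indicator (\<Union>i<n. A i \<inter> {..<c}) x - log_weight \<alpha> p x * indicator ((\<Union>i. A i) \<inter> {..<c}) x) \<le> norm (log_weight \<alpha> p x * indicator {..<c} x)" for n
          by (auto simp: indicator_def)
        show "AE x in lborel. (\<lambda>n. log_weight \<alpha> p x * indicator (\<Union>i<n. A i \<inter> {..<c}) x) \<longlonglongrightarrow> log_weight \<alpha> p x * indicator ((\<Union>i. A i) \<inter> {..<c}) x"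
        proof (intro AE_I2 tendsto_mult tendsto_const)
          fix x
          have "(\<lambda>n. indicator (\<Union>i<n. A i \<inter> {..<c}) x :: complex) \<longlonglongrightarrow> indicator (\<Union>i. A i \<inter> {..<c}) x"
            by (rule LIMSEQ_indicator_UN)
          then show "(\<lambda>n. indicator (\<Union>i<n. A i \<inter> {..<c}) x :: complex) \<longlonglongrightarrow> indicator ((\<Union>i. A i) \<inter> {..<c}) x" 
            by (simp only: UN_extend_simps)
        qed
      qed
    qed
  qed
qed

lemma approximable_LpR:
  assumes g: "g \<in> LpR p"
  shows "approximable \<alpha> p g"
proof -
  have [measurable]: "g \<in> borel_measurable borel" using g by (simp add: LpR_def)
  have w0: "log_weight \<alpha> p x \<noteq> 0" for x 
  proof -
    have "Gamma (\<alpha> + 1) > 0" using \<alpha> by (intro Gamma_real_pos) auto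
    then show ?thesis by (simp add: log_weight_def)
  qed
  \<comment> \<open>The weight is divided out so that simple functions approximating
    \<open>q\<close>, truncated on the right and multiplied by the weight, approximate
    \<open>g\<close> with modulus at most twice that of \<open>g\<close>.\<close>
  define q where "q x = g x / log_weight \<alpha> p x" for x
  have [measurable]: "q \<in> borel_measurable borel" unfolding q_def[abs_def] by measurable
  obtain s where s: "\<And>i. simple_function borel (s i)" "\<And>x. (\<lambda>i. s i x) \<longlonglongrightarrow> q x" "\<And>i x. norm (s i x) \<le> 2 * norm (q x)"
    using borel_measurable_implies_sequence_metric[of q borel 0] by (auto simp: dist_norm)
  have [measurable]: "s i \<in> borel_measurable borel" for i by (rule borel_measurable_simple_function[OF s(1)])
  define h where "h i x = log_weight \<alpha> p x * (s i x * indicator {..<real i} x)" for i x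
  have [measurable]: "h i \<in> borel_measurable borel" for i unfolding h_def by measurable
  have hap: "approximable \<alpha> p (h i)" for i
  proof -
    have fin: "finite (range (s i))" using s(1)[of i] by (simp add: simple_function_def)
    have eq: "h i x = (\<Sum>y\<in>range (s i). y * (log_weight \<alpha> p x * indicator (s i -` {y} \<inter> {..<real i}) x))" for x
    proof -
      have "s i x = (\<Sum>y\<in>range (s i). y * indicator (s i -` {y}) x)"
        using fin by (simp add: indicator_def sum.delta' if_distrib[of "\<lambda>z. _ * z"] cong: if_cong)
      then have "h i x = log_weight \<alpha> p x * ((\<Sum>y\<in>range (s i). y * indicator (s i -` {y}) x) * indicator {..<real i} x)" by (simp only: h_def)
      also have "\<dots> = (\<Sum>y\<in>range (s i). y * (log_weight \<alpha> p x * indicator (s i -` {y} \<inter> {..<real i}) x))"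
        by (simp add: sum_distrib_left sum_distrib_right indicator_inter_arith mult_ac)
      finally show ?thesis .
    qed
    have "s i -` {y} \<in> sets borel" for y
      using measurable_sets[of "s i" borel borel "{y}"] by simp
    then have "approximable \<alpha> p (\<lambda>x. \<Sum>y\<in>range (s i). y * (log_weight \<alpha> p x * indicator (s i -` {y} \<inter> {..<real i}) x))"
      by (intro approximable_sum fin approximable_scale approximable_indicator)
    also have "(\<lambda>x. \<Sum>y\<in>range (s i). y * (log_weight \<alpha> p x * indicator (s i -` {y} \<inter> {..<real i}) x)) = h i"
      by (rule ext) (rule eq[symmetric])
    finally show ?thesis .
  qed
  have hle: "norm (h i x) \<le> 2 * norm (g x)" for i x
  proof -
    have "norm (h i x) \<le> norm (log_weight \<alpha> p x) * norm (s i x)" by (auto simp: h_def norm_mult indicator_def)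
    also have "\<dots> \<le> norm (log_weight \<alpha> p x) * (2 * norm (q x))" by (intro mult_left_mono s) auto
    also have "\<dots> = 2 * norm (g x)" using w0[of x] by (simp add: q_def norm_divide)
    finally show ?thesis .
  qed
  show ?thesis
  proof (rule approximable_limit[OF hap g])
    show "(\<lambda>i. pnorm p (\<lambda>x. h i x - g x)) \<longlonglongrightarrow> 0"
    proof (rule pnorm_dominated_convergence[OF p _ LpR_scale(1)[OF p g, of 3] g])
      show "h i \<in> LpR p" for i using hap by (simp add: approximable_def)
      show "AE x in lborel. norm (h i x - g x) \<le> norm (3 * g x)" for i
      proof (intro AE_I2)
        fix x
        show "norm (h i x - g x) \<le> norm (3 * g x)"
          using norm_triangle_ineq4[of "h i x" "g x"] hle[of i x] by (simp add: norm_mult)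
      qed
      show "AE x in lborel. (\<lambda>i. h i x) \<longlonglongrightarrow> g x"
      proof (intro AE_I2)
        fix x
        obtain N where N: "x < real N" using reals_Archimedean2 by blast
        have "\<forall>\<^sub>F i in sequentially. log_weight \<alpha> p x * s i x = h i x"
          using eventually_ge_at_top[of N] by eventually_elim (use N in \<open>auto simp: h_def\<close>)
        moreover have "(\<lambda>i. log_weight \<alpha> p x * s i x) \<longlonglongrightarrow> log_weight \<alpha> p x * q x" by (intro tendsto_intros s)
        ultimately have "(\<lambda>i. h i x) \<longlonglongrightarrow> log_weight \<alpha> p x * q x" by (rule Lim_transform_eventually[rotated])
        then show "(\<lambda>i. h i x) \<longlonglongrightarrow> g x" using w0 by (simp add: q_def)
      qed
    qed
  qed
qed

end

lemma log_D_dense: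
  assumes p: "1 \<le> p" and \<alpha>: "0 < \<alpha>" and g: "g \<in> LpR p"
  obtains u where "\<And>k. u k \<in> schwartz_half" "(\<lambda>k. pnorm p (\<lambda>x. log_D \<alpha> p (u k) x - g x)) \<longlonglongrightarrow> 0"
proof -
  have "\<exists>u\<in>schwartz_half. pnorm p (\<lambda>x. log_D \<alpha> p u x - g x) < 1 / real (Suc k)" for k
  proof -
    obtain H where H: "H \<in> schwartz_half" "pnorm p (\<lambda>x. log_weight \<alpha> p x * H (exp x) - g x) < 1 / real (Suc k)"
      using approximable_LpR[OF p \<alpha> g] unfolding approximable_def by (metis of_nat_0_less_iff zero_less_Suc zero_less_divide_1_iff)
    obtain u where "u \<in> schwartz_half" "log_D \<alpha> p u = (\<lambda>x. log_weight \<alpha> p x * H (exp x))" using log_D_surj[OF \<alpha> H(1)] by blast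
    then show ?thesis using H by (intro bexI[of _ u]) (simp_all only:)
  qed
  then obtain u where u: "\<And>k. u k \<in> schwartz_half" "\<And>k. pnorm p (\<lambda>x. log_D \<alpha> p (u k) x - g x) < 1 / real (Suc k)" by metis
  have "(\<lambda>k. pnorm p (\<lambda>x. log_D \<alpha> p (u k) x - g x)) \<longlonglongrightarrow> 0"
    by (rule Lim_null_comparison[OF _ LIMSEQ_inverse_real_of_nat])
       (use u(2) in \<open>auto intro!: always_eventually less_imp_le simp: inverse_eq_divide\<close>)
  with u(1) that show ?thesis by blast
qed

section \<open>The space \<open>\<T>\<^sub>p\<^sup>(\<^sup>\<alpha>\<^sup>)(t\<^sup>\<alpha>)\<close> as an isometric copy of \<open>L\<^sup>p\<close>\<close>

lemma weyl_kernel_integrable: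
  assumes "1 \<le> p" "0 < \<alpha>"
  shows "integrable lborel (weyl_kernel \<alpha> p)"
  unfolding weyl_kernel_def[abs_def] by (intro integrable_mult_right kober_kernel_integrable) (use assms in auto)

lemma weyl_kernel_injective:
  assumes p: "1 \<le> p" and \<alpha>: "0 < \<alpha>" and g: "g \<in> LpR p" and z: "AE y in lborel. correl (weyl_kernel \<alpha> p) g y = 0"
  shows "AE x in lborel. g x = 0"
proof (rule kober_kernel_injective[OF p \<alpha> g])
  have G: "Gamma (\<alpha> + 1) > 0" using \<alpha> by (intro Gamma_real_pos) auto
  have "correl (weyl_kernel \<alpha> p) g y = of_real (Gamma (\<alpha> + 1)) * correl (kober_kernel 0 \<alpha> p) g y" for y
    unfolding correl_def weyl_kernel_def mult.assoc by (rule integral_mult_right_zero)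
  then show "AE y in lborel. correl (kober_kernel 0 \<alpha> p) g y = 0" using z G by simp
qed

text \<open>The inverse of D_+^\<alpha> from logarithmic coordinates to the half line. Order 0 is
  separate because its kernel would be a point mass.\<close>

definition Tspace_of :: "real \<Rightarrow> real \<Rightarrow> (real \<Rightarrow> complex) \<Rightarrow> real \<Rightarrow> complex" where
  "Tspace_of \<alpha> p g = (if \<alpha> = 0 then from_log p g else from_log p (correl (weyl_kernel \<alpha> p) g))"

context
  fixes p :: real
  assumes p: "1 \<le> p"
begin

lemma Tspace_of_add:
  assumes \<alpha>: "0 \<le> \<alpha>" and f: "f \<in> LpR p" and g: "g \<in> LpR p"
  shows "ae_eq (Tspace_of \<alpha> p (\<lambda>x. f x + g x)) (\<lambda>t. Tspace_of \<alpha> p f t + Tspace_of \<alpha> p g t)"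
proof (cases "\<alpha> = 0")
  case True
  then show ?thesis by (simp add: Tspace_of_def from_log_add)
next
  case False
  then have ei: "integrable lborel (weyl_kernel \<alpha> p)" using p \<alpha> by (intro weyl_kernel_integrable) auto
  have [measurable]: "f \<in> borel_measurable borel" "g \<in> borel_measurable borel" "weyl_kernel \<alpha> p \<in> borel_measurable borel" using f g ei by (auto simp: LpR_def)
  have "ae_eq (from_log p (correl (weyl_kernel \<alpha> p) (\<lambda>x. f x + g x))) (from_log p (\<lambda>x. correl (weyl_kernel \<alpha> p) f x + correl (weyl_kernel \<alpha> p) g x))"
    using correl_add_AE[OF p ei f g] by (subst ae_eq_from_log_iff) auto
  then show ?thesis using False by (simp add: Tspace_of_def from_log_add)
qed

lemma Tspace_of_scale: "Tspace_of \<alpha> p (\<lambda>x. c * g x) = (\<lambda>t. c * Tspace_of \<alpha> p g t)"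
proof -
  have "correl (weyl_kernel \<alpha> p) (\<lambda>x. c * g x) = (\<lambda>x. c * correl (weyl_kernel \<alpha> p) g x)" by (auto simp: correl_scale)
  then show ?thesis by (simp add: Tspace_of_def from_log_scale)
qed

lemma Tspace_of_diff:
  assumes \<alpha>: "0 \<le> \<alpha>" and f: "f \<in> LpR p" and g: "g \<in> LpR p"
  shows "ae_eq (Tspace_of \<alpha> p (\<lambda>x. f x - g x)) (\<lambda>t. Tspace_of \<alpha> p f t - Tspace_of \<alpha> p g t)"
  using Tspace_of_add[OF \<alpha> f LpR_scale(1)[OF p g, of "-1"]] Tspace_of_scale[of \<alpha> "-1" g] by simp

lemma Tspace_of_cong:
  assumes \<alpha>: "0 \<le> \<alpha>" and f: "f \<in> LpR p" and g: "g \<in> LpR p" and ae: "AE x in lborel. f x = g x"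
  shows "ae_eq (Tspace_of \<alpha> p f) (Tspace_of \<alpha> p g)"
proof (cases "\<alpha> = 0")
  case True
  then show ?thesis using f g ae by (simp add: Tspace_of_def ae_eq_from_log_iff LpR_def)
next
  case False
  then have ei: "integrable lborel (weyl_kernel \<alpha> p)" using p \<alpha> by (intro weyl_kernel_integrable) auto
  have "correl (weyl_kernel \<alpha> p) f = correl (weyl_kernel \<alpha> p) g"
    by (rule ext, rule correl_cong_AE[OF _ _ _ ae]) (use f g ei in \<open>auto simp: LpR_def\<close>)
  then show ?thesis using False by (simp add: Tspace_of_def)
qed

lemma Tspace_of_inj:
  assumes \<alpha>: "0 \<le> \<alpha>" and f: "f \<in> LpR p" and g: "g \<in> LpR p" and ae: "ae_eq (Tspace_of \<alpha> p f) (Tspace_of \<alpha> p g)"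
  shows "AE x in lborel. f x = g x"
proof (cases "\<alpha> = 0")
  case True
  then show ?thesis using f g ae by (simp add: Tspace_of_def ae_eq_from_log_iff LpR_def)
next
  case False
  then have \<alpha>0: "0 < \<alpha>" using \<alpha> by simp
  have ei: "integrable lborel (weyl_kernel \<alpha> p)" by (rule weyl_kernel_integrable[OF p \<alpha>0])
  have [measurable]: "f \<in> borel_measurable borel" "g \<in> borel_measurable borel" "weyl_kernel \<alpha> p \<in> borel_measurable borel" using f g ei by (auto simp: LpR_def)
  have "AE x in lborel. correl (weyl_kernel \<alpha> p) f x = correl (weyl_kernel \<alpha> p) g x"
    using ae False by (simp add: Tspace_of_def ae_eq_from_log_iff)
  then have "AE x in lborel. correl (weyl_kernel \<alpha> p) (\<lambda>x. f x - g x) x = 0"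
    using correl_diff_AE[OF p ei f g] by eventually_elim simp
  then have "AE x in lborel. f x - g x = 0" by (rule weyl_kernel_injective[OF p \<alpha>0 LpR_diff_mem[OF p f g]])
  then show ?thesis by simp
qed

lemma Tspace_of_Lp:
  assumes \<alpha>: "0 \<le> \<alpha>" and g: "g \<in> LpR p" and ae: "ae_eq f (Tspace_of \<alpha> p g)"
  shows "f \<in> Lp p"
proof (cases "\<alpha> = 0")
  case True
  then show ?thesis using from_log_Lp_mem[OF p g] ae by (simp add: Tspace_of_def)
next
  case False
  then have ei: "integrable lborel (weyl_kernel \<alpha> p)" using p \<alpha> by (intro weyl_kernel_integrable) auto
  then show ?thesis using from_log_Lp_mem[OF p correl_LpR_mem[OF p ei g]] ae False by (simp add: Tspace_of_def)
qed

text \<open>The place where commutativity of correlations is used: moving the Stieltjes kernel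
  inside \<open>weyl_kernel\<close> removes \<open>\<alpha>\<close> from the operator.\<close>

lemma Tspace_of_stieltjes:
  assumes \<alpha>: "0 \<le> \<alpha>" and g: "g \<in> LpR p" and ae: "ae_eq f (Tspace_of \<alpha> p g)"
    and a: "0 < \<beta> - 1 / p" "\<beta> - 1 / p < \<mu>"
  shows "ae_eq (stieltjes \<beta> \<mu> f) (Tspace_of \<alpha> p (correl (stieltjes_kernel (\<beta> - 1 / p) \<mu>) g))"
proof -
  have st: "ae_eq (stieltjes \<beta> \<mu> f) (from_log p (correl (stieltjes_kernel (\<beta> - 1 / p) \<mu>) h))" if "h \<in> borel_measurable borel" "ae_eq f (from_log p h)" for h
    using stieltjes_from_log[OF p that, of _ \<beta> \<mu>] unfolding ae_eq_def half_line_AE by simp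
  have gm [measurable]: "g \<in> borel_measurable borel" using g by (simp add: LpR_def)
  have phii: "integrable lborel (stieltjes_kernel (\<beta> - 1 / p) \<mu>)" by (rule stieltjes_kernel_integrable[OF a])
  then have [measurable]: "stieltjes_kernel (\<beta> - 1 / p) \<mu> \<in> borel_measurable borel" by auto
  show ?thesis
  proof (cases "\<alpha> = 0")
    case True
    then show ?thesis using st[OF gm] ae by (simp add: Tspace_of_def)
  next
    case False
    then have ei: "integrable lborel (weyl_kernel \<alpha> p)" using p \<alpha> by (intro weyl_kernel_integrable) auto
    then have [measurable]: "weyl_kernel \<alpha> p \<in> borel_measurable borel" by auto
    have "ae_eq (stieltjes \<beta> \<mu> f) (from_log p (correl (stieltjes_kernel (\<beta> - 1 / p) \<mu>) (correl (weyl_kernel \<alpha> p) g)))"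
      by (rule st) (use ae False in \<open>auto simp: Tspace_of_def\<close>)
    moreover have "ae_eq (from_log p (correl (stieltjes_kernel (\<beta> - 1 / p) \<mu>) (correl (weyl_kernel \<alpha> p) g))) (from_log p (correl (weyl_kernel \<alpha> p) (correl (stieltjes_kernel (\<beta> - 1 / p) \<mu>) g)))"
      using correl_commute_AE[OF p phii ei g] by (subst ae_eq_from_log_iff) auto
    ultimately have "ae_eq (stieltjes \<beta> \<mu> f) (from_log p (correl (weyl_kernel \<alpha> p) (correl (stieltjes_kernel (\<beta> - 1 / p) \<mu>) g)))" by (rule ae_eq_trans)
    then show ?thesis using False by (simp add: Tspace_of_def)
  qed
qed

lemma Lp_norm_log_D_diff:
  assumes \<alpha>: "0 < \<alpha>" and u: "u \<in> schwartz_half" and h: "h \<in> LpR p" and f: "ae_eq f (from_log p h)"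
  shows "Lp_norm p (\<lambda>t. u t - f t) = pnorm p (\<lambda>x. correl (weyl_kernel \<alpha> p) (log_D \<alpha> p u) x - h x)"
proof (rule from_log_Lp_norm[OF p])
  have ei: "integrable lborel (weyl_kernel \<alpha> p)" by (rule weyl_kernel_integrable[OF p \<alpha>])
  show "(\<lambda>x. correl (weyl_kernel \<alpha> p) (log_D \<alpha> p u) x - h x) \<in> LpR p"
    by (intro LpR_diff_mem correl_LpR_mem p ei h log_D_LpR \<alpha> u)
  have "ae_eq u (from_log p (correl (weyl_kernel \<alpha> p) (log_D \<alpha> p u)))"
    unfolding ae_eq_def half_line_AE using from_log_correl_weyl_kernel_log_D[OF p \<alpha> u] by simp
  then show "ae_eq (\<lambda>t. u t - f t) (from_log p (\<lambda>x. correl (weyl_kernel \<alpha> p) (log_D \<alpha> p u) x - h x))"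
    unfolding from_log_diff by (rule ae_eq_diff[OF _ f])
qed

lemma schwartz_half_diff:
  assumes "u \<in> schwartz_half" "v \<in> schwartz_half"
  shows "(\<lambda>t. u t - v t) \<in> schwartz_half"
  using schwartz_half_add[OF assms(1) schwartz_half_scale[OF assms(2), of "-1"]] by simp

lemma correl_weyl_kernel_limit:
  assumes \<alpha>: "0 < \<alpha>" and G: "\<And>k. G k \<in> LpR p" and g: "g \<in> LpR p" and lim: "(\<lambda>k. pnorm p (\<lambda>x. G k x - g x)) \<longlonglongrightarrow> 0"
  shows "(\<lambda>k. pnorm p (\<lambda>x. correl (weyl_kernel \<alpha> p) (G k) x - correl (weyl_kernel \<alpha> p) g x)) \<longlonglongrightarrow> 0"
proof -
  have ei: "integrable lborel (weyl_kernel \<alpha> p)" by (rule weyl_kernel_integrable[OF p \<alpha>])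
  have "pnorm p (\<lambda>x. correl (weyl_kernel \<alpha> p) (G k) x - correl (weyl_kernel \<alpha> p) g x) \<le> (LINT x|lborel. norm (weyl_kernel \<alpha> p x)) * pnorm p (\<lambda>x. G k x - g x)" for k
  proof -
    have "pnorm p (\<lambda>x. correl (weyl_kernel \<alpha> p) (G k) x - correl (weyl_kernel \<alpha> p) g x) = pnorm p (correl (weyl_kernel \<alpha> p) (\<lambda>x. G k x - g x))"
    proof (rule LpR_cong_AE(2)[OF correl_LpR_mem[OF p ei LpR_diff_mem[OF p G g]]])
      show "(\<lambda>x. correl (weyl_kernel \<alpha> p) (G k) x - correl (weyl_kernel \<alpha> p) g x) \<in> borel_measurable borel"
        using LpR_diff_mem[OF p correl_LpR_mem[OF p ei G] correl_LpR_mem[OF p ei g]] by (simp add: LpR_def)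
      show "AE x in lborel. correl (weyl_kernel \<alpha> p) (\<lambda>x. G k x - g x) x = correl (weyl_kernel \<alpha> p) (G k) x - correl (weyl_kernel \<alpha> p) g x"
        by (rule correl_diff_AE[OF p ei G g])
    qed
    then show ?thesis using pnorm_correl_le[OF p ei LpR_diff_mem[OF p G g]] by simp
  qed
  then have le: "\<forall>\<^sub>F k in sequentially. norm (pnorm p (\<lambda>x. correl (weyl_kernel \<alpha> p) (G k) x - correl (weyl_kernel \<alpha> p) g x)) \<le> (LINT x|lborel. norm (weyl_kernel \<alpha> p x)) * pnorm p (\<lambda>x. G k x - g x)"
    by (intro always_eventually allI) (simp only: real_norm_def abs_of_nonneg[OF pnorm_nonneg])
  have "(\<lambda>k. (LINT x|lborel. norm (weyl_kernel \<alpha> p x)) * pnorm p (\<lambda>x. G k x - g x)) \<longlonglongrightarrow> (LINT x|lborel. norm (weyl_kernel \<alpha> p x)) * 0"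
    by (rule tendsto_mult[OF tendsto_const lim])
  then show ?thesis using Lim_null_comparison[OF le] by simp
qed

text \<open>By the isometry the functions \<open>log_D\<close> of the sequence are Cauchy, so they
  converge to some \<open>g\<close>. Correlation with \<open>weyl_kernel\<close> is continuous, so
  its value at \<open>g\<close> and \<open>f\<close> are limits of the same sequence in L^p.\<close>

lemma represents_imp_Tspace_of:
  assumes \<alpha>: "0 < \<alpha>" and f: "f \<in> Lp p" and rep: "represents \<alpha> p u f"
  obtains g where "g \<in> LpR p" "ae_eq f (Tspace_of \<alpha> p g)" "(\<lambda>k. schwartz_norm \<alpha> p (u k)) \<longlonglongrightarrow> pnorm p g"
proof -
  have u: "u k \<in> schwartz_half" for k using rep by (simp add: represents_def)
  have ei: "integrable lborel (weyl_kernel \<alpha> p)" by (rule weyl_kernel_integrable[OF p \<alpha>])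
  have G: "log_D \<alpha> p (u k) \<in> LpR p" for k by (rule log_D_LpR[OF p \<alpha> u])
  have cauchy: "\<exists>N. \<forall>j\<ge>N. \<forall>k\<ge>N. pnorm p (\<lambda>x. log_D \<alpha> p (u j) x - log_D \<alpha> p (u k) x) < e" if "0 < e" for e
    using rep that unfolding represents_def
    by (simp add: schwartz_norm_eq[OF p \<alpha> schwartz_half_diff[OF u u]] log_D_diff[OF \<alpha> u u])
  obtain g where g: "g \<in> LpR p" "(\<lambda>k. pnorm p (\<lambda>x. log_D \<alpha> p (u k) x - g x)) \<longlonglongrightarrow> 0"
    by (rule LpR_complete[OF p G cauchy])
  obtain h where h: "h \<in> LpR p" "ae_eq f (from_log p h)" using Lp_imp_from_log[OF p f] by blast
  have "(\<lambda>k. pnorm p (\<lambda>x. correl (weyl_kernel \<alpha> p) (log_D \<alpha> p (u k)) x - h x)) \<longlonglongrightarrow> 0"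
    using rep unfolding represents_def by (simp add: Lp_norm_log_D_diff[OF \<alpha> u h])
  then have "AE x in lborel. h x = correl (weyl_kernel \<alpha> p) g x"
    by (rule pnorm_limit_unique[OF p correl_LpR_mem[OF p ei G] h(1) correl_LpR_mem[OF p ei g(1)] _ correl_weyl_kernel_limit[OF \<alpha> G g]])
  then have "ae_eq (from_log p h) (from_log p (correl (weyl_kernel \<alpha> p) g))"
    using h(1) correl_LpR_mem[OF p ei g(1)] by (subst ae_eq_from_log_iff) (auto simp: LpR_def)
  then have "ae_eq f (Tspace_of \<alpha> p g)" using ae_eq_trans[OF h(2)] \<alpha> by (simp add: Tspace_of_def)
  moreover have "(\<lambda>k. schwartz_norm \<alpha> p (u k)) \<longlonglongrightarrow> pnorm p g"
    using pnorm_tendsto[OF p G g] by (simp add: schwartz_norm_eq[OF p \<alpha> u])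
  ultimately show ?thesis using g(1) that by blast
qed

text \<open>Density supplies Schwartz functions whose \<open>log_D\<close> tends to
  \<open>g\<close>; the isometry makes them Cauchy and continuity of the inverse makes them converge
  to \<open>f\<close>.\<close>

lemma Tspace_of_imp_represents:
  assumes \<alpha>: "0 < \<alpha>" and g: "g \<in> LpR p" and ae: "ae_eq f (Tspace_of \<alpha> p g)"
  obtains u where "represents \<alpha> p u f" "(\<lambda>k. schwartz_norm \<alpha> p (u k)) \<longlonglongrightarrow> pnorm p g"
proof -
  obtain u where u: "\<And>k. u k \<in> schwartz_half" and lim: "(\<lambda>k. pnorm p (\<lambda>x. log_D \<alpha> p (u k) x - g x)) \<longlonglongrightarrow> 0"
    using log_D_dense[OF p \<alpha> g] by blast
  have ei: "integrable lborel (weyl_kernel \<alpha> p)" by (rule weyl_kernel_integrable[OF p \<alpha>])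
  have G: "log_D \<alpha> p (u k) \<in> LpR p" for k by (rule log_D_LpR[OF p \<alpha> u])
  have ae': "ae_eq f (from_log p (correl (weyl_kernel \<alpha> p) g))" using ae \<alpha> by (simp add: Tspace_of_def)
  have "\<exists>N. \<forall>j\<ge>N. \<forall>k\<ge>N. schwartz_norm \<alpha> p (\<lambda>t. u j t - u k t) < e" if e: "0 < e" for e
  proof -
    obtain N where N: "\<And>k. N \<le> k \<Longrightarrow> pnorm p (\<lambda>x. log_D \<alpha> p (u k) x - g x) < e / 2"
      using order_tendstoD(2)[OF lim, of "e / 2"] e by (auto simp: eventually_sequentially)
    have "schwartz_norm \<alpha> p (\<lambda>t. u j t - u k t) < e" if "N \<le> j" "N \<le> k" for j k
    proof -
      have "schwartz_norm \<alpha> p (\<lambda>t. u j t - u k t) = pnorm p (\<lambda>x. log_D \<alpha> p (u j) x - log_D \<alpha> p (u k) x)"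
        by (simp add: schwartz_norm_eq[OF p \<alpha> schwartz_half_diff[OF u u]] log_D_diff[OF \<alpha> u u])
      also have "\<dots> \<le> pnorm p (\<lambda>x. log_D \<alpha> p (u j) x - g x) + pnorm p (\<lambda>x. log_D \<alpha> p (u k) x - g x)"
        using pnorm_diff_triangle3[OF p G g G] by (simp add: pnorm_minus_commute[of p g])
      also have "\<dots> < e" using N[OF that(1)] N[OF that(2)] by simp
      finally show ?thesis .
    qed
    then show ?thesis by blast
  qed
  moreover have "(\<lambda>k. Lp_norm p (\<lambda>t. u k t - f t)) \<longlonglongrightarrow> 0"
    using correl_weyl_kernel_limit[OF \<alpha> G g lim] by (simp add: Lp_norm_log_D_diff[OF \<alpha> u correl_LpR_mem[OF p ei g] ae'])
  ultimately have "represents \<alpha> p u f" using u by (simp add: represents_def)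
  moreover have "(\<lambda>k. schwartz_norm \<alpha> p (u k)) \<longlonglongrightarrow> pnorm p g"
    using pnorm_tendsto[OF p G g lim] by (simp add: schwartz_norm_eq[OF p \<alpha> u])
  ultimately show ?thesis by (rule that)
qed

lemma Tspace_iff:
  assumes \<alpha>: "0 \<le> \<alpha>"
  shows "f \<in> Tspace \<alpha> p \<longleftrightarrow> (\<exists>g\<in>LpR p. ae_eq f (Tspace_of \<alpha> p g))"
proof (cases "\<alpha> = 0")
  case True
  have "f \<in> Lp p \<longleftrightarrow> (\<exists>g\<in>LpR p. ae_eq f (from_log p g))"
  proof
    assume "f \<in> Lp p"
    then obtain g where "g \<in> LpR p" "ae_eq f (from_log p g)" by (rule Lp_imp_from_log[OF p])
    then show "\<exists>g\<in>LpR p. ae_eq f (from_log p g)" by blast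
  next
    assume "\<exists>g\<in>LpR p. ae_eq f (from_log p g)"
    then show "f \<in> Lp p" using from_log_Lp_mem[OF p] by blast
  qed
  then show ?thesis using True by (simp add: Tspace_def Tspace_of_def)
next
  case False
  then have \<alpha>0: "0 < \<alpha>" using \<alpha> by simp
  show ?thesis
  proof
    assume "f \<in> Tspace \<alpha> p"
    then obtain u where "f \<in> Lp p" "represents \<alpha> p u f" using False by (auto simp: Tspace_def)
    then show "\<exists>g\<in>LpR p. ae_eq f (Tspace_of \<alpha> p g)" using represents_imp_Tspace_of[OF \<alpha>0] by metis
  next
    assume "\<exists>g\<in>LpR p. ae_eq f (Tspace_of \<alpha> p g)"
    then obtain g where g: "g \<in> LpR p" "ae_eq f (Tspace_of \<alpha> p g)" by blast
    then obtain u where "represents \<alpha> p u f" using Tspace_of_imp_represents[OF \<alpha>0] by blast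
    then show "f \<in> Tspace \<alpha> p" using Tspace_of_Lp[OF \<alpha> g] False by (auto simp: Tspace_def)
  qed
qed

lemma Tnorm_eq:
  assumes \<alpha>: "0 \<le> \<alpha>" and g: "g \<in> LpR p" and ae: "ae_eq f (Tspace_of \<alpha> p g)"
  shows "Tnorm \<alpha> p f = pnorm p g"
proof (cases "\<alpha> = 0")
  case True
  then show ?thesis using from_log_Lp_norm[OF p g] ae by (simp add: Tnorm_def Tspace_of_def)
next
  case False
  then have \<alpha>0: "0 < \<alpha>" using \<alpha> by simp
  have "(THE l. \<exists>u. represents \<alpha> p u f \<and> (\<lambda>k. schwartz_norm \<alpha> p (u k)) \<longlonglongrightarrow> l) = pnorm p g"
  proof (rule the_equality)
    show "\<exists>u. represents \<alpha> p u f \<and> (\<lambda>k. schwartz_norm \<alpha> p (u k)) \<longlonglongrightarrow> pnorm p g"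
      using Tspace_of_imp_represents[OF \<alpha>0 g ae] by blast
    \<comment> \<open>Uniqueness of the value picked by \<open>THE\<close>: any other representing
      sequence yields an \<open>h\<close> with the same image, and injectivity identifies
      \<open>h\<close> with \<open>g\<close> almost everywhere.\<close>
    fix l assume "\<exists>u. represents \<alpha> p u f \<and> (\<lambda>k. schwartz_norm \<alpha> p (u k)) \<longlonglongrightarrow> l"
    then obtain u where u: "represents \<alpha> p u f" "(\<lambda>k. schwartz_norm \<alpha> p (u k)) \<longlonglongrightarrow> l" by blast
    obtain h where h: "h \<in> LpR p" "ae_eq f (Tspace_of \<alpha> p h)" "(\<lambda>k. schwartz_norm \<alpha> p (u k)) \<longlonglongrightarrow> pnorm p h"
      using represents_imp_Tspace_of[OF \<alpha>0 Tspace_of_Lp[OF \<alpha> g ae] u(1)] by blast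
    have "AE x in lborel. h x = g x"
      by (rule Tspace_of_inj[OF \<alpha> h(1) g ae_eq_trans[OF ae_eq_sym[OF h(2)] ae]])
    then have "pnorm p g = pnorm p h" using LpR_cong_AE(2)[OF h(1) LpR_measurable[OF g]] by simp
    then show "l = pnorm p g" using LIMSEQ_unique[OF u(2) h(3)] by simp
  qed
  then show ?thesis using False by (simp add: Tnorm_def)
qed

end

section \<open>The spectrum\<close>

text \<open>With kernels multiplied by \<open>convol\<close>, (z - \<phi>) (1/z + \<psi>) = 1 + (z
  \<psi> - \<phi>/z - \<phi> \<psi>) = 1, where \<phi> is the Stieltjes kernel. The other order
  follows as correlations commute.\<close>

lemma resolvent_identities:
  assumes p: "1 \<le> p" and a: "0 < a" "a < \<mu>" and z: "z \<noteq> 0" 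
    and \<psi>: "integrable lborel \<psi>" "\<And>x. convol (stieltjes_kernel a \<mu>) \<psi> x = z * \<psi> x - stieltjes_kernel a \<mu> x / z"
    and g: "g \<in> LpR p"
  defines "Q \<equiv> \<lambda>h x. 1 / z * h x + correl \<psi> h x"
  shows "AE x in lborel. z * Q g x - correl (stieltjes_kernel a \<mu>) (Q g) x = g x"
    and "AE x in lborel. Q (\<lambda>x. z * g x - correl (stieltjes_kernel a \<mu>) g x) x = g x"
proof -
  have phii: "integrable lborel (stieltjes_kernel a \<mu>)" by (rule stieltjes_kernel_integrable[OF a])
  have cg: "correl \<psi> g \<in> LpR p" "correl (stieltjes_kernel a \<mu>) g \<in> LpR p" using correl_LpR_mem[OF p _ g] \<psi>(1) phii by auto
  have conv: "AE x in lborel. correl (stieltjes_kernel a \<mu>) (correl \<psi> g) x = z * correl \<psi> g x - 1 / z * correl (stieltjes_kernel a \<mu>) g x"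
    using correl_convol_AE[OF p phii \<psi>(1) g] correl_AE_integrable[OF p phii g] correl_AE_integrable[OF p \<psi>(1) g]
  proof eventually_elim
    case (elim y)
    have "correl (convol (stieltjes_kernel a \<mu>) \<psi>) g y = (LINT x|lborel. z * (\<psi> x * g (y + x)) - 1 / z * (stieltjes_kernel a \<mu> x * g (y + x)))"
      unfolding correl_def \<psi>(2) by (intro Bochner_Integration.integral_cong) (auto simp: algebra_simps)
    also have "\<dots> = z * correl \<psi> g y - 1 / z * correl (stieltjes_kernel a \<mu>) g y"
      unfolding correl_def using elim(2,3) by (subst Bochner_Integration.integral_diff) auto
    finally show ?case using elim(1) by simp
  qed
  show "AE x in lborel. z * Q g x - correl (stieltjes_kernel a \<mu>) (Q g) x = g x"
    using conv correl_add_AE[OF p phii LpR_scale(1)[OF p g, of "1 / z"] cg(1)]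
    unfolding Q_def correl_scale by eventually_elim (use z in \<open>simp add: field_simps\<close>)
  show "AE x in lborel. Q (\<lambda>x. z * g x - correl (stieltjes_kernel a \<mu>) g x) x = g x"
    using conv correl_commute_AE[OF p phii \<psi>(1) g] correl_diff_AE[OF p \<psi>(1) LpR_scale(1)[OF p g, of z] cg(2)]
    unfolding Q_def correl_scale
  proof eventually_elim
    case (elim x)
    then have "correl \<psi> (\<lambda>x. z * g x - correl (stieltjes_kernel a \<mu>) g x) x = 1 / z * correl (stieltjes_kernel a \<mu>) g x" by simp
    then show ?case using z by (simp add: field_simps)
  qed
qed

lemma stieltjes_resolvent_exists:
  assumes \<alpha>: "0 \<le> \<alpha>" and p: "1 \<le> p" and a: "0 < \<beta> - 1 / p" "\<beta> - 1 / p < \<mu>"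
    and z: "z \<noteq> 0" "\<And>\<xi>. z \<noteq> stieltjes_symbol (\<beta> - 1 / p) \<mu> (\<i> * of_real \<xi>)"
  shows "z \<notin> spectrum_on (Tspace \<alpha> p) (Tnorm \<alpha> p) (stieltjes \<beta> \<mu>)"
proof -
  define \<phi> where "\<phi> = stieltjes_kernel (\<beta> - 1 / p) \<mu>"
  obtain \<psi> where \<psi>: "integrable lborel \<psi>" "\<And>x. convol (stieltjes_kernel (\<beta> - 1 / p) \<mu>) \<psi> x = z * \<psi> x - stieltjes_kernel (\<beta> - 1 / p) \<mu> x / z"
    using resolvent_kernel[OF a z] by blast
  define Q where "Q h x = 1 / z * h x + correl \<psi> h x" for h x
  note res = resolvent_identities[OF p a z(1) \<psi>, folded Q_def \<phi>_def]
  have phii: "integrable lborel \<phi>" unfolding \<phi>_def by (rule stieltjes_kernel_integrable[OF a])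
  have QLR: "Q h \<in> LpR p" if "h \<in> LpR p" for h
    unfolding Q_def[abs_def] by (intro LpR_add_mem LpR_scale correl_LpR_mem p \<psi> that)
  have zLR: "(\<lambda>x. z * h x - correl \<phi> h x) \<in> LpR p" if "h \<in> LpR p" for h
    by (intro LpR_diff_mem LpR_scale correl_LpR_mem p phii that)
  define K where "K = norm (1 / z) + (LINT x|lborel. norm (\<psi> x))"
  have Qle: "pnorm p (Q h) \<le> K * pnorm p h" if h: "h \<in> LpR p" for h
  proof -
    have "pnorm p (Q h) \<le> pnorm p (\<lambda>x. 1 / z * h x) + pnorm p (correl \<psi> h)"
      unfolding Q_def[abs_def] by (intro pnorm_triangle LpR_scale correl_LpR_mem p \<psi> h)
    also have "\<dots> \<le> norm (1 / z) * pnorm p h + (LINT x|lborel. norm (\<psi> x)) * pnorm p h"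
      using LpR_scale(2)[OF p h, of "1 / z"] pnorm_correl_le[OF p \<psi>(1) h] by simp
    finally show ?thesis by (simp add: K_def algebra_simps)
  qed
  let ?V = "Tspace \<alpha> p" and ?J = "Tspace_of \<alpha> p" and ?A = "stieltjes \<beta> \<mu>"
  \<comment> \<open>The choice need not be linear in \<open>f\<close>, but
    \<open>Tspace_of_inj\<close> makes it unique up to null sets. Fact \<open>R\<close> below
    therefore lets any convenient representative replace the chosen one.\<close>
  define pick where "pick f = (SOME g. g \<in> LpR p \<and> ae_eq f (?J g))" for f
  have pick: "pick f \<in> LpR p" "ae_eq f (?J (pick f))" if "f \<in> ?V" for f
    using someI_ex[of "\<lambda>g. g \<in> LpR p \<and> ae_eq f (?J g)"] that Tspace_iff[OF p \<alpha>, of f] unfolding pick_def by blast+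
  define R where "R f = ?J (Q (pick f))" for f
  have V: "f \<in> ?V" if "g \<in> LpR p" "ae_eq f (?J g)" for f g using Tspace_iff[OF p \<alpha>] that by blast
  have R: "ae_eq (R f) (?J (Q g))" if g: "g \<in> LpR p" and ae: "ae_eq f (?J g)" for f g
  proof -
    note f = pick[OF V[OF g ae]]
    have eq: "AE x in lborel. pick f x = g x"
      by (rule Tspace_of_inj[OF p \<alpha> f(1) g ae_eq_trans[OF ae_eq_sym[OF f(2)] ae]])
    have "correl \<psi> (pick f) x = correl \<psi> g x" for x
      by (rule correl_cong_AE[OF _ _ _ eq]) (use \<psi>(1) f(1) g in \<open>auto simp: LpR_def\<close>)
    then have "AE x in lborel. Q (pick f) x = Q g x" using eq by (auto simp: Q_def elim: eventually_mono)
    then show ?thesis unfolding R_def by (rule Tspace_of_cong[OF p \<alpha> QLR[OF f(1)] QLR[OF g]])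
  qed
  have A: "ae_eq (?A f) (?J (correl \<phi> g))" if "g \<in> LpR p" "ae_eq f (?J g)" for f g
    unfolding \<phi>_def by (rule Tspace_of_stieltjes[OF p \<alpha> that a])
  have zA: "ae_eq (\<lambda>t. z * f t - ?A f t) (?J (\<lambda>x. z * g x - correl \<phi> g x))" if g: "g \<in> LpR p" "ae_eq f (?J g)" for f g
  proof -
    have "ae_eq (\<lambda>t. z * f t - ?A f t) (\<lambda>t. z * ?J g t - ?J (correl \<phi> g) t)"
      by (intro ae_eq_diff ae_eq_scale g A)
    also have "(\<lambda>t. z * ?J g t - ?J (correl \<phi> g) t) = (\<lambda>t. ?J (\<lambda>x. z * g x) t - ?J (correl \<phi> g) t)"
      by (simp only: Tspace_of_scale[OF p])
    finally show ?thesis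
      using Tspace_of_diff[OF p \<alpha> LpR_scale(1)[OF p g(1), of z] correl_LpR_mem[OF p phii g(1)]] ae_eq_trans ae_eq_sym by blast
  qed
  have "bounded_operator ?V (Tnorm \<alpha> p) R"
    unfolding bounded_operator_def
  proof (intro conjI ballI allI impI exI[of _ K])
    fix f assume f: "f \<in> ?V"
    show "R f \<in> ?V" unfolding R_def by (rule V[OF QLR[OF pick(1)[OF f]]]) simp
    show "Tnorm \<alpha> p (R f) \<le> K * Tnorm \<alpha> p f"
      using Qle[OF pick(1)[OF f]] Tnorm_eq[OF p \<alpha> pick[OF f]] Tnorm_eq[OF p \<alpha> QLR[OF pick(1)[OF f]] ae_eq_refl]
      by (simp add: R_def)
    show "ae_eq (R (\<lambda>t. c * f t)) (\<lambda>t. c * R f t)" for c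
    proof -
      have "ae_eq (\<lambda>t. c * f t) (?J (\<lambda>x. c * pick f x))"
        unfolding Tspace_of_scale[OF p] by (intro ae_eq_scale pick f)
      then have "ae_eq (R (\<lambda>t. c * f t)) (?J (Q (\<lambda>x. c * pick f x)))"
        by (rule R[OF LpR_scale(1)[OF p pick(1)[OF f]]])
      also have "Q (\<lambda>x. c * pick f x) = (\<lambda>x. c * Q (pick f) x)"
        by (auto simp: Q_def correl_scale algebra_simps)
      finally show ?thesis by (simp add: R_def Tspace_of_scale[OF p])
    qed
    fix g assume g: "g \<in> ?V"
    show "ae_eq (R f) (R g)" if "ae_eq f g"
      unfolding R_def[of g] by (rule R[OF pick(1)[OF g] ae_eq_trans[OF that pick(2)[OF g]]])
    show "ae_eq (R (\<lambda>t. f t + g t)) (\<lambda>t. R f t + R g t)"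
    proof -
      note pf = pick[OF f] and pg = pick[OF g]
      have "ae_eq (\<lambda>t. f t + g t) (?J (\<lambda>x. pick f x + pick g x))"
        by (rule ae_eq_trans[OF ae_eq_add[OF pf(2) pg(2)] ae_eq_sym[OF Tspace_of_add[OF p \<alpha> pf(1) pg(1)]]])
      then have "ae_eq (R (\<lambda>t. f t + g t)) (?J (Q (\<lambda>x. pick f x + pick g x)))"
        by (rule R[OF LpR_add_mem[OF p pf(1) pg(1)]])
      moreover have "ae_eq (?J (Q (\<lambda>x. pick f x + pick g x))) (?J (\<lambda>x. Q (pick f) x + Q (pick g) x))"
      proof (rule Tspace_of_cong[OF p \<alpha> QLR[OF LpR_add_mem[OF p pf(1) pg(1)]] LpR_add_mem[OF p QLR[OF pf(1)] QLR[OF pg(1)]]])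
        show "AE x in lborel. Q (\<lambda>x. pick f x + pick g x) x = Q (pick f) x + Q (pick g) x"
          using correl_add_AE[OF p \<psi>(1) pf(1) pg(1)] by eventually_elim (simp add: Q_def algebra_simps)
      qed
      moreover have "ae_eq (?J (\<lambda>x. Q (pick f) x + Q (pick g) x)) (\<lambda>t. R f t + R g t)"
        unfolding R_def by (rule Tspace_of_add[OF p \<alpha> QLR[OF pf(1)] QLR[OF pg(1)]])
      ultimately show ?thesis using ae_eq_trans by blast
    qed
  qed
  moreover have "ae_eq (R (\<lambda>t. z * f t - ?A f t)) f \<and> ae_eq (\<lambda>t. z * R f t - ?A (R f) t) f" if f: "f \<in> ?V" for f
  proof
    note pf = pick[OF f]
    have "ae_eq (R (\<lambda>t. z * f t - ?A f t)) (?J (Q (\<lambda>x. z * pick f x - correl \<phi> (pick f) x)))"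
      by (rule R[OF zLR[OF pf(1)] zA[OF pf]])
    moreover have "ae_eq (?J (Q (\<lambda>x. z * pick f x - correl \<phi> (pick f) x))) (?J (pick f))"
      by (rule Tspace_of_cong[OF p \<alpha> QLR[OF zLR[OF pf(1)]] pf(1)]) (use res(2)[OF pf(1)] in \<open>simp add: Q_def\<close>)
    ultimately show "ae_eq (R (\<lambda>t. z * f t - ?A f t)) f" using ae_eq_trans ae_eq_sym[OF pf(2)] by blast
    have "ae_eq (\<lambda>t. z * R f t - ?A (R f) t) (?J (\<lambda>x. z * Q (pick f) x - correl \<phi> (Q (pick f)) x))"
      by (rule zA[OF QLR[OF pf(1)]]) (simp add: R_def)
    moreover have "ae_eq (?J (\<lambda>x. z * Q (pick f) x - correl \<phi> (Q (pick f)) x)) (?J (pick f))"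
      by (rule Tspace_of_cong[OF p \<alpha> zLR[OF QLR[OF pf(1)]] pf(1)]) (use res(1)[OF pf(1)] in \<open>simp add: Q_def[abs_def]\<close>)
    ultimately show "ae_eq (\<lambda>t. z * R f t - ?A (R f) t) f" using ae_eq_trans ae_eq_sym[OF pf(2)] by blast
  qed
  ultimately have "\<exists>R. bounded_operator ?V (Tnorm \<alpha> p) R \<and> (\<forall>f\<in>?V. ae_eq (R (\<lambda>t. z * f t - ?A f t)) f \<and> ae_eq (\<lambda>t. z * R f t - ?A (R f) t) f)"
    by (intro exI[of _ R] conjI ballI) simp_all
  then show ?thesis by (simp add: spectrum_on_def)
qed

text \<open>A bounded resolvent recovers an approximate eigenvector from its defect, so the norm of
  the vector would be at most a fixed multiple of an arbitrarily small part of itself.\<close>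

lemma stieltjes_spectrum_mem:
  assumes \<alpha>: "0 \<le> \<alpha>" and p: "1 \<le> p" and a: "0 < \<beta> - 1 / p" "\<beta> - 1 / p < \<mu>"
    and z: "z = 0 \<or> (\<exists>\<xi>. z = stieltjes_symbol (\<beta> - 1 / p) \<mu> (\<i> * of_real \<xi>))"
  shows "z \<in> spectrum_on (Tspace \<alpha> p) (Tnorm \<alpha> p) (stieltjes \<beta> \<mu>)"
proof (rule ccontr)
  let ?V = "Tspace \<alpha> p" and ?J = "Tspace_of \<alpha> p" and ?A = "stieltjes \<beta> \<mu>" and ?\<phi> = "stieltjes_kernel (\<beta> - 1 / p) \<mu>"
  assume "\<not> ?thesis"
  then obtain R where "bounded_operator ?V (Tnorm \<alpha> p) R" and inv: "\<And>f. f \<in> ?V \<Longrightarrow> ae_eq (R (\<lambda>t. z * f t - ?A f t)) f"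
    unfolding spectrum_on_def by blast
  then obtain C where C: "\<And>f. f \<in> ?V \<Longrightarrow> Tnorm \<alpha> p (R f) \<le> C * Tnorm \<alpha> p f"
    unfolding bounded_operator_def by blast
  \<comment> \<open>\<open>\<bar>C\<bar> + 1\<close> replaces \<open>C\<close>, whose sign is
    unknown, and \<open>e\<close> makes its product with this positive constant equal to
    1/2.\<close>
  define e where "e = 1 / (2 * (\<bar>C\<bar> + 1))"
  have e: "0 < e" "(\<bar>C\<bar> + 1) * e = 1 / 2" by (auto simp: e_def add_nonneg_pos)
  obtain g where g: "g \<in> LpR p" "0 < pnorm p g" "pnorm p (\<lambda>x. z * g x - correl ?\<phi> g x) \<le> e * pnorm p g"
    using approximate_eigenvector_closure[OF a p e(1) z] by blast
  define d where "d = (\<lambda>x. z * g x - correl ?\<phi> g x)"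
  have cg: "correl ?\<phi> g \<in> LpR p" by (rule correl_LpR_mem[OF p stieltjes_kernel_integrable[OF a] g(1)])
  have d: "d \<in> LpR p" unfolding d_def by (intro LpR_diff_mem LpR_scale p g cg)
  define h where "h = (\<lambda>t. z * ?J g t - ?A (?J g) t)"
  have "ae_eq h (\<lambda>t. z * ?J g t - ?J (correl ?\<phi> g) t)"
    unfolding h_def by (intro ae_eq_diff ae_eq_refl Tspace_of_stieltjes p \<alpha> g a)
  also have "(\<lambda>t. z * ?J g t - ?J (correl ?\<phi> g) t) = (\<lambda>t. ?J (\<lambda>x. z * g x) t - ?J (correl ?\<phi> g) t)"
    by (simp only: Tspace_of_scale[OF p])
  finally have hd: "ae_eq h (?J d)"
    unfolding d_def using Tspace_of_diff[OF p \<alpha> LpR_scale(1)[OF p g(1), of z] cg] ae_eq_trans ae_eq_sym by blast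
  have hV: "h \<in> ?V" using Tspace_iff[OF p \<alpha>] d hd by blast
  have "?J g \<in> ?V" using Tspace_iff[OF p \<alpha>] g(1) ae_eq_refl by blast
  then have "ae_eq (R h) (?J g)" unfolding h_def by (rule inv)
  then have "pnorm p g = Tnorm \<alpha> p (R h)" using Tnorm_eq[OF p \<alpha> g(1)] by simp
  also have "\<dots> \<le> C * Tnorm \<alpha> p h" by (rule C[OF hV])
  also have "Tnorm \<alpha> p h = pnorm p d" by (rule Tnorm_eq[OF p \<alpha> d hd])
  also have "C * pnorm p d \<le> (\<bar>C\<bar> + 1) * pnorm p d" by (intro mult_right_mono) auto
  also have "\<dots> \<le> (\<bar>C\<bar> + 1) * (e * pnorm p g)" using g(3) unfolding d_def by (intro mult_left_mono) auto
  also have "\<dots> = pnorm p g / 2" using e(2) by (simp flip: mult.assoc)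
  finally show False using g(2) by simp
qed

theorem theorem5:
  fixes \<alpha> p \<beta> \<mu> :: real
  assumes "\<alpha> \<ge> 0" and "1 \<le> p"
    and "0 < \<beta> - 1 / p" and "\<beta> - 1 / p < \<mu>"
  shows "spectrum_on (Tspace \<alpha> p) (Tnorm \<alpha> p) (stieltjes \<beta> \<mu>) =
    {Beta (of_real (\<beta> - 1 / p) + \<i> * of_real \<xi>) (of_real (\<mu> - \<beta> + 1 / p) - \<i> * of_real \<xi>) | \<xi> :: real. True} \<union> {0}"
proof -
  have eq: "\<mu> - \<beta> + 1 / p = \<mu> - (\<beta> - 1 / p)" by simp
  show ?thesis
    unfolding eq stieltjes_symbol_def[symmetric]
  proof (intro equalityI subsetI)
    fix z assume "z \<in> spectrum_on (Tspace \<alpha> p) (Tnorm \<alpha> p) (stieltjes \<beta> \<mu>)"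
    then show "z \<in> {stieltjes_symbol (\<beta> - 1 / p) \<mu> (\<i> * of_real \<xi>) | \<xi> :: real. True} \<union> {0}"
      using stieltjes_resolvent_exists[OF assms, of z] by blast
  next
    fix z assume "z \<in> {stieltjes_symbol (\<beta> - 1 / p) \<mu> (\<i> * of_real \<xi>) | \<xi> :: real. True} \<union> {0}"
    then have "z = 0 \<or> (\<exists>\<xi>. z = stieltjes_symbol (\<beta> - 1 / p) \<mu> (\<i> * of_real \<xi>))" by blast
    then show "z \<in> spectrum_on (Tspace \<alpha> p) (Tnorm \<alpha> p) (stieltjes \<beta> \<mu>)"
      by (rule stieltjes_spectrum_mem[OF assms])
  qed
qed

end
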